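(* If $n\ge8$ is even (respectively, $n\ge9$ is odd) and $d\equiv n\bmod2$, then there exists a positive definite even lattice $L$ of rank $n$ such that the space of Jacobi forms of singular weight $J_{\frac n2,L}(v_\eta^d)$ is non-zero.
   Context: Let $L$ be a positive definite even lattice with form $(\cdot,\cdot)$ (extended bilinearly to $L\otimes\mathbb C$) and dual $L^\vee$. $v_\eta$ is the multiplier system of the Dedekind eta function: $\eta(\frac{a\tau+b}{c\tau+e})=v_\eta(A)(c\tau+e)^{1/2}\eta(\tau)$ for $A=\begin{pmatrix}a&b\\c&e\end{pmatrix}\in\mathrm{SL}_2(\mathbb Z)$ (principal branch). For $k\in\frac12\mathbb Z$, $d\in\mathbb Z$, $J_{k,L}(v_\eta^d)$ (index one) is the space of holomorphic $\varphi:\mathbb H\times(L\otimes\mathbb C)\to\mathbb C$ such that $\varphi(\frac{a\tau+b}{c\tau+e},\frac{\mathfrak Z}{c\tau+e})=v_\eta^d(A)(c\tau+e)^ke^{\pi i\frac{c(\mathfrak Z,\mathfrak Z)}{c\tau+e}}\varphi(\tau,\mathfrak Z)$ for all $A\in\mathrm{SL}_2(\mathbb Z)$, $\varphi(\tau,\mathfrak Z+x\tau+y)=e^{-\pi i((x,x)\tau+2(x,\mathfrak Z))}\varphi(\tau,\mathfrak Z)$ for $x,y\in L$, and $\varphi=\sum f(n,l)e^{2\pi i(n\tau+(l,\mathfrak Z))}$ with the sum over rational $n\ge0$, $n\equiv\frac d{24}\bmod\mathbb Z$, $l\in L^\vee$, $2n-(l,l)\ge0$. The singular weight for $L$ is $\frac{\mathrm{rank}L}2$.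 *)

theory Defs
  imports "HOL-Analysis.Analysis"
begin

section \<open>Positive definite even lattices\<close>

text \<open>
  A positive definite lattice of rank \<open>r\<close> is realised inside the Euclidean space \<open>real ^ 'n\<close>,
  whose inner product restricts to the form of the lattice. Every positive definite lattice
  of rank \<open>CARD('n)\<close> arises in this way, up to isometry.
\<close>

definition is_lattice_of_rank :: "(real ^ 'n) set \<Rightarrow> nat \<Rightarrow> bool" where
  "is_lattice_of_rank L r \<longleftrightarrow>
     (\<exists>B. finite B \<and> independent B \<and> card B = r \<and>
          L = {(\<Sum>b\<in>B. real_of_int (m b) *\<^sub>R b) | m. True})"

definition even_lattice :: "(real ^ 'n) set \<Rightarrow> bool" where
  "even_lattice L \<longleftrightarrow> (\<forall>x\<in>L. \<exists>m :: int. x \<bullet> x = 2 * real_of_int m)"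

text \<open>This is the dual of \<open>L\<close> when \<open>L\<close> has full rank \<open>CARD('n)\<close>.\<close>

definition dual_lattice :: "(real ^ 'n) set \<Rightarrow> (real ^ 'n) set" where
  "dual_lattice L = {l. \<forall>x\<in>L. l \<bullet> x \<in> \<int>}"

text \<open>
  For \<open>L\<close> of full rank \<open>CARD('n)\<close>, the space \<open>L \<otimes> \<complex>\<close> is \<open>complex ^ 'n\<close>; the map \<open>cvec\<close> is the
  inclusion of \<open>L \<otimes> \<real> = real ^ 'n\<close>, and \<open>cform\<close> is the bilinear (not sesquilinear) extension of
  the inner product.
\<close>

definition cvec :: "real ^ 'n \<Rightarrow> complex ^ 'n" where
  "cvec x = (\<chi> i. complex_of_real (x $ i))"

definition cform :: "complex ^ 'n \<Rightarrow> complex ^ 'n \<Rightarrow> complex" where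
  "cform z w = (\<Sum>i\<in>UNIV. z $ i * w $ i)"


section \<open>The Dedekind eta function and its multiplier system\<close>

definition dedekind_eta :: "complex \<Rightarrow> complex" where
  "dedekind_eta \<tau> =
     exp (pi * \<i> * \<tau> / 12) * (\<Prod>n. 1 - exp (2 * pi * \<i> * of_nat (Suc n) * \<tau>))"

definition moebius_act :: "int \<Rightarrow> int \<Rightarrow> int \<Rightarrow> int \<Rightarrow> complex \<Rightarrow> complex" where
  "moebius_act a b c e \<tau> = (of_int a * \<tau> + of_int b) / (of_int c * \<tau> + of_int e)"

text \<open>The arguments are the entries, row by row, of a matrix in \<open>SL\<^sub>2(\<int>)\<close>.\<close>

definition v_eta :: "int \<Rightarrow> int \<Rightarrow> int \<Rightarrow> int \<Rightarrow> complex" where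
  "v_eta a b c e =
     (THE v. \<forall>\<tau>. Im \<tau> > 0 \<longrightarrow>
        dedekind_eta (moebius_act a b c e \<tau>) =
          v * csqrt (of_int c * \<tau> + of_int e) * dedekind_eta \<tau>)"


section \<open>Jacobi forms of lattice index\<close>

text \<open>
  Holomorphy in several variables: complex Frechet differentiability at every point of
  \<open>\<H> \<times> complex ^ 'n\<close>, i.e. the real derivative exists and is complex linear.
  Functions are total; only their values for \<open>Im \<tau> > 0\<close> are relevant.
\<close>

definition holomorphic_on_H :: "(complex \<times> (complex ^ 'n) \<Rightarrow> complex) \<Rightarrow> bool" where
  "holomorphic_on_H \<phi> \<longleftrightarrow>
     (\<forall>\<tau> z. Im \<tau> > 0 \<longrightarrow>
        (\<exists>D. (\<phi> has_derivative D) (at (\<tau>, z)) \<and>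
             (\<forall>s u w. D (s * u, s *s w) = s * D (u, w))))"

text \<open>Rationality of the exponents \<open>n\<close> is implied by the congruence.\<close>

definition fourier_index :: "(real ^ 'n) set \<Rightarrow> int \<Rightarrow> (real \<times> (real ^ 'n)) set" where
  "fourier_index L d =
     {(n, l). n \<ge> 0 \<and> n - of_int d / 24 \<in> \<int> \<and> l \<in> dual_lattice L \<and> 2 * n - l \<bullet> l \<ge> 0}"

text \<open>
  The space \<open>J\<^bsub>k,L\<^esub>(v\<^sub>\<eta>\<^sup>d)\<close>, for \<open>L\<close> of full rank \<open>CARD('n)\<close> and half-integral \<open>k\<close>. Both
  \<open>csqrt\<close> above and \<open>powr\<close> below are the principal branches.
\<close>

definition jacobi_forms ::
    "real \<Rightarrow> (real ^ 'n) set \<Rightarrow> int \<Rightarrow> (complex \<times> (complex ^ 'n) \<Rightarrow> complex) set" where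
  "jacobi_forms k L d =
     {\<phi>. holomorphic_on_H \<phi> \<and>
        (\<forall>a b c e \<tau> z. a * e - b * c = 1 \<longrightarrow> Im \<tau> > 0 \<longrightarrow>
           \<phi> (moebius_act a b c e \<tau>, inverse (of_int c * \<tau> + of_int e) *s z) =
             v_eta a b c e powi d * (of_int c * \<tau> + of_int e) powr of_real k *
             exp (pi * \<i> * (of_int c * cform z z / (of_int c * \<tau> + of_int e))) * \<phi> (\<tau>, z)) \<and>
        (\<forall>\<tau> z. \<forall>x\<in>L. \<forall>y\<in>L. Im \<tau> > 0 \<longrightarrow>
           \<phi> (\<tau>, z + \<tau> *s cvec x + cvec y) =
             exp (- pi * \<i> * (of_real (x \<bullet> x) * \<tau> + 2 * cform (cvec x) z)) * \<phi> (\<tau>, z)) \<and>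
        (\<exists>f. \<forall>\<tau> z. Im \<tau> > 0 \<longrightarrow>
           ((\<lambda>(n, l). f (n, l) * exp (2 * pi * \<i> * (of_real n * \<tau> + cform (cvec l) z)))
              has_sum \<phi> (\<tau>, z)) (fourier_index L d))}"

end

theory Submission
  imports Defs "HOL-Complex_Analysis.Complex_Analysis" "HOL-Probability.Probability"
begin

text \<open>
  The lattices are orthogonal sums of rank one lattices \<open>\<surd>N \<int>\<close> with \<open>N \<in> {4, 12}\<close>, and the Jacobi
  forms are built from the one-variable series
  \<open>\<theta>\<^bsub>N,a\<^esub>(\<tau>, w) = \<Sum>\<^bsub>l\<in>\<int>\<^esub> a(l) exp(\<pi>\<i> l\<^sup>2 \<tau> / N + 2\<pi>\<i> l w / \<surd>N)\<close> with \<open>N\<close>-periodic \<open>a\<close>. Every product of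
  \<open>n\<close> of them in \<open>n\<close> separate variables has the singular weight \<open>n/2\<close>; each exponent \<open>(\<nu>, l)\<close> of its
  Fourier expansion satisfies \<open>2 \<nu> = (l, l)\<close>. What has to be arranged is the character.

  Two series are eigenfunctions of the modular group: the odd Jacobi theta function \<open>Th1\<close>
  (\<open>N = 4\<close>), with character \<open>v\<^sub>\<eta>\<^sup>3\<close>, and the function \<open>Quint\<close> of the quintuple product identity
  (\<open>N = 12\<close>), with character \<open>v\<^sub>\<eta>\<close>. Products with \<open>m\<close> factors \<open>Th1\<close> and \<open>n - m\<close> factors \<open>Quint\<close> have
  character \<open>v\<^sub>\<eta>\<close> to the power \<open>n + 2 m\<close>. The even Jacobi theta functions \<open>Th2\<close>, \<open>Th3\<close>, \<open>Th4\<close> are permuted up to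
  factors by \<open>T\<close> and \<open>S\<close>, so the \<open>3 \<times> 3\<close> determinant of their values in three variables is again an
  eigenfunction, with character \<open>v\<^sub>\<eta>\<close> to the power \<open>15\<close>; with \<open>m\<close> factors \<open>Th1\<close> and \<open>n - 3 - m\<close> factors \<open>Quint\<close>
  the power becomes \<open>n + 12 + 2 m\<close>. As \<open>v\<^sub>\<eta>\<close> has order \<open>24\<close>, and \<open>m\<close> ranges up to \<open>n\<close>, respectively \<open>n - 3\<close>,
  these two families reach every \<open>d \<equiv> n (mod 2)\<close> as soon as \<open>n \<ge> 8\<close>
  (\<open>jacobi_form_of_products\<close>, \<open>jacobi_form_of_determinant\<close>).

  The analytic input is the inversion formula for \<open>\<theta>\<^bsub>N,a\<^esub>\<close> (\<open>theta_inversion\<close>), in which \<open>a\<close> is replaced by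
  its finite Fourier transform. It follows from the case \<open>N = 1\<close>, which is Poisson summation for the
  Gaussian: on the imaginary axis both sides are even periodic functions with equal Fourier
  coefficients, and analytic continuation does the rest. Euler's pentagonal number theorem
  identifies \<open>2 \<eta>(\<tau>)\<close> with \<open>Quint\<close> at \<open>w = 0\<close>, which gives the transformation of \<open>\<eta>\<close> and hence the
  properties of \<open>v\<^sub>\<eta>\<close> (\<open>v_eta_exists\<close>). Finally, the transformation law of a Jacobi form \<open>\<phi>\<close> under
  \<open>SL\<^sub>2(\<int>)\<close> is obtained by passing to \<open>\<phi> / \<eta>\<^sup>d\<close>, which has integral weight and trivial character,
  so that it suffices to check the generators \<open>T\<close> and \<open>S\<close>.
\<close>

section \<open>Theta series in one variable\<close>

text \<open>
  With the factors \<open>1 / N\<close> and \<open>1 / \<surd>N\<close> in the exponent, \<open>l / \<surd>N\<close> is a vector of the dual of the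
  lattice \<open>\<surd>N \<int>\<close>, so that \<open>w\<close> is a coordinate with respect to an orthonormal basis.
\<close>

definition theta_term :: "nat \<Rightarrow> (int \<Rightarrow> complex) \<Rightarrow> complex \<Rightarrow> complex \<Rightarrow> int \<Rightarrow> complex" where
  "theta_term N a \<tau> w l =
     a l * exp (pi * \<i> * (of_int l)\<^sup>2 * \<tau> / of_nat N + 2 * pi * \<i> * of_int l * w / of_real (sqrt N))"

definition theta :: "nat \<Rightarrow> (int \<Rightarrow> complex) \<Rightarrow> complex \<Rightarrow> complex \<Rightarrow> complex" where
  "theta N a \<tau> w = (\<Sum>\<^sub>\<infinity>l. theta_term N a \<tau> w l)"

text \<open>
  Growth conditions are exponential, not polynomial: the class is closed under
  differentiation of the series and is still dominated by the Gaussian factor.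
\<close>

definition exp_growth :: "(int \<Rightarrow> complex) \<Rightarrow> bool" where
  "exp_growth a \<longleftrightarrow> (\<exists>C B. \<forall>l. norm (a l) \<le> C * exp (B * \<bar>real_of_int l\<bar>))"

lemma exp_growth_bounded: "(\<And>l. norm (a l) \<le> C) \<Longrightarrow> exp_growth a"
  unfolding exp_growth_def by (rule exI[of _ C], rule exI[of _ 0]) auto

lemma Im_inversion_pos:
  assumes "Im \<tau> > 0"
  shows "Im (- 1 / \<tau>) > 0"
  using assms by (simp add: Im_divide field_simps sum_power2_gt_zero_iff)

lemma exp_growth_one: "exp_growth (\<lambda>_. 1)"
  by (rule exp_growth_bounded[of _ 1]) simp

lemma exp_growth_mult_index:
  assumes "exp_growth a"
  shows "exp_growth (\<lambda>l. c * of_int l * a l)"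
proof -
  obtain C B where CB: "\<And>l. norm (a l) \<le> C * exp (B * \<bar>real_of_int l\<bar>)"
    using assms unfolding exp_growth_def by blast
  have "norm (c * of_int l * a l) \<le> (norm c * C) * exp ((B + 1) * \<bar>real_of_int l\<bar>)" for l
  proof -
    have "\<bar>real_of_int l\<bar> \<le> exp \<bar>real_of_int l\<bar>"
      using exp_ge_add_one_self[of "\<bar>real_of_int l\<bar>"] by linarith
    hence "\<bar>real_of_int l\<bar> * norm (a l) \<le> exp \<bar>real_of_int l\<bar> * (C * exp (B * \<bar>real_of_int l\<bar>))"
      using CB[of l] by (intro mult_mono) auto
    also have "\<dots> = C * exp ((B + 1) * \<bar>real_of_int l\<bar>)"
      by (simp add: algebra_simps exp_add)
    finally have "norm c * (\<bar>real_of_int l\<bar> * norm (a l)) \<le> norm c * (C * exp ((B + 1) * \<bar>real_of_int l\<bar>))"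
      by (intro mult_left_mono) auto
    thus ?thesis by (simp add: norm_mult mult_ac)
  qed
  thus ?thesis unfolding exp_growth_def by blast
qed

lemma summable_exp_neg_abs_int: "(\<lambda>l. exp (- \<bar>real_of_int l\<bar>)) summable_on (UNIV :: int set)"
proof -
  have nat: "(\<lambda>n. exp (- real n)) summable_on (UNIV :: nat set)"
  proof -
    have "summable (\<lambda>n. (exp (-1 :: real)) ^ n)"
      by (rule summable_geometric) simp
    hence "(\<lambda>n. (exp (-1 :: real)) ^ n) summable_on UNIV"
      by (rule summable_nonneg_imp_summable_on) simp
    thus ?thesis by (simp add: exp_of_nat_mult[symmetric])
  qed
  have 1: "(\<lambda>l. exp (- \<bar>real_of_int l\<bar>)) summable_on range int"
    using summable_on_reindex[of int UNIV "\<lambda>l. exp (- \<bar>real_of_int l\<bar>)"] nat by (simp add: o_def)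
  have 2: "(\<lambda>l. exp (- \<bar>real_of_int l\<bar>)) summable_on range (\<lambda>n. - int n)"
    using summable_on_reindex[of "\<lambda>n. - int n" UNIV "\<lambda>l. exp (- \<bar>real_of_int l\<bar>)"] nat
    by (simp add: o_def inj_on_def)
  have U: "(UNIV :: int set) = range int \<union> range (\<lambda>n. - int n)"
  proof (intro equalityI subsetI)
    fix l :: int show "l \<in> range int \<union> range (\<lambda>n. - int n)"
      by (cases l rule: int_cases2) auto
  qed auto
  show ?thesis unfolding U by (rule summable_on_union[OF 1 2])
qed

lemma theta_term_bound:
  assumes N: "N > 0" and a: "exp_growth a" and y: "y > 0"
  shows "\<exists>K. \<forall>l \<tau> w. Im \<tau> \<ge> y \<longrightarrow> \<bar>Im w\<bar> \<le> v \<longrightarrow>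
           norm (theta_term N a \<tau> w l) \<le> K * exp (- \<bar>real_of_int l\<bar>)"
proof -
  obtain C B where CB: "\<And>l. norm (a l) \<le> C * exp (B * \<bar>real_of_int l\<bar>)"
    using a unfolding exp_growth_def by blast
  have "0 \<le> C" using order_trans[OF norm_ge_zero CB[of 0]] by simp
  define p where "p = pi * y / N"
  define b where "b = B + 2 * pi * v / sqrt N + 1"
  have p: "p > 0" using N y by (simp add: p_def)
  have "norm (theta_term N a \<tau> w l) \<le> C * exp (b\<^sup>2 / (4 * p)) * exp (- \<bar>real_of_int l\<bar>)"
    if \<tau>: "Im \<tau> \<ge> y" and w: "\<bar>Im w\<bar> \<le> v" for l \<tau> w
  proof -
    let ?l = "real_of_int l"
    have re: "Re (pi * \<i> * (of_int l)\<^sup>2 * \<tau> / of_nat N + 2 * pi * \<i> * of_int l * w / of_real (sqrt N))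
       = - (pi * ?l\<^sup>2 * Im \<tau> / N) - 2 * pi * ?l * Im w / sqrt N"
      by (simp add: Re_divide_of_nat flip: of_int_power)
    have e1: "pi * ?l\<^sup>2 * Im \<tau> / N \<ge> p * \<bar>?l\<bar>\<^sup>2"
      unfolding p_def using mult_left_mono[OF \<tau>, of "?l\<^sup>2"] N by (simp add: divide_simps mult_ac)
    have "- (?l * Im w) \<le> \<bar>?l\<bar> * v"
      using mult_left_mono[OF w, of "\<bar>?l\<bar>"] abs_ge_minus_self[of "?l * Im w"] by (simp add: abs_mult)
    hence "- (2 * pi / sqrt N * (?l * Im w)) \<le> 2 * pi / sqrt N * (\<bar>?l\<bar> * v)"
      using mult_left_mono[of "- (?l * Im w)" "\<bar>?l\<bar> * v" "2 * pi / sqrt N"] by simp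
    hence e2: "- (2 * pi * ?l * Im w / sqrt N) \<le> 2 * pi * v / sqrt N * \<bar>?l\<bar>"
      by (simp add: mult_ac)
    have e4: "b * \<bar>?l\<bar> = B * \<bar>?l\<bar> + 2 * pi * v / sqrt N * \<bar>?l\<bar> + \<bar>?l\<bar>"
      by (simp only: b_def distrib_right mult_1)
    have e5: "B * \<bar>?l\<bar> - (pi * ?l\<^sup>2 * Im \<tau> / N) - 2 * pi * ?l * Im w / sqrt N \<le> b\<^sup>2 / (4 * p) - \<bar>?l\<bar>"
      if "b * \<bar>?l\<bar> - p * \<bar>?l\<bar>\<^sup>2 \<le> b\<^sup>2 / (4 * p)"
      using that e1 e2 e4 by linarith
    have e3: "b * \<bar>?l\<bar> - p * \<bar>?l\<bar>\<^sup>2 \<le> b\<^sup>2 / (4 * p)"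
    proof -
      \<comment> \<open>completing the square\<close>
      have "0 \<le> (2 * p * \<bar>?l\<bar> - b)\<^sup>2" by simp
      hence "4 * p * (b * \<bar>?l\<bar> - p * \<bar>?l\<bar>\<^sup>2) \<le> b\<^sup>2" by (simp add: power2_eq_square algebra_simps)
      thus ?thesis using p by (simp add: field_simps)
    qed
    have "norm (theta_term N a \<tau> w l) =
        norm (a l) * exp (- (pi * ?l\<^sup>2 * Im \<tau> / N) - 2 * pi * ?l * Im w / sqrt N)"
      unfolding theta_term_def norm_mult norm_exp_eq_Re re ..
    also have "\<dots> \<le> C * exp (B * \<bar>?l\<bar>) * exp (- (pi * ?l\<^sup>2 * Im \<tau> / N) - 2 * pi * ?l * Im w / sqrt N)"
      by (intro mult_right_mono CB) auto
    also have "\<dots> = C * exp (B * \<bar>?l\<bar> - (pi * ?l\<^sup>2 * Im \<tau> / N) - 2 * pi * ?l * Im w / sqrt N)"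
      by (simp add: exp_add exp_diff exp_minus divide_inverse)
    also have "\<dots> \<le> C * exp (b\<^sup>2 / (4 * p) - \<bar>?l\<bar>)"
      using \<open>0 \<le> C\<close> e5[OF e3] by (intro mult_left_mono) simp_all
    also have "\<dots> = C * exp (b\<^sup>2 / (4 * p)) * exp (- \<bar>?l\<bar>)"
      by (simp only: diff_conv_add_uminus exp_add mult.assoc)
    finally show ?thesis .
  qed
  thus ?thesis by (intro exI[of _ "C * exp (b\<^sup>2 / (4 * p))"]) auto
qed

lemma theta_term_abs_summable:
  assumes "N > 0" "exp_growth a" "Im \<tau> > 0"
  shows "(\<lambda>l. norm (theta_term N a \<tau> w l)) summable_on UNIV"
proof -
  from theta_term_bound[OF assms, of "\<bar>Im w\<bar>"] obtain K where
    "\<forall>l \<sigma> u. Im \<tau> \<le> Im \<sigma> \<longrightarrow> \<bar>Im u\<bar> \<le> \<bar>Im w\<bar> \<longrightarrow>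
       norm (theta_term N a \<sigma> u l) \<le> K * exp (- \<bar>real_of_int l\<bar>)" ..
  hence K: "\<And>l. norm (theta_term N a \<tau> w l) \<le> K * exp (- \<bar>real_of_int l\<bar>)"
    by simp
  show ?thesis
    by (rule summable_on_comparison_test[OF summable_on_cmult_right[OF summable_exp_neg_abs_int, of K]])
       (use K in auto)
qed

lemma theta_has_sum:
  assumes "N > 0" "exp_growth a" "Im \<tau> > 0"
  shows "(theta_term N a \<tau> w has_sum theta N a \<tau> w) UNIV"
  unfolding theta_def
  by (rule has_sum_infsum[OF abs_summable_summable[OF theta_term_abs_summable[OF assms]]])

text \<open>The classical theta function, with all coefficients equal to \<open>1\<close>.\<close>

abbreviation theta_one :: "complex \<Rightarrow> complex \<Rightarrow> complex" where
  "theta_one \<equiv> theta 1 (\<lambda>_. 1)"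

lemma continuous_on_theta_term [continuous_intros]:
  "continuous_on S f \<Longrightarrow> continuous_on S g \<Longrightarrow> continuous_on S (\<lambda>p. theta_term N a (f p) (g p) l)"
  unfolding theta_term_def divide_inverse by (intro continuous_intros)

lemma theta_uniform_limit:
  assumes "N > 0" "exp_growth a" "y > 0"
  shows "uniform_limit {(\<tau>, w). Im \<tau> \<ge> y \<and> \<bar>Im w\<bar> \<le> v}
           (\<lambda>X (\<tau>, w). \<Sum>l\<in>X. theta_term N a \<tau> w l) (\<lambda>(\<tau>, w). theta N a \<tau> w)
           (finite_subsets_at_top UNIV)"
proof -
  from theta_term_bound[OF assms, of v] obtain K where K: "\<forall>l \<tau> w. y \<le> Im \<tau> \<longrightarrow> \<bar>Im w\<bar> \<le> v \<longrightarrow>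
           norm (theta_term N a \<tau> w l) \<le> K * exp (- \<bar>real_of_int l\<bar>)" ..
  have "uniform_limit {(\<tau>, w). Im \<tau> \<ge> y \<and> \<bar>Im w\<bar> \<le> v}
      (\<lambda>X p. \<Sum>l\<in>X. theta_term N a (fst p) (snd p) l)
      (\<lambda>p. \<Sum>\<^sub>\<infinity>l. theta_term N a (fst p) (snd p) l) (finite_subsets_at_top UNIV)"
    by (rule Weierstrass_m_test_general[OF _ summable_on_cmult_right[OF summable_exp_neg_abs_int, of K]])
       (use K in auto)
  thus ?thesis by (simp add: case_prod_unfold theta_def)
qed

lemma theta_continuous_at:
  assumes "N > 0" "exp_growth a" "Im \<tau> > 0"
  shows "isCont (\<lambda>(\<tau>, w). theta N a \<tau> w) (\<tau>, w)"
proof -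
  define U where "U = {(\<sigma>, u). Im \<sigma> > Im \<tau> / 2 \<and> \<bar>Im u\<bar> < \<bar>Im w\<bar> + 1}"
  have "open U"
  proof -
    have "U = {p. Im (fst p) > Im \<tau> / 2} \<inter> {p. \<bar>Im (snd p)\<bar> < \<bar>Im w\<bar> + 1}"
      by (auto simp: U_def)
    also have "open \<dots>"
      by (intro open_Int open_Collect_less continuous_intros)
    finally show ?thesis .
  qed
  have "continuous_on {(\<sigma>, u). Im \<sigma> \<ge> Im \<tau> / 2 \<and> \<bar>Im u\<bar> \<le> \<bar>Im w\<bar> + 1} (\<lambda>(\<tau>, w). theta N a \<tau> w)"
    by (rule uniform_limit_theorem[OF _ theta_uniform_limit])
       (use assms in \<open>auto simp: case_prod_unfold intro!: always_eventually continuous_intros\<close>)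
  hence "continuous_on U (\<lambda>(\<tau>, w). theta N a \<tau> w)"
    by (rule continuous_on_subset) (auto simp: U_def)
  moreover have "(\<tau>, w) \<in> U" using assms by (auto simp: U_def)
  ultimately show ?thesis using \<open>open U\<close> continuous_on_eq_continuous_at by blast
qed

lemma theta_deriv_index:
  assumes "N > 0" "exp_growth a" "Im \<tau> > 0"
  shows "((\<lambda>w. theta N a \<tau> w) has_field_derivative
           theta N (\<lambda>l. 2 * pi * \<i> / of_real (sqrt N) * of_int l * a l) \<tau> w) (at w)"
proof -
  let ?a' = "\<lambda>l. 2 * pi * \<i> / of_real (sqrt N) * of_int l * a l"
  have sub: "(\<lambda>u. (\<tau>, u)) ` cball w 1 \<subseteq> {(\<sigma>, u). Im \<sigma> \<ge> Im \<tau> \<and> \<bar>Im u\<bar> \<le> \<bar>Im w\<bar> + 1}"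
  proof clarsimp
    fix u assume "dist w u \<le> 1"
    hence "\<bar>Im (w - u)\<bar> \<le> 1" using abs_Im_le_cmod[of "w - u"] by (simp add: dist_norm)
    thus "\<bar>Im u\<bar> \<le> \<bar>Im w\<bar> + 1" by simp
  qed
  have ul: "uniform_limit (cball w 1) (\<lambda>X u. \<Sum>l\<in>X. theta_term N a \<tau> u l) (\<lambda>u. theta N a \<tau> u)
          (finite_subsets_at_top UNIV)"
    using uniform_limit_on_subset[OF theta_uniform_limit[OF assms, of "\<bar>Im w\<bar> + 1"] sub]
    by (simp add: uniform_limit_iff Ball_image_comp o_def)
  have d: "((\<lambda>u. \<Sum>l\<in>X. theta_term N a \<tau> u l) has_field_derivative (\<Sum>l\<in>X. theta_term N ?a' \<tau> u l)) (at u)"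
    for X u
    by (rule DERIV_sum) (use assms(1) in \<open>auto simp: theta_term_def intro!: derivative_eq_intros\<close>)
  obtain g' where g': "\<And>u. u \<in> ball w 1 \<Longrightarrow> ((\<lambda>u. theta N a \<tau> u) has_field_derivative g' u) (at u) \<and>
      ((\<lambda>X. \<Sum>l\<in>X. theta_term N ?a' \<tau> u l) \<longlongrightarrow> g' u) (finite_subsets_at_top UNIV)"
    by (rule has_complex_derivative_uniform_limit[OF _ ul,
          where f' = "\<lambda>X u. \<Sum>l\<in>X. theta_term N ?a' \<tau> u l"])
       (use d in \<open>auto intro!: always_eventually continuous_intros\<close>)
  have "((\<lambda>X. \<Sum>l\<in>X. theta_term N ?a' \<tau> w l) \<longlongrightarrow> theta N ?a' \<tau> w) (finite_subsets_at_top UNIV)"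
    using theta_has_sum[OF assms(1) exp_growth_mult_index[OF assms(2)] assms(3)]
    unfolding has_sum_def by blast
  hence "theta N ?a' \<tau> w = g' w"
    using g'[of w] by (intro tendsto_unique[OF finite_subsets_at_top_neq_bot]) auto
  thus ?thesis using g'[of w] by simp
qed

lemma theta_has_derivative_modulus:
  assumes "N > 0" "exp_growth a" "Im \<tau> > 0"
  shows "\<exists>D. ((\<lambda>\<sigma>. theta N a \<sigma> w) has_field_derivative D) (at \<tau>)"
proof -
  define r where "r = Im \<tau> / 2"
  have r: "r > 0" using assms by (simp add: r_def)
  have sub: "(\<lambda>\<sigma>. (\<sigma>, w)) ` cball \<tau> r \<subseteq> {(\<sigma>, u). Im \<sigma> \<ge> r \<and> \<bar>Im u\<bar> \<le> \<bar>Im w\<bar>}"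
  proof clarsimp
    fix u assume "dist \<tau> u \<le> r"
    hence "\<bar>Im (\<tau> - u)\<bar> \<le> r" using abs_Im_le_cmod[of "\<tau> - u"] by (simp add: dist_norm)
    thus "r \<le> Im u" unfolding r_def minus_complex.simps by linarith
  qed
  have ul: "uniform_limit (cball \<tau> r) (\<lambda>X \<sigma>. \<Sum>l\<in>X. theta_term N a \<sigma> w l) (\<lambda>\<sigma>. theta N a \<sigma> w)
          (finite_subsets_at_top UNIV)"
    using uniform_limit_on_subset[OF theta_uniform_limit[OF assms(1,2) r, of "\<bar>Im w\<bar>"] sub]
    by (simp add: uniform_limit_iff Ball_image_comp o_def)
  have "(\<lambda>\<sigma>. theta N a \<sigma> w) holomorphic_on ball \<tau> r"
  proof (rule holomorphic_uniform_limit[OF _ ul])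
    have "(\<lambda>\<sigma>. theta_term N a \<sigma> w l) holomorphic_on ball \<tau> r" for l
      unfolding theta_term_def divide_inverse by (intro holomorphic_intros)
    thus "\<forall>\<^sub>F X in finite_subsets_at_top UNIV.
        continuous_on (cball \<tau> r) (\<lambda>\<sigma>. \<Sum>l\<in>X. theta_term N a \<sigma> w l) \<and>
        (\<lambda>\<sigma>. \<Sum>l\<in>X. theta_term N a \<sigma> w l) holomorphic_on ball \<tau> r"
      by (intro always_eventually allI conjI continuous_intros holomorphic_intros)
  qed auto
  thus ?thesis
    using r by (meson centre_in_ball field_differentiable_def holomorphic_on_imp_differentiable_at open_ball)
qed

text \<open>
  Joint complex differentiability: the partial derivative in \<open>w\<close> is a theta series of the same
  kind, hence jointly continuous, and with it differentiability in \<open>\<tau>\<close> alone is enough.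
\<close>

lemma theta_has_derivative:
  assumes N: "N > 0" and a: "exp_growth a" and \<tau>: "Im \<tau> > 0"
  shows "\<exists>D E. ((\<lambda>(\<tau>, w). theta N a \<tau> w) has_derivative (\<lambda>(s, t). D * s + E * t)) (at (\<tau>, w))"
proof -
  define H where "H = {\<sigma>. Im \<sigma> > 0}"
  have opH: "open H" unfolding H_def by (rule open_halfspace_Im_gt)
  let ?a' = "\<lambda>l. 2 * pi * \<i> / of_real (sqrt N) * of_int l * a l"
  from theta_has_derivative_modulus[OF assms]
  obtain D where D: "((\<lambda>\<sigma>. theta N a \<sigma> w) has_field_derivative D) (at \<tau>)" ..
  have c: "isCont (\<lambda>(\<tau>, w). theta N ?a' \<tau> w) (\<tau>, w)"
    by (rule theta_continuous_at[OF N exp_growth_mult_index[OF a] \<tau>])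
  have "((\<lambda>(x, y). theta N a x y) has_derivative
      (\<lambda>(tx, ty). (*) D tx + blinfun_apply (blinfun_mult_right (theta N ?a' \<tau> w)) ty)) (at (\<tau>, w) within H \<times> UNIV)"
  proof (rule has_derivative_partialsI)
    show "((\<lambda>x. theta N a x w) has_derivative (*) D) (at \<tau> within H)"
      using D unfolding has_field_derivative_def by (rule has_derivative_at_withinI)
    fix x y :: complex assume "x \<in> H"
    thus "((\<lambda>y. theta N a x y) has_derivative blinfun_apply (blinfun_mult_right (theta N ?a' x y))) (at y within UNIV)"
      using theta_deriv_index[OF N a, of x y]
      unfolding has_field_derivative_def by (simp add: H_def)
  next
    have "isCont (\<lambda>p. blinfun_mult_right ((\<lambda>(\<tau>, w). theta N ?a' \<tau> w) p)) (\<tau>, w)"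
      by (intro bounded_linear.isCont[OF bounded_linear_blinfun_mult_right] c)
    from continuous_at_imp_continuous_at_within[OF this]
    show "continuous (at (\<tau>, w) within H \<times> UNIV) (\<lambda>(x, y). blinfun_mult_right (theta N ?a' x y))"
      by (simp only: case_prod_unfold)
  qed auto
  moreover have "at (\<tau>, w) within H \<times> UNIV = at (\<tau>, w)"
    by (rule at_within_open) (use \<tau> opH in \<open>auto simp: H_def open_Times\<close>)
  ultimately have "((\<lambda>(\<tau>, w). theta N a \<tau> w) has_derivative (\<lambda>(s, t). D * s + theta N ?a' \<tau> w * t)) (at (\<tau>, w))"
    by (simp only: blinfun_mult_right.rep_eq)
  thus ?thesis by (intro exI)
qed

lemma holomorphic_theta_comp:
  assumes N: "N > 0" and a: "exp_growth a" and S: "open S" and f: "f holomorphic_on S" and g: "g holomorphic_on S"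
    and pos: "\<And>s. s \<in> S \<Longrightarrow> Im (f s) > 0"
  shows "(\<lambda>s. theta N a (f s) (g s)) holomorphic_on S"
  unfolding holomorphic_on_open[OF S]
proof
  fix s assume s: "s \<in> S"
  from bspec[OF f[unfolded holomorphic_on_open[OF S]] s]
  obtain f' where f': "(f has_field_derivative f') (at s)" ..
  from bspec[OF g[unfolded holomorphic_on_open[OF S]] s]
  obtain g' where g': "(g has_field_derivative g') (at s)" ..
  from theta_has_derivative[OF N a pos[OF s], of "g s"]
  obtain D E where DE: "((\<lambda>(\<tau>, w). theta N a \<tau> w) has_derivative (\<lambda>(s, t). D * s + E * t)) (at (f s, g s))"
    by (elim exE) (rule that)
  have "((\<lambda>s. (f s, g s)) has_derivative (\<lambda>h. (f' * h, g' * h))) (at s)"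
    using f' g' unfolding has_field_derivative_def by (intro has_derivative_Pair)
  note has_derivative_compose[OF this DE]
  moreover have "(\<lambda>x. case (f' * x, g' * x) of (s, t) \<Rightarrow> D * s + E * t) = (*) (D * f' + E * g')"
    by (auto simp: algebra_simps)
  ultimately have "((\<lambda>s. theta N a (f s) (g s)) has_derivative (*) (D * f' + E * g')) (at s)"
    by (simp only: prod.case)
  thus "\<exists>d. ((\<lambda>s. theta N a (f s) (g s)) has_field_derivative d) (at s)"
    unfolding has_field_derivative_def by (rule exI)
qed

section \<open>Poisson summation for the Gaussian\<close>

lemma integral_gaussian_cos:
  fixes s t :: real
  assumes t: "t > 0"
  shows "has_bochner_integral lborel (\<lambda>x. exp (- (pi * t * x\<^sup>2)) * cos (2 * pi * s * x))
           (exp (- (pi * s\<^sup>2 / t)) / sqrt t)"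
proof -
  interpret std: real_distribution std_normal_distribution by (rule real_dist_normal_dist)
  define c where "c = sqrt (2 * pi * t)"
  define u where "u = 2 * pi * s / c"
  have c: "c > 0" "c\<^sup>2 = 2 * pi * t" using t by (auto simp: c_def)
  have int: "integrable std_normal_distribution (\<lambda>x. cos (u * x))"
    by (rule std.integrable_const_bound[of _ 1]) auto
  have "(CLINT x|std_normal_distribution. iexp (u * x)) = complex_of_real (exp (- (u\<^sup>2) / 2))"
    using fun_cong[OF char_std_normal_distribution, of u] by (simp add: char_def)
  hence "Re (CLINT x|std_normal_distribution. iexp (u * x)) = exp (- (u\<^sup>2) / 2)"
    by simp
  moreover have "Re (CLINT x|std_normal_distribution. iexp (u * x)) = (LINT x|std_normal_distribution. cos (u * x))"
    by (subst integral_Re[symmetric]) (auto simp: Re_exp intro: std.integrable_iexp)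
  ultimately have hb: "has_bochner_integral std_normal_distribution (\<lambda>x. cos (u * x)) (exp (- (u\<^sup>2) / 2))"
    using int by (simp add: has_bochner_integral_iff)
  have "has_bochner_integral lborel (\<lambda>x. std_normal_density x *\<^sub>R cos (u * x)) (exp (- (u\<^sup>2) / 2))"
    using hb integrable_density[of "\<lambda>x. cos (u * x)" lborel std_normal_density]
      integral_density[of "\<lambda>x. cos (u * x)" lborel std_normal_density]
    by (simp add: has_bochner_integral_iff)
  hence "has_bochner_integral lborel (\<lambda>x. std_normal_density (0 + c * x) *\<^sub>R cos (u * (0 + c * x)))
            (exp (- (u\<^sup>2) / 2) /\<^sub>R \<bar>c\<bar>)"
    using c by (subst (asm) lborel_has_bochner_integral_real_affine_iff[of c _ _ 0]) auto
  from has_bochner_integral_mult_right[OF this, of "sqrt (2 * pi)"]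
  have "has_bochner_integral lborel (\<lambda>x. sqrt (2 * pi) * (std_normal_density (0 + c * x) *\<^sub>R cos (u * (0 + c * x))))
            (sqrt (2 * pi) * (exp (- (u\<^sup>2) / 2) /\<^sub>R \<bar>c\<bar>))" by simp
  moreover have "sqrt (2 * pi) * (std_normal_density (0 + c * x) *\<^sub>R cos (u * (0 + c * x))) =
      exp (- (pi * t * x\<^sup>2)) * cos (2 * pi * s * x)" for x
  proof -
    have "(c * x)\<^sup>2 / 2 = pi * t * x\<^sup>2" using c by (simp add: power_mult_distrib)
    moreover have "u * (c * x) = 2 * pi * s * x" using c by (simp add: u_def)
    ultimately show ?thesis by (simp only: std_normal_density_def add_0 minus_divide_left[symmetric]) simp
  qed
  moreover have "sqrt (2 * pi) * (exp (- (u\<^sup>2) / 2) /\<^sub>R \<bar>c\<bar>) = exp (- (pi * s\<^sup>2 / t)) / sqrt t"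
  proof -
    have "u\<^sup>2 / 2 = pi * s\<^sup>2 / t"
      using c t by (simp add: u_def power_divide power_mult_distrib) (simp add: power2_eq_square field_simps)
    thus ?thesis using t c by (simp add: c_def real_sqrt_mult field_simps)
  qed
  ultimately show ?thesis by simp
qed

lemma gaussian_cos_cutoff:
  fixes t :: real and j :: nat
  assumes t: "t > 0"
  defines "F \<equiv> (\<lambda>x. exp (- (pi * t * x\<^sup>2)) * cos (2 * pi * real j * x))"
  shows "(\<lambda>M. integral {- real M..real M} F) \<longlonglongrightarrow> exp (- (pi * (real j)\<^sup>2 / t)) / sqrt t"
proof -
  have F: "(F has_integral exp (- (pi * (real j)\<^sup>2 / t)) / sqrt t) UNIV"
  proof -
    have 1: "integrable lborel F" and 2: "integral\<^sup>L lborel F = exp (- (pi * (real j)\<^sup>2 / t)) / sqrt t"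
      using integral_gaussian_cos[OF t, of "real j"] by (auto simp: F_def has_bochner_integral_iff)
    show ?thesis using has_integral_integral_lborel[OF 1] unfolding 2 .
  qed
  have G: "(\<lambda>x. exp (- (pi * t * x\<^sup>2))) integrable_on UNIV"
  proof -
    have "integrable lborel (\<lambda>x. exp (- (pi * t * x\<^sup>2)))"
      using integral_gaussian_cos[OF t, of 0] by (simp add: has_bochner_integral_iff)
    from has_integral_integral_lborel[OF this] show ?thesis by (rule has_integral_integrable)
  qed
  have cont: "continuous_on A F" for A unfolding F_def by (intro continuous_intros)
  have "(\<lambda>M. integral UNIV (\<lambda>x. if x \<in> {- real M..real M} then F x else 0)) \<longlonglongrightarrow> integral UNIV F"
  proof (rule dominated_convergence(2)[OF _ G])
    show "(\<lambda>x. if x \<in> {- real M..real M} then F x else 0) integrable_on UNIV" for M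
      by (subst integrable_restrict_UNIV) (intro integrable_continuous_real cont)
    show "norm (if x \<in> {- real M..real M} then F x else 0) \<le> exp (- (pi * t * x\<^sup>2))" for M x
      by (auto simp: F_def abs_mult)
    show "(\<lambda>M. if x \<in> {- real M..real M} then F x else 0) \<longlonglongrightarrow> F x" for x
    proof (rule tendsto_eventually)
      obtain m where m: "\<bar>x\<bar> \<le> real m" using real_arch_simple by blast
      show "\<forall>\<^sub>F M in sequentially. (if x \<in> {- real M..real M} then F x else 0) = F x"
        using eventually_ge_at_top[of m] by eventually_elim (use m in auto)
    qed
  qed
  moreover have "integral UNIV F = exp (- (pi * (real j)\<^sup>2 / t)) / sqrt t"
    using F by (rule integral_unique)
  ultimately show ?thesis by (simp only: integral_restrict_UNIV)
qed

text \<open>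
  Uniqueness of Fourier coefficients. An even periodic function is a continuous function of
  \<open>cos (2 \<pi> x)\<close>, so by Weierstrass it is approximated by polynomials in \<open>cos (2 \<pi> x)\<close>. Those are
  orthogonal to \<open>D\<close> by the assumption and the product formula for cosines, hence \<open>D\<close> is orthogonal
  to itself.
\<close>

lemma even_periodic_eq_0I:
  fixes D :: "real \<Rightarrow> real"
  assumes cont: "continuous_on UNIV D" and per: "\<And>x. D (x + 1) = D x" and even: "\<And>x. D (- x) = D x"
    and coeff: "\<And>j :: nat. integral {0..1} (\<lambda>x. D x * cos (2 * pi * real j * x)) = 0"
  shows "D x = 0"
proof -
  have contS: "continuous_on S D" for S using cont by (rule continuous_on_subset) auto
  have pw: "integral {0..1} (\<lambda>x. D x * (cos (2 * pi * x) ^ i * cos (2 * pi * real j * x))) = 0" for i j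
  proof (induction i arbitrary: j)
    case 0 thus ?case using coeff[of j] by simp
  next
    case (Suc i)
    define q where "q = (if j = 0 then 1 else j - 1)"
    have eq: "cos (2 * pi * x) * cos (2 * pi * real j * x) =
        (cos (2 * pi * real (j + 1) * x) + cos (2 * pi * real q * x)) / 2" for x
    proof (cases "j = 0")
      case False
      hence j: "real j = real q + 1" by (simp add: q_def of_nat_diff)
      have "2 * pi * x - 2 * pi * real j * x = - (2 * pi * real q * x)"
        by (simp add: j algebra_simps)
      moreover have "2 * pi * x + 2 * pi * real j * x = 2 * pi * real (j + 1) * x"
        by (simp add: algebra_simps)
      ultimately show ?thesis by (simp only: cos_times_cos cos_minus add.commute)
    qed (simp add: q_def)
    have "D x * (cos (2 * pi * x) ^ Suc i * cos (2 * pi * real j * x)) =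
        (D x * (cos (2 * pi * x) ^ i * cos (2 * pi * real (j + 1) * x)) +
         D x * (cos (2 * pi * x) ^ i * cos (2 * pi * real q * x))) / 2" for x
    proof -
      have "D x * (cos (2 * pi * x) ^ Suc i * cos (2 * pi * real j * x)) =
        D x * cos (2 * pi * x) ^ i * (cos (2 * pi * x) * cos (2 * pi * real j * x))" by simp
      thus ?thesis unfolding eq by (simp add: field_simps)
    qed
    moreover have "(\<lambda>x. D x * (cos (2 * pi * x) ^ i * cos (2 * pi * real j * x))) integrable_on {0..1}" for j
      by (intro integrable_continuous_real continuous_intros contS)
    ultimately have "integral {0..1} (\<lambda>x. D x * (cos (2 * pi * x) ^ Suc i * cos (2 * pi * real j * x))) =
        (integral {0..1} (\<lambda>x. D x * (cos (2 * pi * x) ^ i * cos (2 * pi * real (j + 1) * x))) +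
         integral {0..1} (\<lambda>x. D x * (cos (2 * pi * x) ^ i * cos (2 * pi * real q * x)))) / 2"
      by (simp only: integral_divide integral_add)
    thus ?case by (simp only: Suc) simp
  qed
  have poly: "integral {0..1} (\<lambda>x. D x * (\<Sum>i\<le>n. a i * cos (2 * pi * x) ^ i)) = 0" for a :: "nat \<Rightarrow> real" and n
  proof -
    have int: "(\<lambda>x. D x * (cos (2 * pi * x) ^ i * cos (2 * pi * real 0 * x))) integrable_on {0..1}" for i
      by (intro integrable_continuous_real continuous_intros contS)
    have "((\<lambda>x. D x * (cos (2 * pi * x) ^ i * cos (2 * pi * real 0 * x))) has_integral 0) {0..1}" for i
      using pw[of i 0] integrable_integral[OF int[of i]] by simp
    hence "((\<lambda>x. \<Sum>i\<le>n. a i * (D x * (cos (2 * pi * x) ^ i * cos (2 * pi * real 0 * x)))) has_integral (\<Sum>i\<le>n. a i * 0)) {0..1}"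
      by (intro has_integral_sum has_integral_mult_right) auto
    hence "((\<lambda>x. D x * (\<Sum>i\<le>n. a i * cos (2 * pi * x) ^ i)) has_integral 0) {0..1}"
      by (simp add: sum_distrib_left mult_ac)
    thus ?thesis by (rule integral_unique)
  qed
  define u where "u = (\<lambda>y. D (arccos y / (2 * pi)))"
  have u_cont: "continuous_on {-1..1} u"
    unfolding u_def by (intro continuous_on_compose2[OF cont] continuous_intros) auto
  have u: "D x = u (cos (2 * pi * x))" if x: "x \<in> {0..1}" for x
  proof (cases "x \<le> 1 / 2")
    case True
    thus ?thesis using x by (simp add: u_def arccos_cos)
  next
    case False
    have "cos (2 * pi * x) = cos (2 * pi * (1 - x))"
      using cos_periodic[of "- (2 * pi * x)"] by (simp add: algebra_simps)
    moreover have "2 * pi * (1 - x) \<le> pi" using False by (simp add: algebra_simps)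
    moreover have "D x = D (1 - x)" using per[of "- x"] even[of x] by (simp add: add.commute)
    ultimately show ?thesis using x by (simp add: u_def arccos_cos)
  qed
  define A where "A = integral {0..1} (\<lambda>x. \<bar>D x\<bar>)"
  have A: "A \<ge> 0" unfolding A_def by (intro integral_nonneg integrable_continuous_real continuous_intros contS) auto
  define I where "I = integral {0..1} (\<lambda>x. D x * D x)"
  have I0: "I \<ge> 0" unfolding I_def by (intro integral_nonneg integrable_continuous_real continuous_intros contS) auto
  have le: "I \<le> e * A" if e: "e > 0" for e
  proof -
    obtain p where p: "real_polynomial_function p" "\<And>y. y \<in> {-1..1} \<Longrightarrow> \<bar>u y - p y\<bar> < e"
      using Stone_Weierstrass_real_polynomial_function[OF compact_Icc u_cont e] by blast
    obtain a n where an: "p = (\<lambda>x. \<Sum>i\<le>n. a i * x ^ i)"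
      using p(1) real_polynomial_function_iff_sum by blast
    have "I = integral {0..1} (\<lambda>x. D x * D x) - integral {0..1} (\<lambda>x. D x * (\<Sum>i\<le>n. a i * cos (2 * pi * x) ^ i))"
      by (simp add: I_def poly)
    also have "\<dots> = integral {0..1} (\<lambda>x. D x * D x - D x * (\<Sum>i\<le>n. a i * cos (2 * pi * x) ^ i))"
      by (intro integral_diff[symmetric] integrable_continuous_real continuous_intros contS)
    also have "\<dots> \<le> integral {0..1} (\<lambda>x. e * \<bar>D x\<bar>)"
    proof (intro integral_le integrable_continuous_real continuous_intros contS)
      fix x :: real assume x: "x \<in> {0..1}"
      have "D x * D x - D x * (\<Sum>i\<le>n. a i * cos (2 * pi * x) ^ i) = D x * (D x - p (cos (2 * pi * x)))"
        by (simp add: an right_diff_distrib)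
      also have "\<dots> = D x * (u (cos (2 * pi * x)) - p (cos (2 * pi * x)))"
        by (simp only: u[OF x])
      also have "\<dots> \<le> \<bar>D x\<bar> * \<bar>u (cos (2 * pi * x)) - p (cos (2 * pi * x))\<bar>"
        by (metis abs_ge_self abs_mult)
      also have "\<dots> \<le> \<bar>D x\<bar> * e"
        by (intro mult_left_mono less_imp_le[OF p(2)]) auto
      finally show "D x * D x - D x * (\<Sum>i\<le>n. a i * cos (2 * pi * x) ^ i) \<le> e * \<bar>D x\<bar>" by (simp add: mult.commute)
    qed
    also have "\<dots> = e * A" by (simp add: A_def)
    finally show ?thesis .
  qed
  have "I = 0"
  proof (rule ccontr)
    assume "I \<noteq> 0"
    hence "I > 0" using I0 by simp
    moreover have "I \<le> I / (2 * (A + 1)) * A" using le[of "I / (2 * (A + 1))"] \<open>I > 0\<close> A by simp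
    moreover have "I / (2 * (A + 1)) * A \<le> I / 2" using A \<open>I > 0\<close> by (simp add: field_simps)
    ultimately show False by simp
  qed
  hence "((\<lambda>x. D x * D x) has_integral 0) {0..1}"
    unfolding I_def by (metis contS continuous_on_mult has_integral_integral integrable_continuous_real)
  hence D01: "D x = 0" if "x \<in> {0..1}" for x
    using has_integral_0_cbox_imp_0[of 0 1 "\<lambda>x. D x * D x" x] that contS
    by (auto intro!: continuous_intros simp: cbox_interval)
  have per_int: "D (x + real_of_int n) = D x" for x n
  proof (induction n rule: int_induct[of _ 0])
    case (step1 i) thus ?case using per[of "x + real_of_int i"] by (simp add: algebra_simps)
  next
    case (step2 i) thus ?case using per[of "x + real_of_int (i - 1)"] by (simp add: algebra_simps)
  qed simp
  have "D x = D (frac x)" using per_int[of "frac x" "\<lfloor>x\<rfloor>"] by (simp add: frac_def)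
  also have "\<dots> = 0" by (rule D01) (auto simp: frac_lt_1 less_imp_le)
  finally show ?thesis .
qed


text \<open>This turns unordered sums over the integers into limits of sums over intervals.\<close>

lemma filterlim_int_intervals:
  fixes f :: "nat \<Rightarrow> int set"
  assumes "\<And>M. finite (f M)" and f: "\<And>M. {- int M..<int M} \<subseteq> f M"
  shows "filterlim f (finite_subsets_at_top UNIV) sequentially"
  unfolding filterlim_finite_subsets_at_top
proof (intro allI impI)
  fix X :: "int set" assume "finite X \<and> X \<subseteq> UNIV"
  hence "finite ((\<lambda>x. nat \<bar>x\<bar>) ` X)" by simp
  then obtain m where m: "\<And>x. x \<in> X \<Longrightarrow> nat \<bar>x\<bar> < m"
    unfolding finite_nat_set_iff_bounded by auto
  show "\<forall>\<^sub>F M in sequentially. finite (f M) \<and> X \<subseteq> f M \<and> f M \<subseteq> UNIV"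
    using eventually_ge_at_top[of m]
  proof eventually_elim
    case (elim M)
    have "x \<in> {- int M..<int M}" if "x \<in> X" for x
      using m[OF that] elim by auto
    thus ?case using assms by blast
  qed
qed

lemma int_series_integral:
  fixes F :: "int \<Rightarrow> real \<Rightarrow> real"
  assumes cont: "\<And>n. continuous_on UNIV (F n)"
    and bound: "\<And>X. \<exists>M. M summable_on UNIV \<and> (\<forall>n x. \<bar>x\<bar> \<le> X \<longrightarrow> \<bar>F n x\<bar> \<le> M n)"
  shows int_series_summable: "(\<lambda>n. F n x) summable_on UNIV"
    and int_series_continuous: "continuous_on UNIV (\<lambda>x. \<Sum>\<^sub>\<infinity>n. F n x)"
    and int_series_has_sum_integral:
      "((\<lambda>n. integral {0..1} (F n)) has_sum integral {0..1} (\<lambda>x. \<Sum>\<^sub>\<infinity>n. F n x)) UNIV"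
proof -
  have ul: "uniform_limit {- X..X} (\<lambda>A x. \<Sum>n\<in>A. F n x) (\<lambda>x. \<Sum>\<^sub>\<infinity>n. F n x) (finite_subsets_at_top UNIV)" for X
  proof -
    from bound[of X] obtain M where M: "M summable_on UNIV" "\<And>n x. \<bar>x\<bar> \<le> X \<Longrightarrow> \<bar>F n x\<bar> \<le> M n"
      by (elim exE conjE) simp
    show ?thesis
    proof (rule Weierstrass_m_test_general[OF _ M(1)])
      fix n :: int and x :: real assume "x \<in> {- X..X}"
      hence "\<bar>x\<bar> \<le> X" by auto
      thus "norm (F n x) \<le> M n" using M(2) by simp
    qed
  qed
  have contF: "continuous_on S (F n)" for S n using cont by (rule continuous_on_subset) auto
  show "(\<lambda>n. F n x) summable_on UNIV"
  proof -
    from bound[of "\<bar>x\<bar>"] obtain M where M: "M summable_on UNIV" "\<And>n. \<bar>F n x\<bar> \<le> M n"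
      by (elim exE conjE) simp
    have "(\<lambda>n. norm (F n x)) summable_on UNIV"
      by (rule summable_on_comparison_test[OF M(1)]) (use M(2) in auto)
    thus ?thesis by (rule abs_summable_summable)
  qed
  show "continuous_on UNIV (\<lambda>x. \<Sum>\<^sub>\<infinity>n. F n x)"
    unfolding continuous_on_eq_continuous_at[OF open_UNIV]
  proof
    fix x :: real
    have "continuous_on {- (\<bar>x\<bar> + 1)..\<bar>x\<bar> + 1} (\<lambda>x. \<Sum>\<^sub>\<infinity>n. F n x)"
      by (rule uniform_limit_theorem[OF _ ul]) (auto intro!: always_eventually continuous_intros contF)
    hence "continuous_on {- (\<bar>x\<bar> + 1)<..<\<bar>x\<bar> + 1} (\<lambda>x. \<Sum>\<^sub>\<infinity>n. F n x)"
      by (rule continuous_on_subset) auto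
    moreover have "x \<in> {- (\<bar>x\<bar> + 1)<..<\<bar>x\<bar> + 1}" by auto
    ultimately show "isCont (\<lambda>x. \<Sum>\<^sub>\<infinity>n. F n x) x"
      using continuous_on_eq_continuous_at[OF open_greaterThanLessThan] by blast
  qed
  have ul01: "uniform_limit {0..1} (\<lambda>A x. \<Sum>n\<in>A. F n x) (\<lambda>x. \<Sum>\<^sub>\<infinity>n. F n x) (finite_subsets_at_top UNIV)"
    by (rule uniform_limit_on_subset[OF ul[of 1]]) auto
  obtain I J where IJ: "\<And>A. ((\<lambda>x. \<Sum>n\<in>A. F n x) has_integral I A) {0..1}"
      "((\<lambda>x. \<Sum>\<^sub>\<infinity>n. F n x) has_integral J) {0..1}" "(I \<longlongrightarrow> J) (finite_subsets_at_top UNIV)"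
    by (rule uniform_limit_integral[OF ul01]) (auto intro!: continuous_intros contF)
  have "I A = (\<Sum>n\<in>A. integral {0..1} (F n))" if "finite A" for A
    using integral_unique[OF IJ(1)[of A]]
      integral_sum[OF that, of F "{0..1}"] integrable_continuous_real[OF contF] by simp
  hence "\<forall>\<^sub>F A in finite_subsets_at_top UNIV. I A = (\<Sum>n\<in>A. integral {0..1} (F n))"
    by (intro eventually_finite_subsets_at_top_weakI) auto
  from tendsto_cong[OF this] IJ(3) have "((\<lambda>A. \<Sum>n\<in>A. integral {0..1} (F n)) \<longlongrightarrow> J) (finite_subsets_at_top UNIV)"
    by simp
  thus "((\<lambda>n. integral {0..1} (F n)) has_sum integral {0..1} (\<lambda>x. \<Sum>\<^sub>\<infinity>n. F n x)) UNIV"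
    unfolding has_sum_def integral_unique[OF IJ(2)] .
qed

lemma integral_cos_int: "integral {0..1} (\<lambda>x. cos (2 * pi * real_of_int m * x)) = (if m = 0 then 1 else 0)"
proof (cases "m = 0")
  case False
  have "((\<lambda>x. cos (2 * pi * real_of_int m * x)) has_integral
      (sin (2 * pi * real_of_int m * 1) / (2 * pi * real_of_int m) - sin (2 * pi * real_of_int m * 0) / (2 * pi * real_of_int m))) {0..1}"
    by (rule fundamental_theorem_of_calculus)
       (use False in \<open>auto intro!: derivative_eq_intros simp flip: has_real_derivative_iff_has_vector_derivative\<close>)
  moreover have "sin (2 * pi * real_of_int m) = 0"
    using sin_int_2pin[of m] by (simp add: mult_ac)
  ultimately show ?thesis using False by (simp add: integral_unique)
qed simp

lemma sum_integral_unit_intervals: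
  fixes F :: "real \<Rightarrow> real"
  assumes cont: "continuous_on UNIV F"
  shows "(\<Sum>n\<in>{a..<a + int k}. integral {0..1} (\<lambda>x. F (x + real_of_int n))) =
           integral {real_of_int a..real_of_int a + real k} F"
proof (induction k)
  case (Suc k)
  have int: "F integrable_on {u..v}" for u v
    by (intro integrable_continuous_real continuous_on_subset[OF cont]) auto
  have "{a..<a + int (Suc k)} = insert (a + int k) {a..<a + int k}" by auto
  hence "(\<Sum>n\<in>{a..<a + int (Suc k)}. integral {0..1} (\<lambda>x. F (x + real_of_int n))) =
      integral {0..1} (\<lambda>x. F (x + real_of_int (a + int k))) + integral {real_of_int a..real_of_int a + real k} F"
    using Suc by simp
  also have "integral {0..1} (\<lambda>x. F (x + real_of_int (a + int k))) =
      integral {real_of_int a + real k..real_of_int a + real (Suc k)} F"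
    using integral_shift[of 0 "real_of_int (a + int k)" 1 F] continuous_on_subset[OF cont]
    by (simp add: o_def add_ac)
  finally show ?case
    using Henstock_Kurzweil_Integration.integral_combine[of "real_of_int a" "real_of_int a + real k"
        "real_of_int a + real (Suc k)" F] int by simp
qed simp

text \<open>
  Poisson summation for the Gaussian of variance proportional to \<open>s\<close>: the two sides are compared
  through their Fourier coefficients on the unit interval.
\<close>

lemma theta_one_imag_inversion_real:
  fixes s x :: real
  assumes s: "s > 0"
  shows "(\<Sum>\<^sub>\<infinity>n::int. exp (- (pi * (x + real_of_int n)\<^sup>2 / s))) =
         (\<Sum>\<^sub>\<infinity>k::int. sqrt s * exp (- (pi * s * (real_of_int k)\<^sup>2)) * cos (2 * pi * real_of_int k * x))"
proof -
  define G where "G = (\<lambda>n x. exp (- (pi * (x + real_of_int n)\<^sup>2 / s)))"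
  define H where "H = (\<lambda>k x. sqrt s * exp (- (pi * s * (real_of_int k)\<^sup>2)) * cos (2 * pi * real_of_int k * x))"
  have G_bound: "\<exists>M. M summable_on UNIV \<and> (\<forall>n x. \<bar>x\<bar> \<le> X \<longrightarrow> \<bar>G n x\<bar> \<le> M n)" for X
  proof -
    from theta_term_bound[of 1 "\<lambda>_. 1" "1 / s" "X / s"] exp_growth_one s obtain K where
      "\<forall>l \<tau> w. 1 / s \<le> Im \<tau> \<longrightarrow> \<bar>Im w\<bar> \<le> X / s \<longrightarrow>
        norm (theta_term 1 (\<lambda>_. 1) \<tau> w l) \<le> K * exp (- \<bar>real_of_int l\<bar>)" by auto
    hence K: "norm (theta_term 1 (\<lambda>_. 1) (\<i> / s) (\<i> * x / s) n) \<le> K * exp (- \<bar>real_of_int n\<bar>)"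
      if "\<bar>x\<bar> \<le> X" for n x
      using that s by (simp add: divide_right_mono)
    have "\<bar>G n x\<bar> \<le> K * exp (- \<bar>real_of_int n\<bar>)" if x: "\<bar>x\<bar> \<le> X" for n x
    proof -
      have "norm (theta_term 1 (\<lambda>_. 1) (\<i> / s) (\<i> * x / s) n) =
          exp (- (pi * (real_of_int n)\<^sup>2 / s) - 2 * pi * real_of_int n * x / s)"
        by (simp add: theta_term_def flip: of_int_power of_real_divide)
      moreover have "G n x \<le> exp (- (pi * (real_of_int n)\<^sup>2 / s) - 2 * pi * real_of_int n * x / s)"
      proof -
        have "pi * (x + real_of_int n)\<^sup>2 / s =
            pi * x\<^sup>2 / s + pi * (real_of_int n)\<^sup>2 / s + 2 * pi * real_of_int n * x / s"
          using s by (simp add: field_simps power2_sum)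
        moreover have "pi * x\<^sup>2 / s \<ge> 0" using s by simp
        ultimately show ?thesis by (simp add: G_def)
      qed
      moreover have "\<bar>G n x\<bar> = G n x" by (simp add: G_def)
      ultimately show ?thesis using K[OF x, of n] by linarith
    qed
    thus ?thesis
      by (intro exI[of _ "\<lambda>n. K * exp (- \<bar>real_of_int n\<bar>)"] conjI summable_on_cmult_right[OF summable_exp_neg_abs_int]) auto
  qed
  have H_bound: "\<exists>M. M summable_on UNIV \<and> (\<forall>n x. \<bar>x\<bar> \<le> X \<longrightarrow> \<bar>H n x\<bar> \<le> M n)" for X
  proof -
    have "(\<lambda>n. norm (theta_term 1 (\<lambda>_. 1) (\<i> * s) 0 n)) summable_on UNIV"
      by (rule theta_term_abs_summable[OF _ exp_growth_one]) (use s in auto)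
    moreover have "norm (theta_term 1 (\<lambda>_. 1) (\<i> * s) 0 n) = exp (- (pi * s * (real_of_int n)\<^sup>2))" for n
      by (simp add: theta_term_def mult_ac flip: of_int_power)
    ultimately have "(\<lambda>n. sqrt s * exp (- (pi * s * (real_of_int n)\<^sup>2))) summable_on UNIV"
      by (simp add: summable_on_cmult_right)
    thus ?thesis using s
      by (intro exI[of _ "\<lambda>n. sqrt s * exp (- (pi * s * (real_of_int n)\<^sup>2))"])
         (auto simp: H_def abs_mult intro!: mult_left_le)
  qed
  have G_cont: "continuous_on UNIV (G n)" for n
    unfolding G_def divide_inverse by (intro continuous_intros)
  have H_cont: "continuous_on UNIV (H n)" for n
    unfolding H_def by (intro continuous_intros)
  define g where "g = (\<lambda>x. \<Sum>\<^sub>\<infinity>n. G n x)"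
  define h where "h = (\<lambda>x. \<Sum>\<^sub>\<infinity>n. H n x)"
  note G_sum = int_series_summable[of G, OF G_cont G_bound]
  note H_sum = int_series_summable[of H, OF H_cont H_bound]
  have g_cont: "continuous_on UNIV g" unfolding g_def by (rule int_series_continuous[OF G_cont G_bound])
  have h_cont: "continuous_on UNIV h" unfolding h_def by (rule int_series_continuous[OF H_cont H_bound])
  have cos_bound: "\<exists>M. M summable_on UNIV \<and> (\<forall>n x. \<bar>x\<bar> \<le> X \<longrightarrow> \<bar>F n x * cos (2 * pi * real j * x)\<bar> \<le> M n)"
    if "\<exists>M. M summable_on UNIV \<and> (\<forall>n x. \<bar>x\<bar> \<le> X \<longrightarrow> \<bar>F n x\<bar> \<le> M n)" for F :: "int \<Rightarrow> real \<Rightarrow> real" and X j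
  proof -
    from that obtain M where M: "M summable_on UNIV" "\<And>n x. \<bar>x\<bar> \<le> X \<Longrightarrow> \<bar>F n x\<bar> \<le> M n" by auto
    have "\<bar>F n x * cos (2 * pi * real j * x)\<bar> \<le> M n" if "\<bar>x\<bar> \<le> X" for n x
    proof -
      have "\<bar>F n x * cos (2 * pi * real j * x)\<bar> \<le> \<bar>F n x\<bar> * 1"
        unfolding abs_mult by (intro mult_left_mono) auto
      also have "\<dots> \<le> M n" using M(2)[OF that, of n] by simp
      finally show ?thesis .
    qed
    thus ?thesis using M(1) by blast
  qed
  \<comment> \<open>Unfolding the sum over translates turns the coefficient into an integral over the real line.\<close>
  have g_coeff: "integral {0..1} (\<lambda>x. g x * cos (2 * pi * real j * x)) = sqrt s * exp (- (pi * s * (real j)\<^sup>2))" for j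
  proof -
    define F where "F = (\<lambda>x. exp (- (pi * (1 / s) * x\<^sup>2)) * cos (2 * pi * real j * x))"
    have F_cont: "continuous_on UNIV F" unfolding F_def by (intro continuous_intros)
    have F: "G n x * cos (2 * pi * real j * x) = F (x + real_of_int n)" for n x
    proof -
      have "2 * pi * real j * (x + real_of_int n) = 2 * pi * real j * x + 2 * real_of_int (int j * n) * pi"
        by (simp add: algebra_simps)
      hence "cos (2 * pi * real j * (x + real_of_int n)) = cos (2 * pi * real j * x)"
        using cos_int_2pin[of "int j * n"] sin_int_2pin[of "int j * n"] by (simp add: cos_add mult_ac)
      thus ?thesis by (simp add: F_def G_def)
    qed
    have "((\<lambda>n. integral {0..1} (\<lambda>x. G n x * cos (2 * pi * real j * x))) has_sum
        integral {0..1} (\<lambda>x. \<Sum>\<^sub>\<infinity>n. G n x * cos (2 * pi * real j * x))) UNIV"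
      by (rule int_series_has_sum_integral) (intro continuous_intros G_cont cos_bound G_bound)+
    moreover have "(\<Sum>\<^sub>\<infinity>n. G n x * cos (2 * pi * real j * x)) = g x * cos (2 * pi * real j * x)" for x
      unfolding g_def by (rule infsum_cmult_left) (rule G_sum)
    ultimately have "((\<lambda>n. integral {0..1} (\<lambda>x. F (x + real_of_int n))) has_sum
        integral {0..1} (\<lambda>x. g x * cos (2 * pi * real j * x))) UNIV"
      by (simp only: F)
    hence "(\<lambda>M. \<Sum>n\<in>{- int M..<int M}. integral {0..1} (\<lambda>x. F (x + real_of_int n))) \<longlonglongrightarrow>
        integral {0..1} (\<lambda>x. g x * cos (2 * pi * real j * x))"
      unfolding has_sum_def by (rule filterlim_compose[OF _ filterlim_int_intervals]) auto
    moreover have "(\<Sum>n\<in>{- int M..<int M}. integral {0..1} (\<lambda>x. F (x + real_of_int n))) =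
        integral {- real M..real M} F" for M
      using sum_integral_unit_intervals[OF F_cont, of "- int M" "2 * M"] by simp
    ultimately have "(\<lambda>M. integral {- real M..real M} F) \<longlonglongrightarrow> integral {0..1} (\<lambda>x. g x * cos (2 * pi * real j * x))"
      by simp
    moreover have "(\<lambda>M. integral {- real M..real M} F) \<longlonglongrightarrow> exp (- (pi * (real j)\<^sup>2 / (1 / s))) / sqrt (1 / s)"
      unfolding F_def by (rule gaussian_cos_cutoff) (use s in simp)
    ultimately have "integral {0..1} (\<lambda>x. g x * cos (2 * pi * real j * x)) = exp (- (pi * (real j)\<^sup>2 / (1 / s))) / sqrt (1 / s)"
      by (rule LIMSEQ_unique)
    thus ?thesis using s by (simp add: real_sqrt_divide mult_ac)
  qed
  have h_coeff: "integral {0..1} (\<lambda>x. h x * cos (2 * pi * real j * x)) = sqrt s * exp (- (pi * s * (real j)\<^sup>2))" for j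
  proof -
    define c where "c = sqrt s * exp (- (pi * s * (real j)\<^sup>2))"
    have coeff: "integral {0..1} (\<lambda>x. H k x * cos (2 * pi * real j * x)) =
        (if k = int j then c / 2 else 0) + (if k = - int j then c / 2 else 0)" for k
    proof -
      define b where "b = sqrt s * exp (- (pi * s * (real_of_int k)\<^sup>2))"
      have "H k x * cos (2 * pi * real j * x) =
         b / 2 * (cos (2 * pi * real_of_int (k - int j) * x) + cos (2 * pi * real_of_int (k + int j) * x))" for x
      proof -
        have "cos (2 * pi * real_of_int k * x) * cos (2 * pi * real j * x) =
          (cos (2 * pi * real_of_int (k - int j) * x) + cos (2 * pi * real_of_int (k + int j) * x)) / 2"
          by (simp add: cos_times_cos algebra_simps)
        thus ?thesis by (simp add: H_def b_def mult.assoc)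
      qed
      moreover have "(\<lambda>x. cos (2 * pi * real_of_int m * x)) integrable_on {0..1}" for m
        by (intro integrable_continuous_real continuous_intros)
      ultimately have "integral {0..1} (\<lambda>x. H k x * cos (2 * pi * real j * x)) =
         b / 2 * ((if k - int j = 0 then 1 else 0) + (if k + int j = 0 then 1 else 0))"
        by (simp only: integral_mult_right integral_add integral_cos_int)
      also have "\<dots> = (if k = int j then b / 2 else 0) + (if k = - int j then b / 2 else 0)"
        by (auto simp: add_eq_0_iff)
      also have "\<dots> = (if k = int j then c / 2 else 0) + (if k = - int j then c / 2 else 0)"
        by (auto simp: b_def c_def)
      finally show ?thesis .
    qed
    have "((\<lambda>k. integral {0..1} (\<lambda>x. H k x * cos (2 * pi * real j * x))) has_sum
        integral {0..1} (\<lambda>x. \<Sum>\<^sub>\<infinity>k. H k x * cos (2 * pi * real j * x))) UNIV"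
      by (rule int_series_has_sum_integral) (intro continuous_intros H_cont cos_bound H_bound)+
    moreover have "(\<Sum>\<^sub>\<infinity>n. H n x * cos (2 * pi * real j * x)) = h x * cos (2 * pi * real j * x)" for x
      unfolding h_def by (rule infsum_cmult_left) (rule H_sum)
    ultimately have "((\<lambda>k. (if k = int j then c / 2 else 0) + (if k = - int j then c / 2 else 0)) has_sum
        integral {0..1} (\<lambda>x. h x * cos (2 * pi * real j * x))) UNIV"
      by (simp only: coeff)
    moreover have single: "((\<lambda>k. if k = m then c / 2 else 0) has_sum c / 2) UNIV" for m :: int
      by (rule has_sum_finite_neutralI[of "{m}"]) auto
    have "((\<lambda>k. (if k = int j then c / 2 else 0) + (if k = - int j then c / 2 else 0)) has_sum (c / 2 + c / 2)) UNIV"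
      by (intro has_sum_add single)
    ultimately have "integral {0..1} (\<lambda>x. h x * cos (2 * pi * real j * x)) = c / 2 + c / 2"
      by (rule has_sum_unique)
    thus ?thesis by (simp add: c_def)
  qed
  define D where "D = (\<lambda>x. g x - h x)"
  have bij1: "bij_betw (\<lambda>n::int. n + 1) UNIV UNIV"
    by (rule bij_betwI[of _ _ _ "\<lambda>n. n - 1"]) auto
  have bij2: "bij_betw (\<lambda>n::int. - n) UNIV UNIV"
    by (rule bij_betwI[of _ _ _ "\<lambda>n. - n"]) auto
  have "D x = 0"
  proof (rule even_periodic_eq_0I[of D])
    show "continuous_on UNIV D" unfolding D_def by (intro continuous_intros g_cont h_cont)
    fix x :: real
    have "g (x + 1) = g x"
    proof -
      have "g (x + 1) = (\<Sum>\<^sub>\<infinity>n. G (n + 1) x)" by (simp add: g_def G_def add_ac)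
      also have "\<dots> = g x" unfolding g_def by (rule infsum_reindex_bij_betw[OF bij1, of "\<lambda>n. G n x"])
      finally show ?thesis .
    qed
    moreover have "h (x + 1) = h x"
    proof -
      have "cos (2 * pi * real_of_int k * (x + 1)) = cos (2 * pi * real_of_int k * x)" for k
        using cos_int_2pin[of k] sin_int_2pin[of k] by (simp add: cos_add distrib_left mult_ac)
      thus ?thesis by (simp add: h_def H_def)
    qed
    ultimately show "D (x + 1) = D x" by (simp add: D_def)
    have "g (- x) = g x"
    proof -
      have "G n (- x) = G (- n) x" for n by (simp add: G_def power2_eq_square algebra_simps)
      hence "g (- x) = (\<Sum>\<^sub>\<infinity>n. G (- n) x)" by (simp add: g_def)
      also have "\<dots> = g x" unfolding g_def by (rule infsum_reindex_bij_betw[OF bij2, of "\<lambda>n. G n x"])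
      finally show ?thesis .
    qed
    moreover have "h (- x) = h x" by (simp add: h_def H_def)
    ultimately show "D (- x) = D x" by (simp add: D_def)
  next
    fix j :: nat
    have "integral {0..1} (\<lambda>x. D x * cos (2 * pi * real j * x)) =
       integral {0..1} (\<lambda>x. g x * cos (2 * pi * real j * x)) - integral {0..1} (\<lambda>x. h x * cos (2 * pi * real j * x))"
      unfolding D_def left_diff_distrib
      by (intro integral_diff integrable_continuous_real continuous_intros
            continuous_on_subset[OF g_cont] continuous_on_subset[OF h_cont]) auto
    thus "integral {0..1} (\<lambda>x. D x * cos (2 * pi * real j * x)) = 0" by (simp add: g_coeff h_coeff)
  qed
  thus ?thesis by (simp add: D_def g_def h_def G_def H_def)
qed


lemma theta_reindex_neg: "theta N (\<lambda>l. a (- l)) \<tau> w = theta N a \<tau> (- w)"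
proof -
  have bij: "bij_betw (\<lambda>n::int. - n) UNIV UNIV"
    by (rule bij_betwI[of _ _ _ "\<lambda>n. - n"]) auto
  have "theta N a \<tau> (- w) = (\<Sum>\<^sub>\<infinity>l. theta_term N a \<tau> (- w) (- l))"
    unfolding theta_def by (rule infsum_reindex_bij_betw[OF bij, symmetric])
  thus ?thesis by (simp add: theta_def theta_term_def)
qed

lemma has_sum_complex_of_real_eq:
  assumes "((\<lambda>x. complex_of_real (f x)) has_sum S) A"
  shows "S = of_real (infsum f A)"
proof -
  have "(f has_sum Re S) A"
    using has_sum_bounded_linear[OF bounded_linear_Re assms] by (simp add: o_def)
  moreover have "((\<lambda>_. 0) has_sum Im S) A"
    using has_sum_bounded_linear[OF bounded_linear_Im assms] by (simp add: o_def)
  moreover from this have "Im S = 0"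
    by (rule has_sum_unique) simp
  ultimately show ?thesis by (simp add: complex_eq_iff infsumI)
qed

lemma theta_one_imag_inversion:
  fixes s x :: real
  assumes s: "s > 0"
  shows "theta_one (- 1 / (\<i> * s)) (x / (\<i> * s)) =
           csqrt (- \<i> * (\<i> * s)) * exp (pi * \<i> * (of_real x)\<^sup>2 / (\<i> * s)) * theta_one (\<i> * s) x"
proof -
  let ?g = "\<Sum>\<^sub>\<infinity>n::int. exp (- (pi * (- x + real_of_int n)\<^sup>2 / s))"
  have inv: "- 1 / (\<i> * s) = \<i> / s" "x / (\<i> * s) = - (\<i> * x / s)"
    using s by (simp_all add: field_simps)
  have 1: "theta_one (\<i> / s) (- (\<i> * x / s)) = of_real (exp (pi * x\<^sup>2 / s)) * of_real ?g"
  proof -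
    have "theta_term 1 (\<lambda>_. 1) (\<i> / s) (- (\<i> * x / s)) n =
        of_real (exp (pi * x\<^sup>2 / s) * exp (- (pi * (- x + real_of_int n)\<^sup>2 / s)))" for n
    proof -
      have "pi * \<i> * (of_int n)\<^sup>2 * (\<i> / s) / of_nat 1 + 2 * pi * \<i> * of_int n * (- (\<i> * x / s)) / of_real (sqrt (real 1)) =
        of_real (pi * x\<^sup>2 / s + - (pi * (- x + real_of_int n)\<^sup>2 / s))"
        using s by (simp add: field_simps power2_eq_square)
      thus ?thesis
        unfolding theta_term_def exp_add[symmetric] exp_of_real[symmetric] by simp
    qed
    moreover have "(theta_term 1 (\<lambda>_. 1) (\<i> / s) (- (\<i> * x / s)) has_sum
        theta_one (\<i> / s) (- (\<i> * x / s))) UNIV"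
      by (rule theta_has_sum[OF _ exp_growth_one]) (use s in auto)
    ultimately have "theta_one (\<i> / s) (- (\<i> * x / s)) =
        of_real (\<Sum>\<^sub>\<infinity>n. exp (pi * x\<^sup>2 / s) * exp (- (pi * (- x + real_of_int n)\<^sup>2 / s)))"
      by (intro has_sum_complex_of_real_eq) (metis (no_types, lifting) has_sum_cong)
    also have "\<dots> = of_real (exp (pi * x\<^sup>2 / s)) * of_real ?g"
      by (subst infsum_cmult_right') simp
    finally show ?thesis .
  qed
  have 2: "of_real (sqrt s) * theta_one (\<i> * s) x = of_real ?g"
  proof -
    have "(theta_term 1 (\<lambda>_. 1) (\<i> * s) w has_sum theta_one (\<i> * s) w) UNIV" for w
      by (rule theta_has_sum[OF _ exp_growth_one]) (use s in auto)
    note hs = has_sum_add[OF this[of x] this[of "- x"]]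
    have sym: "theta_one (\<i> * s) (- x) = theta_one (\<i> * s) x"
      unfolding of_real_minus by (rule theta_reindex_neg[symmetric])
    have "((\<lambda>k. theta_term 1 (\<lambda>_. 1) (\<i> * s) x k + theta_term 1 (\<lambda>_. 1) (\<i> * s) (- x) k) has_sum
       2 * theta_one (\<i> * s) x) UNIV"
      using hs unfolding sym mult_2 .
    from has_sum_cmult_right[OF this, of "of_real (sqrt s) / 2"]
    have "((\<lambda>k. of_real (sqrt s) / 2 * (theta_term 1 (\<lambda>_. 1) (\<i> * s) x k + theta_term 1 (\<lambda>_. 1) (\<i> * s) (- x) k)) has_sum
       of_real (sqrt s) * theta_one (\<i> * s) x) UNIV" by simp
    moreover have "of_real (sqrt s) / 2 * (theta_term 1 (\<lambda>_. 1) (\<i> * s) x k + theta_term 1 (\<lambda>_. 1) (\<i> * s) (- x) k) =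
       complex_of_real (sqrt s * exp (- (pi * s * (real_of_int k)\<^sup>2)) * cos (2 * pi * real_of_int k * (- x)))" for k
    proof -
      have e: "theta_term 1 (\<lambda>_. 1) (\<i> * s) (of_real y) k =
         of_real (exp (- (pi * s * (real_of_int k)\<^sup>2))) * cis (2 * pi * real_of_int k * y)" for y
      proof -
        have "pi * \<i> * (of_int k)\<^sup>2 * (\<i> * s) / of_nat 1 + 2 * pi * \<i> * of_int k * of_real y / of_real (sqrt (real 1)) =
            of_real (- (pi * s * (real_of_int k)\<^sup>2)) + \<i> * of_real (2 * pi * real_of_int k * y)"
          by (simp add: algebra_simps power2_eq_square)
        thus ?thesis
          unfolding theta_term_def cis_conv_exp exp_of_real[symmetric] exp_add[symmetric] by (simp only: mult_1)
      qed
      have "cis (2 * pi * real_of_int k * x) + cis (2 * pi * real_of_int k * (- x)) =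
         2 * of_real (cos (2 * pi * real_of_int k * (- x)))"
        by (simp add: complex_eq_iff)
      thus ?thesis unfolding e distrib_left[symmetric] by simp
    qed
    ultimately have "((\<lambda>k. complex_of_real (sqrt s * exp (- (pi * s * (real_of_int k)\<^sup>2)) * cos (2 * pi * real_of_int k * (- x)))) has_sum
       of_real (sqrt s) * theta_one (\<i> * s) x) UNIV" by (simp only:)
    hence "of_real (sqrt s) * theta_one (\<i> * s) x =
       of_real (\<Sum>\<^sub>\<infinity>k. sqrt s * exp (- (pi * s * (real_of_int k)\<^sup>2)) * cos (2 * pi * real_of_int k * (- x)))"
      by (rule has_sum_complex_of_real_eq)
    also have "\<dots> = of_real ?g"
      using theta_one_imag_inversion_real[OF s, of "- x"] by simp
    finally show ?thesis .
  qed
  have 3: "csqrt (- \<i> * (\<i> * s)) = of_real (sqrt s)"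
  proof -
    have "- \<i> * (\<i> * s) = of_real s" by (simp add: complex_eq_iff)
    thus ?thesis using csqrt_of_real_nonneg[of "of_real s"] s by simp
  qed
  have 4: "exp (pi * \<i> * (of_real x)\<^sup>2 / (\<i> * s)) = of_real (exp (pi * x\<^sup>2 / s))"
  proof -
    have "pi * \<i> * (of_real x)\<^sup>2 / (\<i> * s) = of_real (pi * x\<^sup>2 / s)" using s by simp
    thus ?thesis by (simp only: exp_of_real)
  qed
  show ?thesis unfolding inv 1 3 4 2[symmetric] by simp
qed

text \<open>
  Analytic continuation, first in \<open>\<tau>\<close> from the imaginary axis for fixed real \<open>z\<close>, and then in \<open>z\<close>
  from the real line for fixed \<open>\<tau>\<close>.
\<close>

theorem theta_one_inversion:
  assumes \<tau>: "Im \<tau> > 0"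
  shows "theta_one (- 1 / \<tau>) (z / \<tau>) =
           csqrt (- \<i> * \<tau>) * exp (pi * \<i> * z\<^sup>2 / \<tau>) * theta_one \<tau> z"
proof -
  define S where "S = {\<tau>. Im \<tau> > 0}"
  have S: "open S" "connected S"
    unfolding S_def by (rule open_halfspace_Im_gt, rule convex_connected[OF convex_halfspace_Im_gt])
  have nz: "\<sigma> \<noteq> 0" if "\<sigma> \<in> S" for \<sigma> using that by (auto simp: S_def)
  have inv: "Im (- 1 / \<sigma>) > 0" if "\<sigma> \<in> S" for \<sigma>
    using Im_inversion_pos that by (simp add: S_def)
  have csq: "(\<lambda>\<sigma>. csqrt (- \<i> * \<sigma>)) holomorphic_on S"
  proof (rule holomorphic_on_csqrt')
    fix \<sigma> assume "\<sigma> \<in> S"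
    hence "Re (- \<i> * \<sigma>) > 0" by (simp add: S_def)
    thus "- \<i> * \<sigma> \<notin> \<real>\<^sub>\<le>\<^sub>0" by (auto simp: complex_nonpos_Reals_iff)
  qed (intro holomorphic_intros)
  have real: "theta_one (- 1 / \<sigma>) (of_real x / \<sigma>) -
      csqrt (- \<i> * \<sigma>) * exp (pi * \<i> * (of_real x)\<^sup>2 / \<sigma>) * theta_one \<sigma> (of_real x) = 0"
    (is "?f \<sigma> = 0") if \<sigma>: "\<sigma> \<in> S" for \<sigma> and x :: real
  proof (rule analytic_continuation[of ?f S "{\<sigma>. Re \<sigma> = 0 \<and> Im \<sigma> > 0}" \<i>])
    show "?f holomorphic_on S"
      by (intro holomorphic_intros holomorphic_theta_comp csq exp_growth_one S) (use nz inv in \<open>auto simp: S_def\<close>)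
    show "\<i> islimpt {\<sigma>. Re \<sigma> = 0 \<and> Im \<sigma> > 0}"
      unfolding islimpt_approachable
    proof (intro allI impI)
      fix e :: real assume e: "e > 0"
      show "\<exists>x'\<in>{\<sigma>. Re \<sigma> = 0 \<and> Im \<sigma> > 0}. x' \<noteq> \<i> \<and> dist x' \<i> < e"
        by (rule bexI[of _ "Complex 0 (1 + e / 2)"])
           (use e in \<open>auto simp: dist_norm complex_eq_iff cmod_def\<close>)
    qed
    fix z assume "z \<in> {\<sigma>. Re \<sigma> = 0 \<and> Im \<sigma> > 0}"
    hence "z = \<i> * of_real (Im z)" "Im z > 0" by (auto simp: complex_eq_iff)
    thus "?f z = 0" using theta_one_imag_inversion[of "Im z" x] by simp
  qed (use S \<sigma> in \<open>auto simp: S_def\<close>)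
  have \<tau>S: "\<tau> \<in> S" using \<tau> by (simp add: S_def)
  let ?h = "\<lambda>z. theta_one (- 1 / \<tau>) (z / \<tau>) - csqrt (- \<i> * \<tau>) * exp (pi * \<i> * z\<^sup>2 / \<tau>) * theta_one \<tau> z"
  have "?h z = 0"
  proof (rule analytic_continuation[of ?h UNIV "\<real>" 0])
    show "?h holomorphic_on UNIV"
      by (intro holomorphic_intros holomorphic_theta_comp exp_growth_one) (use nz[OF \<tau>S] inv[OF \<tau>S] \<tau> in auto)
    show "0 islimpt (\<real> :: complex set)"
      unfolding islimpt_approachable
    proof (intro allI impI)
      fix e :: real assume e: "e > 0"
      show "\<exists>x'\<in>\<real>. x' \<noteq> 0 \<and> dist x' (0 :: complex) < e"
        by (rule bexI[of _ "of_real (e / 2)"]) (use e in auto)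
    qed
    fix w :: complex assume "w \<in> \<real>"
    then obtain x where "w = of_real x" by (elim Reals_cases)
    thus "?h w = 0" using real[OF \<tau>S, of x] by simp
  qed auto
  thus ?thesis by simp
qed

section \<open>Transformations of theta series with periodic coefficients\<close>

lemma has_sum_sum:
  fixes f :: "'i \<Rightarrow> 'a \<Rightarrow> 'b :: {topological_comm_monoid_add}"
  assumes "\<And>i. i \<in> I \<Longrightarrow> (f i has_sum s i) A"
  shows "((\<lambda>x. \<Sum>i\<in>I. f i x) has_sum (\<Sum>i\<in>I. s i)) A"
  using assms by (induction I rule: infinite_finite_induct) (auto intro: has_sum_add)

lemma theta_linear:
  assumes "N > 0" "Im \<tau> > 0" "\<And>r. r \<in> R \<Longrightarrow> exp_growth (f r)"
  shows "theta N (\<lambda>l. \<Sum>r\<in>R. c r * f r l) \<tau> w = (\<Sum>r\<in>R. c r * theta N (f r) \<tau> w)"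
proof -
  have "((\<lambda>l. \<Sum>r\<in>R. c r * theta_term N (f r) \<tau> w l) has_sum (\<Sum>r\<in>R. c r * theta N (f r) \<tau> w)) UNIV"
    using assms by (intro has_sum_sum has_sum_cmult_right theta_has_sum) auto
  moreover have "(\<Sum>r\<in>R. c r * theta_term N (f r) \<tau> w l) = theta_term N (\<lambda>l. \<Sum>r\<in>R. c r * f r l) \<tau> w l" for l
    by (simp add: theta_term_def sum_distrib_right mult.assoc)
  ultimately show ?thesis by (simp add: theta_def infsumI)
qed

lemma theta_cmult: "theta N (\<lambda>l. c * a l) \<tau> w = c * theta N a \<tau> w"
proof -
  have "theta N (\<lambda>l. c * a l) \<tau> w = (\<Sum>\<^sub>\<infinity>l. c * theta_term N a \<tau> w l)"
    by (simp add: theta_def theta_term_def mult.assoc)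
  thus ?thesis by (simp add: theta_def infsum_cmult_right')
qed

lemma theta_modulus_shift:
  "theta N a (\<tau> + 1) w = theta N (\<lambda>l. a l * exp (pi * \<i> * (of_int l)\<^sup>2 / of_nat N)) \<tau> w"
proof -
  have "pi * \<i> * (of_int l)\<^sup>2 * (\<tau> + 1) / of_nat N + 2 * pi * \<i> * of_int l * w / of_real (sqrt N) =
      pi * \<i> * (of_int l)\<^sup>2 / of_nat N +
      (pi * \<i> * (of_int l)\<^sup>2 * \<tau> / of_nat N + 2 * pi * \<i> * of_int l * w / of_real (sqrt N))" for l
    by (simp add: distrib_left add_divide_distrib)
  thus ?thesis unfolding theta_def theta_term_def by (simp only: exp_add mult.assoc)
qed

lemma theta_lattice_shift:
  fixes m k :: int
  assumes N: "N > 0" and per: "\<And>l. a (l + int N) = a l"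
  shows "theta N a \<tau> (w + \<tau> * of_real (sqrt N * m) + of_real (sqrt N * k)) =
           exp (- pi * \<i> * (of_real ((sqrt N * m)\<^sup>2) * \<tau> + 2 * (of_real (sqrt N * m) * w))) * theta N a \<tau> w"
proof -
  have per': "a (l + int N * j) = a l" for l j
  proof (induction j rule: int_induct[of _ 0])
    case (step1 i) thus ?case using per[of "l + int N * i"] by (simp add: algebra_simps)
  next
    case (step2 i) thus ?case using per[of "l + int N * (i - 1)"] by (simp add: algebra_simps)
  qed simp
  define q where "q = complex_of_real (sqrt N)"
  have q: "q \<noteq> 0" "q * q = of_nat N" using N by (auto simp: q_def simp flip: of_real_mult)
  let ?c = "exp (- pi * \<i> * (of_real ((sqrt N * m)\<^sup>2) * \<tau> + 2 * (of_real (sqrt N * m) * w)))"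
  have trm: "theta_term N a \<tau> (w + \<tau> * of_real (sqrt N * m) + of_real (sqrt N * k)) l =
      ?c * theta_term N a \<tau> w (l + int N * m)" for l
  proof -
    have "pi * \<i> * (of_int l)\<^sup>2 * \<tau> / of_nat N + 2 * pi * \<i> * of_int l * (w + \<tau> * of_real (sqrt N * m) + of_real (sqrt N * k)) / of_real (sqrt N) =
       (- pi * \<i> * (of_real ((sqrt N * m)\<^sup>2) * \<tau> + 2 * (of_real (sqrt N * m) * w)) +
       (pi * \<i> * (of_int (l + int N * m))\<^sup>2 * \<tau> / of_nat N + 2 * pi * \<i> * of_int (l + int N * m) * w / of_real (sqrt N))) +
       2 * of_int (l * k) * pi * \<i>"
      unfolding of_real_mult of_real_power q_def[symmetric] of_int_add of_int_mult of_int_of_nat_eq q(2)[symmetric] of_real_of_int_eq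
      using q(1) by (simp add: field_simps power2_eq_square)
    moreover have "exp (2 * of_int (l * k) * pi * \<i>) = (1 :: complex)"
      by (rule exp_integer_2pi) simp
    ultimately show ?thesis
      unfolding theta_term_def per' by (simp only: exp_add mult_1_right mult.left_commute[of "a l"])
  qed
  have bij: "bij_betw (\<lambda>l. l + int N * m) UNIV UNIV"
    by (rule bij_betwI[of _ _ _ "\<lambda>l. l - int N * m"]) auto
  have "theta N a \<tau> (w + \<tau> * of_real (sqrt N * m) + of_real (sqrt N * k)) =
     ?c * (\<Sum>\<^sub>\<infinity>l. theta_term N a \<tau> w (l + int N * m))"
    unfolding theta_def[of _ _ _ "w + _ + _"] trm by (rule infsum_cmult_right')
  also have "(\<Sum>\<^sub>\<infinity>l. theta_term N a \<tau> w (l + int N * m)) = theta N a \<tau> w"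
    unfolding theta_def by (rule infsum_reindex_bij_betw[OF bij])
  finally show ?thesis .
qed

lemma csqrt_mult_pos_real:
  assumes "c > 0" "Re z > 0"
  shows "csqrt (of_real c * z) = of_real (sqrt c) * csqrt z"
proof (rule csqrt_unique)
  show "(of_real (sqrt c) * csqrt z)\<^sup>2 = of_real c * z"
    using assms by (simp add: power_mult_distrib flip: of_real_power)
  have "Re (csqrt z) > 0"
    using assms by (simp add: complex_nonpos_Reals_iff csqrt.sel(1) real_sqrt_gt_zero add_pos_nonneg add_nonneg_pos)
  thus "0 < Re (of_real (sqrt c) * csqrt z) \<or> Re (of_real (sqrt c) * csqrt z) = 0 \<and> 0 \<le> Im (of_real (sqrt c) * csqrt z)"
    using assms by simp
qed

text \<open>
  The indicator function of a residue class and the additive characters modulo \<open>N\<close> both reduce to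
  \<open>N = 1\<close>, with modulus \<open>N \<tau>\<close>, respectively \<open>\<tau> / N\<close>. The inversion takes \<open>\<tau> / N\<close> to \<open>N (- 1 / \<tau>)\<close>.
\<close>

lemma theta_residue_class:
  assumes N: "N > 0" and r: "r < N" 
  shows "theta N (\<lambda>l. if l mod int N = int r then 1 else 0) \<tau> w =
           exp (pi * \<i> * (of_nat r)\<^sup>2 * \<tau> / of_nat N + 2 * pi * \<i> * of_nat r * w / of_real (sqrt N)) *
           theta_one (of_nat N * \<tau>) (of_real (sqrt N) * w + of_nat r * \<tau>)"
proof -
  define q where "q = complex_of_real (sqrt N)"
  have q: "q \<noteq> 0" "q * q = of_nat N" using N by (auto simp: q_def simp flip: of_real_mult)
  have inj: "inj (\<lambda>m. int r + int N * m)" using N by (auto simp: inj_on_def)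
  have rng: "range (\<lambda>m. int r + int N * m) = {l. l mod int N = int r}"
  proof (intro equalityI subsetI)
    fix l assume "l \<in> {l. l mod int N = int r}"
    hence "l = int r + int N * (l div int N)" using mod_mult_div_eq[of l "int N"] by simp
    thus "l \<in> range (\<lambda>m. int r + int N * m)" by blast
  qed (use r in auto)
  let ?\<delta> = "\<lambda>l. if l mod int N = int r then 1 else (0 :: complex)"
  let ?e = "exp (pi * \<i> * (of_nat r)\<^sup>2 * \<tau> / of_nat N + 2 * pi * \<i> * of_nat r * w / of_real (sqrt N))"
  have trm: "theta_term N ?\<delta> \<tau> w (int r + int N * m) =
     ?e * theta_term 1 (\<lambda>_. 1) (of_nat N * \<tau>) (of_real (sqrt N) * w + of_nat r * \<tau>) m" for m
  proof -
    have "pi * \<i> * (of_int (int r + int N * m))\<^sup>2 * \<tau> / of_nat N + 2 * pi * \<i> * of_int (int r + int N * m) * w / of_real (sqrt N) =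
      (pi * \<i> * (of_nat r)\<^sup>2 * \<tau> / of_nat N + 2 * pi * \<i> * of_nat r * w / of_real (sqrt N)) +
      (pi * \<i> * (of_int m)\<^sup>2 * (of_nat N * \<tau>) / of_nat 1 + 2 * pi * \<i> * of_int m * (of_real (sqrt N) * w + of_nat r * \<tau>) / of_real (sqrt (real 1)))"
      unfolding q_def[symmetric] of_int_add of_int_mult of_int_of_nat_eq q(2)[symmetric]
      using q(1) by (simp add: field_simps power2_eq_square)
    thus ?thesis using r unfolding theta_term_def by (simp only: exp_add) simp
  qed
  have "theta N ?\<delta> \<tau> w = infsum (theta_term N ?\<delta> \<tau> w) (range (\<lambda>m. int r + int N * m))"
    unfolding theta_def rng by (rule infsum_cong_neutral) (auto simp: theta_term_def)
  also have "\<dots> = (\<Sum>\<^sub>\<infinity>m. theta_term N ?\<delta> \<tau> w (int r + int N * m))"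
    by (subst infsum_reindex[OF inj]) (simp add: o_def)
  also have "\<dots> = ?e * theta_one (of_nat N * \<tau>) (of_real (sqrt N) * w + of_nat r * \<tau>)"
    unfolding trm theta_def by (rule infsum_cmult_right')
  finally show ?thesis .
qed

lemma theta_additive_character:
  assumes N: "N > 0"
  shows "theta N (\<lambda>m. exp (- 2 * pi * \<i> * of_nat r * of_int m / of_nat N)) \<tau> z =
           theta_one (\<tau> / of_nat N) (z / of_real (sqrt N) - of_nat r / of_nat N)"
proof -
  have "- 2 * pi * \<i> * of_nat r * of_int m / of_nat N +
     (pi * \<i> * (of_int m)\<^sup>2 * \<tau> / of_nat N + 2 * pi * \<i> * of_int m * z / of_real (sqrt N)) =
     pi * \<i> * (of_int m)\<^sup>2 * (\<tau> / of_nat N) / of_nat 1 +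
     2 * pi * \<i> * of_int m * (z / of_real (sqrt N) - of_nat r / of_nat N) / of_real (sqrt (real 1))" for m :: int
    using N by (simp add: field_simps)
  thus ?thesis unfolding theta_def theta_term_def exp_add[symmetric] by (simp only: mult_1)
qed

lemma theta_residue_class_inversion:
  assumes N: "N > 0" and r: "r < N" and \<tau>: "Im \<tau> > 0"
  shows "theta N (\<lambda>l. if l mod int N = int r then 1 else 0) (- 1 / \<tau>) (z / \<tau>) =
           csqrt (- \<i> * \<tau>) * exp (pi * \<i> * z\<^sup>2 / \<tau>) *
           (theta N (\<lambda>m. exp (- 2 * pi * \<i> * of_nat r * of_int m / of_nat N)) \<tau> z / of_real (sqrt N))"
proof -
  define q where "q = complex_of_real (sqrt N)"
  have q: "q \<noteq> 0" "q * q = of_nat N" using N by (auto simp: q_def simp flip: of_real_mult)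
  have \<tau>0: "\<tau> \<noteq> 0" using \<tau> by auto
  define z1 where "z1 = z / q - of_nat r / of_nat N"
  define \<tau>1 where "\<tau>1 = \<tau> / of_nat N"
  have \<tau>1: "Im \<tau>1 > 0" using \<tau> N by (simp add: \<tau>1_def)
  have a1: "of_nat N * (- 1 / \<tau>) = - 1 / \<tau>1" using N \<tau>0 by (simp add: \<tau>1_def)
  have a2: "q * (z / \<tau>) + of_nat r * (- 1 / \<tau>) = z1 / \<tau>1"
    unfolding z1_def \<tau>1_def q(2)[symmetric] using q(1) \<tau>0 by (simp add: field_simps)
  have a3: "csqrt (- \<i> * \<tau>1) = csqrt (- \<i> * \<tau>) / q"
  proof -
    have "- \<i> * \<tau>1 = of_real (1 / N) * (- \<i> * \<tau>)" using N by (simp add: \<tau>1_def)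
    thus ?thesis using csqrt_mult_pos_real[of "1 / N" "- \<i> * \<tau>"] N \<tau>
      by (simp add: real_sqrt_divide q_def)
  qed
  have a4: "pi * \<i> * (of_nat r)\<^sup>2 * (- 1 / \<tau>) / of_nat N + 2 * pi * \<i> * of_nat r * (z / \<tau>) / q + pi * \<i> * z1\<^sup>2 / \<tau>1
      = pi * \<i> * z\<^sup>2 / \<tau>"
    unfolding z1_def \<tau>1_def q(2)[symmetric] using q(1) \<tau>0 by (simp add: field_simps power2_eq_square)
  have "theta N (\<lambda>l. if l mod int N = int r then 1 else 0) (- 1 / \<tau>) (z / \<tau>) =
     exp (pi * \<i> * (of_nat r)\<^sup>2 * (- 1 / \<tau>) / of_nat N + 2 * pi * \<i> * of_nat r * (z / \<tau>) / q) *
     theta_one (of_nat N * (- 1 / \<tau>)) (q * (z / \<tau>) + of_nat r * (- 1 / \<tau>))"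
    unfolding q_def by (rule theta_residue_class[OF N r])
  also have "\<dots> = exp (pi * \<i> * (of_nat r)\<^sup>2 * (- 1 / \<tau>) / of_nat N + 2 * pi * \<i> * of_nat r * (z / \<tau>) / q) *
     (csqrt (- \<i> * \<tau>1) * exp (pi * \<i> * z1\<^sup>2 / \<tau>1) * theta_one \<tau>1 z1)"
    by (simp only: a1 a2 theta_one_inversion[OF \<tau>1])
  also have "\<dots> = (csqrt (- \<i> * \<tau>) / q) * exp (pi * \<i> * z\<^sup>2 / \<tau>) * theta_one \<tau>1 z1"
    unfolding a3 a4[symmetric] exp_add[of "_ + _"] by (simp only: mult_ac)
  finally show ?thesis
    unfolding theta_additive_character[OF N] q_def[symmetric] z1_def[symmetric] \<tau>1_def[symmetric] by simp
qed

text \<open>The coefficients \<open>b\<close> are the unitary finite Fourier transform of \<open>a\<close>.\<close>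

theorem theta_inversion:
  assumes N: "N > 0" and \<tau>: "Im \<tau> > 0" and per: "\<And>l. a l = a (l mod int N)"
    and b: "\<And>m. b m = (\<Sum>r<N. a (int r) * exp (- 2 * pi * \<i> * of_nat r * of_int m / of_nat N)) / of_real (sqrt N)"
  shows "theta N a (- 1 / \<tau>) (z / \<tau>) = csqrt (- \<i> * \<tau>) * exp (pi * \<i> * z\<^sup>2 / \<tau>) * theta N b \<tau> z"
proof -
  note inv = Im_inversion_pos[OF \<tau>]
  have a: "a l = (\<Sum>r<N. a (int r) * (if l mod int N = int r then 1 else 0))" for l
  proof -
    have "(\<Sum>r<N. a (int r) * (if l mod int N = int r then 1 else 0)) = (\<Sum>r<N. if r = nat (l mod int N) then a (int r) else 0)"
      using N by (intro sum.cong) auto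
    also have "\<dots> = a (l mod int N)" using N by (simp add: nat_less_iff)
    finally show ?thesis using per[of l] by simp
  qed
  have g1: "exp_growth (\<lambda>l. if l mod int N = int r then 1 else 0)" for r
    by (rule exp_growth_bounded[of _ 1]) simp
  have g2: "exp_growth (\<lambda>m. exp (- 2 * pi * \<i> * of_nat r * of_int m / of_nat N))" for r
    by (rule exp_growth_bounded[of _ 1]) (simp add: norm_exp_eq_Re)
  have "theta N a (- 1 / \<tau>) (z / \<tau>) = theta N (\<lambda>l. \<Sum>r<N. a (int r) * (if l mod int N = int r then 1 else 0)) (- 1 / \<tau>) (z / \<tau>)"
    by (rule arg_cong[OF ext[OF a], of "\<lambda>f. theta N f (- 1 / \<tau>) (z / \<tau>)"])
  also have "\<dots> = (\<Sum>r<N. a (int r) * theta N (\<lambda>l. if l mod int N = int r then 1 else 0) (- 1 / \<tau>) (z / \<tau>))"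
    by (rule theta_linear[OF N inv g1])
  also have "\<dots> = csqrt (- \<i> * \<tau>) * exp (pi * \<i> * z\<^sup>2 / \<tau>) *
      (\<Sum>r<N. a (int r) / of_real (sqrt N) * theta N (\<lambda>m. exp (- 2 * pi * \<i> * of_nat r * of_int m / of_nat N)) \<tau> z)"
    unfolding sum_distrib_left by (intro sum.cong refl, subst theta_residue_class_inversion[OF N _ \<tau>]) simp_all
  also have "(\<Sum>r<N. a (int r) / of_real (sqrt N) * theta N (\<lambda>m. exp (- 2 * pi * \<i> * of_nat r * of_int m / of_nat N)) \<tau> z) =
      theta N (\<lambda>m. \<Sum>r<N. a (int r) / of_real (sqrt N) * exp (- 2 * pi * \<i> * of_nat r * of_int m / of_nat N)) \<tau> z"
    by (rule theta_linear[OF N \<tau> g2, symmetric])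
  also have "(\<lambda>m. \<Sum>r<N. a (int r) / of_real (sqrt N) * exp (- 2 * pi * \<i> * of_nat r * of_int m / of_nat N)) = b"
    by (rule ext) (simp add: b sum_divide_distrib)
  finally show ?thesis .
qed

section \<open>The pentagonal number theorem and the eta function\<close>

text \<open>The triangular numbers.\<close>

definition triangular :: "nat \<Rightarrow> nat" where "triangular s = s * (s + 1) div 2"

lemma triangular_0 [simp]: "triangular 0 = 0" by (simp add: triangular_def)
lemma triangular_Suc: "triangular (Suc s) = triangular s + Suc s"
  unfolding triangular_def by (induction s) auto

text \<open>
  Shanks' finite form of the pentagonal number theorem: the sums on the left interpolate between
  partial products of \<open>\<Prod>(1 - q\<^sup>k)\<close> and partial sums of the pentagonal series. The first lemma
  compares the sums for \<open>n\<close> and \<open>n + 1\<close>, truncated at \<open>m\<close>, by telescoping in \<open>m\<close>.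
\<close>

lemma shanks_partial_sum:
  fixes q :: "'a :: comm_ring_1"
  assumes "m \<le> n"
  defines "R \<equiv> (\<lambda>n s. \<Prod>k\<in>{s<..n}. 1 - q ^ k)"
  shows "(\<Sum>s\<le>m. (-1) ^ s * R (Suc n) s * q ^ (s * Suc n + triangular s)) =
         (\<Sum>s\<le>m. (-1) ^ s * R n s * q ^ (s * n + triangular s)) - (-1) ^ m * R n m * q ^ (Suc m * Suc n + triangular m)"
  using assms(1)
proof (induction m)
  case 0
  have "{0<..Suc n} = insert (Suc n) {0<..n}" by auto
  thus ?case by (simp add: R_def algebra_simps)
next
  case (Suc m)
  have "{Suc m<..Suc n} = insert (Suc n) {Suc m<..n}" using Suc.prems by auto
  hence R1: "R (Suc n) (Suc m) = (1 - q ^ Suc n) * R n (Suc m)" by (simp add: R_def)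
  have "{m<..n} = insert (Suc m) {Suc m<..n}" using Suc.prems by auto
  hence R2: "R n m = (1 - q ^ Suc m) * R n (Suc m)" by (simp add: R_def)
  have IH: "(\<Sum>s\<le>m. (-1) ^ s * R (Suc n) s * q ^ (s * Suc n + triangular s)) =
         (\<Sum>s\<le>m. (-1) ^ s * R n s * q ^ (s * n + triangular s)) - (-1) ^ m * R n m * q ^ (Suc m * Suc n + triangular m)"
    using Suc by simp
  show ?case unfolding sum.atMost_Suc IH R1 R2
    by (simp add: triangular_Suc power_add algebra_simps)
qed

lemma pentagonal_partial:
  fixes q :: "'a :: comm_ring_1"
  shows "(\<Sum>s\<le>n. (-1) ^ s * (\<Prod>k\<in>{s<..n}. 1 - q ^ k) * q ^ (s * n + triangular s)) =
     1 + (\<Sum>k=1..n. (-1) ^ k * (q ^ (k * k + triangular (k - 1)) + q ^ (k * k + triangular k)))"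
proof (induction n)
  case (Suc n)
  show ?case
    unfolding sum.atMost_Suc shanks_partial_sum[OF order_refl] Suc
    by (simp add: algebra_simps)
qed simp

lemma convergent_prod_one_minus_powers:
  fixes q :: complex
  assumes q: "norm q < 1"
  shows "convergent_prod (\<lambda>n. 1 - q ^ Suc n)"
proof (rule abs_convergent_prod_imp_convergent_prod)
  have "summable (\<lambda>n. norm q ^ Suc n)" using q by (subst summable_Suc_iff) (auto intro: summable_geometric)
  thus "abs_convergent_prod (\<lambda>n. 1 - q ^ Suc n)"
    by (simp add: abs_convergent_prod_conv_summable norm_mult norm_power)
qed

text \<open>
  In Shanks' sum the term \<open>s = 0\<close> is the partial product, and the terms with \<open>s \<ge> 1\<close> carry a
  factor \<open>q\<^sup>n\<close>, so their sum tends to \<open>0\<close>.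
\<close>

theorem pentagonal_number_limit:
  fixes q :: complex
  assumes q: "norm q < 1"
  shows "(\<lambda>n. 1 + (\<Sum>k=1..n. (-1) ^ k * (q ^ (k * k + triangular (k - 1)) + q ^ (k * k + triangular k)))) \<longlonglongrightarrow>
           (\<Prod>n. 1 - q ^ Suc n)"
proof -
  define r where "r = norm q"
  have r: "0 \<le> r" "r < 1" using q by (auto simp: r_def)
  have "(\<lambda>n. \<Prod>i\<le>n. 1 - q ^ Suc i) \<longlonglongrightarrow> (\<Prod>n. 1 - q ^ Suc n)"
    by (rule convergent_prod_LIMSEQ[OF convergent_prod_one_minus_powers[OF q]])
  moreover have "(\<Prod>i\<le>n. 1 - q ^ Suc i) = (\<Prod>k\<in>{0<..Suc n}. 1 - q ^ k)" for n
  proof -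
    have "{0<..Suc n} = Suc ` {..n}" by (auto simp: image_iff) (metis Suc_le_D Suc_le_mono atMost_iff less_eq_Suc_le)
    thus ?thesis by (simp add: prod.reindex)
  qed
  ultimately have P: "(\<lambda>n. \<Prod>k\<in>{0<..n}. 1 - q ^ k) \<longlonglongrightarrow> (\<Prod>n. 1 - q ^ Suc n)"
    using filterlim_sequentially_Suc[of "\<lambda>n. \<Prod>k\<in>{0<..n}. 1 - q ^ k"] by simp
  define C where "C = exp (1 / (1 - r))"
  have R: "norm (\<Prod>k\<in>{s<..n}. 1 - q ^ k) \<le> C" for s n
  proof -
    have "norm (\<Prod>k\<in>{s<..n}. 1 - q ^ k) = (\<Prod>k\<in>{s<..n}. norm (1 - q ^ k))" by (rule prod_norm[symmetric])
    also have "\<dots> \<le> (\<Prod>k\<in>{s<..n}. exp (r ^ k))"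
    proof (intro prod_mono conjI)
      fix k
      have "norm (1 - q ^ k) \<le> 1 + r ^ k" using norm_triangle_ineq4[of 1 "q ^ k"] by (simp add: r_def norm_power)
      also have "\<dots> \<le> exp (r ^ k)" by (rule exp_ge_add_one_self)
      finally show "norm (1 - q ^ k) \<le> exp (r ^ k)" .
    qed auto
    also have "\<dots> = exp (\<Sum>k\<in>{s<..n}. r ^ k)" by (simp add: exp_sum)
    also have "(\<Sum>k\<in>{s<..n}. r ^ k) \<le> (\<Sum>k. r ^ k)"
      using r by (intro sum_le_suminf summable_geometric) auto
    also have "\<dots> = 1 / (1 - r)" using r by (simp add: suminf_geometric)
    finally show ?thesis by (simp add: C_def)
  qed
  define E where "E = (\<lambda>n. \<Sum>s=1..n. (-1) ^ s * (\<Prod>k\<in>{s<..n}. 1 - q ^ k) * q ^ (s * n + triangular s))"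
  have "E \<longlonglongrightarrow> 0"
  proof (rule Lim_null_comparison)
    show "\<forall>\<^sub>F n in sequentially. norm (E n) \<le> C * (real n * r ^ n)"
    proof (intro always_eventually allI)
      fix n
      have "norm (E n) \<le> (\<Sum>s=1..n. norm ((-1) ^ s * (\<Prod>k\<in>{s<..n}. 1 - q ^ k) * q ^ (s * n + triangular s)))"
        unfolding E_def by (rule norm_sum)
      also have "\<dots> \<le> (\<Sum>s=1..n. C * r ^ n)"
      proof (rule sum_mono)
        fix s assume "s \<in> {1..n}"
        hence "n \<le> s * n + triangular s" by (cases s) auto
        hence "r ^ (s * n + triangular s) \<le> r ^ n" using r by (intro power_decreasing) auto
        hence "norm (\<Prod>k\<in>{s<..n}. 1 - q ^ k) * r ^ (s * n + triangular s) \<le> C * r ^ n"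
          using R r by (intro mult_mono) (auto simp: C_def)
        thus "norm ((-1) ^ s * (\<Prod>k\<in>{s<..n}. 1 - q ^ k) * q ^ (s * n + triangular s)) \<le> C * r ^ n"
          by (simp add: norm_mult norm_power r_def)
      qed
      also have "\<dots> = C * (real n * r ^ n)" by simp
      finally show "norm (E n) \<le> C * (real n * r ^ n)" .
    qed
    have "(\<lambda>n. real n * r ^ n) \<longlonglongrightarrow> 0"
      using powser_times_n_limit_0[of r] r by simp
    thus "(\<lambda>n. C * (real n * r ^ n)) \<longlonglongrightarrow> 0" by (rule tendsto_mult_right_zero)
  qed
  from tendsto_add[OF P this]
  have "(\<lambda>n. (\<Prod>k\<in>{0<..n}. 1 - q ^ k) + E n) \<longlonglongrightarrow> (\<Prod>n. 1 - q ^ Suc n)" by simp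
  moreover have "(\<Prod>k\<in>{0<..n}. 1 - q ^ k) + E n =
     1 + (\<Sum>k=1..n. (-1) ^ k * (q ^ (k * k + triangular (k - 1)) + q ^ (k * k + triangular k)))" for n
  proof -
    have "{..n} = insert 0 {1..n}" by auto
    thus ?thesis unfolding pentagonal_partial[symmetric] E_def by simp
  qed
  ultimately show ?thesis by simp
qed


text \<open>The even primitive Dirichlet character modulo \<open>12\<close>.\<close>

definition chi12 :: "int \<Rightarrow> complex" where
  "chi12 l = (if l mod 12 \<in> {1, 11} then 1 else if l mod 12 \<in> {5, 7} then - 1 else 0)"

lemma chi12_eq:
  "chi12 (6 * s + 1) = (if even s then 1 else - 1)" "chi12 (6 * s - 1) = (if even s then 1 else - 1)"
proof -
  have "(6 * s + 1) mod 12 = (if even s then 1 else 7)" "(6 * s - 1) mod 12 = (if even s then 11 else 5)"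
    by (cases "even s"; presburger)+
  thus "chi12 (6 * s + 1) = (if even s then 1 else - 1)" "chi12 (6 * s - 1) = (if even s then 1 else - 1)"
    by (auto simp: chi12_def)
qed

lemma exp_growth_chi12: "exp_growth chi12"
  by (rule exp_growth_bounded[of _ 1]) (simp add: chi12_def)

lemma of_nat_triangular: "of_nat (triangular k) = of_nat k * (of_nat k + 1) / (2 :: complex)"
proof -
  have "even (k * (k + 1))" by simp
  hence "2 * triangular k = k * (k + 1)" unfolding triangular_def by simp
  hence "of_nat (2 * triangular k) = (of_nat (k * (k + 1)) :: complex)" by (rule arg_cong)
  thus ?thesis by (simp add: algebra_simps)
qed

text \<open>
  The support of the character consists of the classes \<open>\<plusminus> 1\<close> modulo \<open>6\<close>, which contribute equally;
  this is the factor \<open>2\<close>. For \<open>l = 6 s + 1\<close> the exponent \<open>l\<^sup>2 / 24\<close> is \<open>1 / 24\<close> plus the pentagonal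
  number \<open>s (3 s + 1) / 2\<close>.
\<close>

theorem theta_chi12_eq_eta:
  assumes \<tau>: "Im \<tau> > 0"
  shows "theta 12 chi12 \<tau> 0 = 2 * dedekind_eta \<tau>"
proof -
  define t where "t = theta_term 12 chi12 \<tau> 0"
  define q where "q = exp (2 * pi * \<i> * \<tau>)"
  define c where "c = exp (pi * \<i> * \<tau> / 12)"
  have q: "norm q < 1" using \<tau> by (simp add: q_def norm_exp_eq_Re)
  have q_pow: "q ^ k = exp (of_nat k * (2 * pi * \<i> * \<tau>))" for k by (simp add: q_def exp_of_nat_mult)
  have t_sum: "(t has_sum theta 12 chi12 \<tau> 0) UNIV"
    unfolding t_def by (rule theta_has_sum[OF _ exp_growth_chi12 \<tau>]) simp
  have inj1: "inj (\<lambda>s::int. 6 * s + 1)" and inj2: "inj (\<lambda>s::int. 6 * s - 1)" by (auto simp: inj_on_def)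
  have t_sub: "t summable_on A" for A
    using has_sum_imp_summable[OF t_sum] by (rule summable_on_subset_banach) auto
  have tm: "t (6 * (- s) - 1) = t (6 * s + 1)" for s
  proof -
    have "chi12 (6 * (- s) - 1) = chi12 (6 * s + 1)" unfolding chi12_eq by simp
    moreover have "(of_int (6 * (- s) - 1))\<^sup>2 = (of_int (6 * s + 1) :: complex)\<^sup>2" by (simp add: power2_eq_square algebra_simps)
    ultimately show ?thesis unfolding t_def theta_term_def by simp
  qed
  have "theta 12 chi12 \<tau> 0 = infsum t UNIV" using infsumI[OF t_sum] by simp
  also have "infsum t UNIV = infsum t (range (\<lambda>s. 6 * s + 1) \<union> range (\<lambda>s. 6 * s - 1))"
  proof (rule infsum_cong_neutral)
    fix l :: int assume l: "l \<in> UNIV - (range (\<lambda>s. 6 * s + 1) \<union> range (\<lambda>s. 6 * s - 1))"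
    have "chi12 l = 0"
    proof (rule ccontr)
      assume "chi12 l \<noteq> 0"
      hence "l mod 12 \<in> {1, 11, 5, 7}" by (auto simp: chi12_def split: if_splits)
      hence "l = 6 * (l div 6) + 1 \<or> l = 6 * (l div 6 + 1) - 1" by (elim insertE emptyE; presburger)
      thus False using l by blast
    qed
    thus "t l = 0" by (simp add: t_def theta_term_def)
  qed auto
  also have "\<dots> = infsum t (range (\<lambda>s. 6 * s + 1)) + infsum t (range (\<lambda>s. 6 * s - 1))"
  proof (rule infsum_Un_disjoint[OF t_sub t_sub])
    have "6 * s + 1 \<noteq> 6 * r - (1 :: int)" for s r by presburger
    thus "range (\<lambda>s. 6 * s + 1) \<inter> range (\<lambda>s. 6 * s - (1 :: int)) = {}" by blast
  qed
  also have "infsum t (range (\<lambda>s. 6 * s + 1)) = (\<Sum>\<^sub>\<infinity>s. t (6 * s + 1))"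
    by (subst infsum_reindex[OF inj1]) (simp add: o_def)
  also have "infsum t (range (\<lambda>s. 6 * s - 1)) = (\<Sum>\<^sub>\<infinity>s. t (6 * s - 1))"
    by (subst infsum_reindex[OF inj2]) (simp add: o_def)
  also have "(\<Sum>\<^sub>\<infinity>s. t (6 * s - 1)) = (\<Sum>\<^sub>\<infinity>s. t (6 * (- s) - 1))"
    by (rule infsum_reindex_bij_betw[symmetric, of uminus UNIV UNIV "\<lambda>s. t (6 * s - 1)"])
       (rule bij_betwI[of _ _ _ uminus], auto)
  finally have 2: "theta 12 chi12 \<tau> 0 = 2 * (\<Sum>\<^sub>\<infinity>s. t (6 * s + 1))" by (simp only: tm mult_2)
  have "(\<lambda>s. t (6 * s + 1)) summable_on UNIV"
    using t_sub[of "range (\<lambda>s. 6 * s + 1)"] summable_on_reindex[OF inj1, of t] by (simp add: o_def)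
  hence "((\<lambda>s. t (6 * s + 1)) has_sum (\<Sum>\<^sub>\<infinity>s. t (6 * s + 1))) UNIV" by (rule has_sum_infsum)
  hence lim1: "(\<lambda>M. \<Sum>s\<in>{- int M..int M}. t (6 * s + 1)) \<longlonglongrightarrow> (\<Sum>\<^sub>\<infinity>s. t (6 * s + 1))"
    unfolding has_sum_def by (rule filterlim_compose[OF _ filterlim_int_intervals]) auto
  have pos: "t (6 * int k + 1) = c * ((-1) ^ k * q ^ (k * k + triangular k))" for k
  proof -
    have "pi * \<i> * (of_int (6 * int k + 1))\<^sup>2 * \<tau> / of_nat 12 + 2 * pi * \<i> * of_int (6 * int k + 1) * 0 / of_real (sqrt (real 12)) =
      pi * \<i> * \<tau> / 12 + of_nat (k * k + triangular k) * (2 * pi * \<i> * \<tau>)"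
      by (simp add: of_nat_triangular field_simps power2_eq_square)
    thus ?thesis
      unfolding t_def theta_term_def chi12_eq q_pow c_def by (simp only: exp_add) (simp add: minus_one_power_iff)
  qed
  have neg: "t (6 * (- int k) + 1) = c * ((-1) ^ k * q ^ (k * k + triangular (k - 1)))" if k: "k \<ge> 1" for k
  proof -
    have e: "of_nat (triangular (k - 1)) = (of_nat k - 1) * of_nat k / (2 :: complex)"
      using k by (simp add: of_nat_triangular of_nat_diff)
    have "pi * \<i> * (of_int (6 * (- int k) + 1))\<^sup>2 * \<tau> / of_nat 12 + 2 * pi * \<i> * of_int (6 * (- int k) + 1) * 0 / of_real (sqrt (real 12)) =
      pi * \<i> * \<tau> / 12 + of_nat (k * k + triangular (k - 1)) * (2 * pi * \<i> * \<tau>)"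
      unfolding of_nat_add e by (simp add: field_simps power2_eq_square)
    thus ?thesis
      unfolding t_def theta_term_def chi12_eq q_pow c_def by (simp only: exp_add) (simp add: minus_one_power_iff)
  qed
  have part: "(\<Sum>s\<in>{- int M..int M}. t (6 * s + 1)) =
      c * (1 + (\<Sum>k=1..M. (-1) ^ k * (q ^ (k * k + triangular (k - 1)) + q ^ (k * k + triangular k))))" for M
  proof (induction M)
    case 0
    show ?case using pos[of 0] by simp
  next
    case (Suc M)
    have "{- int (Suc M)..int (Suc M)} = insert (- int (Suc M)) (insert (int (Suc M)) {- int M..int M})" by auto
    hence "(\<Sum>s\<in>{- int (Suc M)..int (Suc M)}. t (6 * s + 1)) =
       t (6 * (- int (Suc M)) + 1) + (t (6 * int (Suc M) + 1) + (\<Sum>s\<in>{- int M..int M}. t (6 * s + 1)))"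
      by (simp del: of_nat_Suc)
    also have "\<dots> = c * (1 + (\<Sum>k=1..Suc M. (-1) ^ k * (q ^ (k * k + triangular (k - 1)) + q ^ (k * k + triangular k))))"
    proof -
      have "1 \<le> Suc M" by simp
      from neg[OF this] show ?thesis
        unfolding pos Suc.IH sum.cl_ivl_Suc by (simp only: \<open>1 \<le> Suc M\<close> if_True distrib_left not_less[symmetric])
          (simp add: algebra_simps)
    qed
    finally show ?case .
  qed
  have "(\<lambda>M. c * (1 + (\<Sum>k=1..M. (-1) ^ k * (q ^ (k * k + triangular (k - 1)) + q ^ (k * k + triangular k))))) \<longlonglongrightarrow>
      c * (\<Prod>n. 1 - q ^ Suc n)"
    by (intro tendsto_mult tendsto_const pentagonal_number_limit q)
  hence "(\<Sum>\<^sub>\<infinity>s. t (6 * s + 1)) = c * (\<Prod>n. 1 - q ^ Suc n)"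
    using lim1 unfolding part by (rule LIMSEQ_unique[rotated])
  also have "\<dots> = dedekind_eta \<tau>"
    unfolding dedekind_eta_def q_pow c_def by (simp only: mult_ac)
  finally show ?thesis unfolding 2 by simp
qed

section \<open>Modular transformations of the eta function\<close>

text \<open>Integers prime to \<open>6\<close> have square \<open>1\<close> modulo \<open>24\<close>.\<close>

lemma chi12_modulus_shift:
  "chi12 l * exp (pi * \<i> * (of_int l)\<^sup>2 / of_nat 12) = exp (pi * \<i> / 12) * chi12 l"
proof (cases "chi12 l = 0")
  case False
  hence "l mod 12 \<in> {1, 11, 5, 7}" by (auto simp: chi12_def split: if_splits)
  hence "24 dvd l\<^sup>2 - 1"
  proof -
    have "l mod 12 = r \<Longrightarrow> 24 dvd r\<^sup>2 - 1 \<Longrightarrow> 24 dvd l\<^sup>2 - 1" for r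
    proof -
      assume r: "l mod 12 = r" "24 dvd r\<^sup>2 - 1"
      define k where "k = l div 12"
      have "l = 12 * k + r" using r by (auto simp: k_def)
      hence "l\<^sup>2 - 1 = 24 * (6 * k\<^sup>2 + k * r) + (r\<^sup>2 - 1)" by (simp add: power2_eq_square algebra_simps)
      thus ?thesis using r(2) by (metis dvd_add dvd_triv_left)
    qed
    thus ?thesis using \<open>l mod 12 \<in> {1, 11, 5, 7}\<close> by (elim insertE emptyE) auto
  qed
  then obtain k where "l\<^sup>2 - 1 = 24 * k" by (elim dvdE)
  hence k: "l\<^sup>2 = 24 * k + 1" by simp
  have "(of_int l :: complex)\<^sup>2 = 24 * of_int k + 1"
    using arg_cong[OF k, of "of_int :: int \<Rightarrow> complex"] by simp
  hence "pi * \<i> * (of_int l)\<^sup>2 / of_nat 12 = 2 * of_int k * pi * \<i> + pi * \<i> / 12"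
    by (simp add: field_simps)
  moreover have "exp (2 * of_int k * pi * \<i>) = (1 :: complex)" by (rule exp_integer_2pi) simp
  ultimately show ?thesis by (simp only: exp_add) simp
qed simp

text \<open>The character is its own finite Fourier transform: its Gauss sum is \<open>\<surd>12\<close>.\<close>

lemma chi12_fourier:
  "chi12 m = (\<Sum>r<12. chi12 (int r) * exp (- 2 * pi * \<i> * of_nat r * of_int m / of_nat 12)) / of_real (sqrt (real 12))"
proof -
  define E where "E = (\<lambda>r :: nat. exp (- 2 * pi * \<i> * of_nat r * of_int m / of_nat 12))"
  define \<theta> where "\<theta> = pi * real_of_int m / 6"
  have cis: "E r = cis (- (real r * \<theta>))" for r
    unfolding E_def cis_conv_exp \<theta>_def by (rule arg_cong[of _ _ exp]) simp
  have per: "cis (2 * pi * real_of_int m) = 1" by (rule cis_multiple_2pi) simp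
  have e11: "E 11 = cis \<theta>"
  proof -
    have "\<theta> = 2 * pi * real_of_int m + - (11 * \<theta>)" by (simp add: \<theta>_def)
    hence "cis \<theta> = cis (2 * pi * real_of_int m) * cis (- (11 * \<theta>))" unfolding cis_mult by (rule arg_cong)
    thus ?thesis by (simp add: cis per)
  qed
  have e7: "E 7 = cis (5 * \<theta>)"
  proof -
    have "5 * \<theta> = 2 * pi * real_of_int m + - (7 * \<theta>)" by (simp add: \<theta>_def)
    hence "cis (5 * \<theta>) = cis (2 * pi * real_of_int m) * cis (- (7 * \<theta>))" unfolding cis_mult by (rule arg_cong)
    thus ?thesis by (simp add: cis per)
  qed
  have "(\<Sum>r<12. chi12 (int r) * E r) = E 1 - E 5 - E 7 + E 11"
    by (simp add: eval_nat_numeral lessThan_Suc chi12_def)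
  also have "\<dots> = of_real (2 * cos \<theta> - 2 * cos (5 * \<theta>))"
    unfolding e11 e7 by (simp add: cis complex_eq_iff)
  also have "cos (5 * \<theta>) = (if even m then cos \<theta> else - cos \<theta>)"
  proof -
    have e1: "5 * \<theta> = pi * real_of_int m - \<theta>" by (simp add: \<theta>_def)
    have "sin (pi * real_of_int m) = 0" using sin_npi_int by simp
    moreover have "cos (pi * real_of_int m) = (if even m then 1 else - 1)" using cos_npi_int by simp
    ultimately show ?thesis unfolding e1 cos_diff by simp
  qed
  also have "complex_of_real (2 * cos \<theta> - 2 * (if even m then cos \<theta> else - cos \<theta>)) =
     of_real (sqrt 12) * chi12 m"
  proof -
    define k j where "k = m div 12" and "j = m mod 12"
    have m: "m = 12 * k + j" by (simp add: k_def j_def)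
    have "\<theta> = pi * real_of_int j / 6 + 2 * pi * real_of_int k" by (simp add: \<theta>_def m field_simps)
    hence ct: "cos \<theta> = cos (pi * real_of_int j / 6)"
      using cos_int_2pin[of k] sin_int_2pin[of k] by (simp add: cos_add)
    have s12: "sqrt 12 = 2 * sqrt 3" using real_sqrt_mult[of 4 3] by simp
    have "j \<in> {0..<12}" by (simp add: j_def)
    hence "j \<in> {0,1,2,3,4,5,6,7,8,9,10,11}" by (auto; presburger)
    moreover have ev: "even m \<longleftrightarrow> even j" by (simp add: m)
    moreover have chi: "chi12 m = (if j \<in> {1, 11} then 1 else if j \<in> {5, 7} then - 1 else 0)"
      by (simp add: chi12_def j_def)
    moreover have "cos (pi * 1 / 6) = sqrt 3 / 2" by (simp add: cos_30)
    moreover have "cos (pi * 3 / 6) = 0" using cos_pi_half by simp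
    moreover have "cos (pi * 5 / 6) = - (sqrt 3 / 2)"
    proof -
      have "pi * 5 / 6 = pi - pi / 6" by simp
      thus ?thesis by (simp only: cos_diff) (simp add: cos_30)
    qed
    moreover have "cos (pi * 7 / 6) = - (sqrt 3 / 2)"
    proof -
      have "pi * 7 / 6 = pi + pi / 6" by simp
      thus ?thesis by (simp only: cos_add) (simp add: cos_30)
    qed
    moreover have "cos (pi * 9 / 6) = 0"
    proof -
      have "pi * 9 / 6 = pi + pi / 2" by simp
      thus ?thesis by (simp only: cos_add) simp
    qed
    moreover have "cos (pi * 11 / 6) = sqrt 3 / 2"
    proof -
      have "pi * 11 / 6 = 2 * pi - pi / 6" by simp
      thus ?thesis by (simp only: cos_diff) (simp add: cos_30)
    qed
    ultimately show ?thesis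
      unfolding ct s12 by (elim insertE emptyE) (simp_all del: of_real_mult of_real_divide)
  qed
  finally show ?thesis by (simp add: E_def)
qed

lemma chi12_mod: "chi12 l = chi12 (l mod int 12)"
  by (simp add: chi12_def)

lemma eta_inversion:
  assumes \<tau>: "Im \<tau> > 0"
  shows "dedekind_eta (- 1 / \<tau>) = csqrt (- \<i> * \<tau>) * dedekind_eta \<tau>"
proof -
  note inv = Im_inversion_pos[OF \<tau>]
  show ?thesis
    using theta_inversion[of 12 \<tau> chi12 chi12 0, OF _ \<tau> chi12_mod chi12_fourier]
    unfolding div_0 theta_chi12_eq_eta[OF inv] theta_chi12_eq_eta[OF \<tau>] by simp
qed

lemma eta_shift:
  assumes \<tau>: "Im \<tau> > 0"
  shows "dedekind_eta (\<tau> + 1) = exp (pi * \<i> / 12) * dedekind_eta \<tau>"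
proof -
  have \<tau>1: "Im (\<tau> + 1) > 0" using \<tau> by simp
  have "theta 12 chi12 (\<tau> + 1) 0 = exp (pi * \<i> / 12) * theta 12 chi12 \<tau> 0"
    unfolding theta_modulus_shift chi12_modulus_shift by (rule theta_cmult)
  thus ?thesis unfolding theta_chi12_eq_eta[OF \<tau>1] theta_chi12_eq_eta[OF \<tau>] by simp
qed

lemma eta_nonzero:
  assumes \<tau>: "Im \<tau> > 0"
  shows "dedekind_eta \<tau> \<noteq> 0"
proof -
  define q where "q = exp (2 * pi * \<i> * \<tau>)"
  have q: "norm q < 1" using \<tau> by (simp add: q_def norm_exp_eq_Re)
  have q_pow: "exp (2 * pi * \<i> * of_nat (Suc n) * \<tau>) = q ^ Suc n" for n
    unfolding q_def exp_of_nat_mult[symmetric] by (simp only: mult_ac)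
  note convergent_prod_one_minus_powers[OF q]
  moreover have "1 - q ^ Suc n \<noteq> 0" for n
  proof
    assume "1 - q ^ Suc n = 0"
    hence "norm (q ^ Suc n) = 1" by (metis eq_iff_diff_eq_0 norm_one)
    moreover have "norm q ^ Suc n < 1" using power_Suc_less_one[of "norm q" n] q by (cases "q = 0") auto
    ultimately show False by (simp only: norm_power)
  qed
  ultimately have "(\<Prod>n. 1 - q ^ Suc n) \<noteq> 0" by (rule prodinf_nonzero)
  thus ?thesis unfolding dedekind_eta_def q_pow by simp
qed

lemma eta_continuous_on: "continuous_on {\<tau>. Im \<tau> > 0} dedekind_eta"
proof -
  have "(\<lambda>\<tau>. theta 12 chi12 \<tau> 0 / 2) holomorphic_on {\<tau>. Im \<tau> > 0}"
    by (intro holomorphic_intros holomorphic_theta_comp exp_growth_chi12 open_halfspace_Im_gt) auto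
  hence "continuous_on {\<tau>. Im \<tau> > 0} (\<lambda>\<tau>. theta 12 chi12 \<tau> 0 / 2)"
    by (rule holomorphic_on_imp_continuous_on)
  thus ?thesis
    by (rule continuous_on_eq) (simp add: theta_chi12_eq_eta)
qed


section \<open>The modular group\<close>

text \<open>
  Induction along left multiplication by the generators \<open>T\<close>, its inverse, and \<open>S\<close>. The Euclidean
  algorithm on the first column reduces the absolute value of \<open>c\<close>.
\<close>

lemma sl2z_induct [consumes 1, case_names one shift unshift inversion]:
  fixes P :: "int \<Rightarrow> int \<Rightarrow> int \<Rightarrow> int \<Rightarrow> bool"
  assumes det: "a * e - b * c = 1"
    and one: "P 1 0 0 1"
    and shift: "\<And>a b c e. a * e - b * c = 1 \<Longrightarrow> P a b c e \<Longrightarrow> P (a + c) (b + e) c e"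
    and unshift: "\<And>a b c e. a * e - b * c = 1 \<Longrightarrow> P a b c e \<Longrightarrow> P (a - c) (b - e) c e"
    and inversion: "\<And>a b c e. a * e - b * c = 1 \<Longrightarrow> P a b c e \<Longrightarrow> P (- c) (- e) a b"
  shows "P a b c e"
proof -
  have shifts: "P (a + k * c) (b + k * e) c e" if "a * e - b * c = 1" "P a b c e" for a b c e k
  proof (induction k rule: int_induct[of _ 0])
    case base thus ?case using that by simp
  next
    case (step1 i)
    have "(a + i * c) * e - (b + i * e) * c = 1" using that(1) by (simp add: algebra_simps)
    from shift[OF this step1(2)] show ?case by (simp add: algebra_simps)
  next
    case (step2 i)
    have "(a + i * c) * e - (b + i * e) * c = 1" using that(1) by (simp add: algebra_simps)
    from unshift[OF this step2(2)] show ?case by (simp add: algebra_simps)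
  qed
  from det show ?thesis
  proof (induction "nat \<bar>c\<bar>" arbitrary: a b c e rule: less_induct)
    case less
    show ?case
    proof (cases "c = 0")
      case True
      hence "a * e = 1" using less.prems by simp
      hence "a = 1 \<and> e = 1 \<or> a = - 1 \<and> e = - 1" using zmult_eq_1_iff by auto
      thus ?thesis
      proof
        assume "a = 1 \<and> e = 1"
        thus ?thesis using shifts[OF _ one, of b] True by simp
      next
        assume ae: "a = - 1 \<and> e = - 1"
        have "P 0 (- 1) 1 0" using inversion[OF _ one] by simp
        hence "P (- 1) 0 0 (- 1)" using inversion[of 0 0 "- 1" 1] by simp
        from shifts[OF _ this, of "- b"] show ?thesis using ae True by simp
      qed
    next
      case False
      define k where "k = a div c"
      define a' b' where "a' = a - k * c" and "b' = b - k * e"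
      have a': "a' = a mod c" by (simp add: a'_def k_def minus_div_mult_eq_mod)
      have lt: "nat \<bar>a'\<bar> < nat \<bar>c\<bar>"
        using abs_mod_less[OF False, of a] by (simp add: a')
      have det': "a' * e - b' * c = 1" using less.prems by (simp add: a'_def b'_def algebra_simps)
      have "P (- c) (- e) a' b'" by (rule less.hyps[OF lt]) (use det' in \<open>simp add: algebra_simps\<close>)
      \<comment> \<open>\<open>S\<close> has order \<open>4\<close>, so three more steps undo the one above.\<close>
      hence "P (- a') (- b') (- c) (- e)"
        by (rule inversion[rotated]) (use det' in \<open>simp add: algebra_simps\<close>)
      hence "P (- (- c)) (- (- e)) (- a') (- b')"
        by (rule inversion[rotated]) (use det' in \<open>simp add: algebra_simps\<close>)
      hence "P (- (- a')) (- (- b')) (- (- c)) (- (- e))"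
        by (rule inversion[rotated]) (use det' in \<open>simp add: algebra_simps\<close>)
      hence "P a' b' c e" by simp
      from shifts[OF det' this, of k] show ?thesis by (simp add: a'_def b'_def)
    qed
  qed
qed

lemma automorphy_factor_nonzero:
  fixes a b c e :: int
  assumes det: "a * e - b * c = 1" and \<tau>: "Im \<tau> > 0"
  shows "of_int c * \<tau> + of_int e \<noteq> 0"
proof
  assume z: "of_int c * \<tau> + of_int e = 0"
  hence "Im (of_int c * \<tau> + of_int e) = 0" "Re (of_int c * \<tau> + of_int e) = 0" by simp_all
  hence "c = 0" using \<tau> by simp
  hence "e = 0" using z by simp
  thus False using det \<open>c = 0\<close> by simp
qed

lemma Im_moebius_act:
  assumes det: "a * e - b * c = 1" and \<tau>: "Im \<tau> > 0"
  shows "Im (moebius_act a b c e \<tau>) > 0"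
proof -
  define j where "j = of_int c * \<tau> + of_int e"
  have j: "j \<noteq> 0" unfolding j_def by (rule automorphy_factor_nonzero[OF assms])
  have "moebius_act a b c e \<tau> = (of_int a * \<tau> + of_int b) * cnj j / of_real ((cmod j)\<^sup>2)"
    unfolding moebius_act_def j_def[symmetric] using j complex_norm_square[of j] by (simp add: field_simps)
  moreover have "Im ((of_int a * \<tau> + of_int b) * cnj j) = of_int (a * e - b * c) * Im \<tau>"
    by (simp add: j_def algebra_simps)
  ultimately have "Im (moebius_act a b c e \<tau>) = Im \<tau> / (cmod j)\<^sup>2"
    unfolding det by (simp flip: of_real_power)
  thus ?thesis using \<tau> j by simp
qed

text \<open>
  A transformation law of integral weight \<open>w\<close>, trivial character and index given by the constant
  \<open>\<mu>\<close> extends from the generators to the group, since the factors satisfy the cocycle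
  relation. The value \<open>\<mu> = 0\<close> covers modular forms in one variable.
\<close>

lemma automorphy_induct:
  fixes F :: "complex \<Rightarrow> complex ^ 'n \<Rightarrow> complex" and w :: int and \<mu> :: complex
  assumes T: "\<And>\<tau> z. Im \<tau> > 0 \<Longrightarrow> F (\<tau> + 1) z = F \<tau> z"
    and S: "\<And>\<tau> z. Im \<tau> > 0 \<Longrightarrow>
       F (- 1 / \<tau>) (inverse \<tau> *s z) = \<tau> powi w * exp (\<mu> * (cform z z / \<tau>)) * F \<tau> z"
    and det: "a * e - b * c = 1" and \<tau>: "Im \<tau> > 0"
  shows "F (moebius_act a b c e \<tau>) (inverse (of_int c * \<tau> + of_int e) *s z) =
           (of_int c * \<tau> + of_int e) powi w *
           exp (\<mu> * (of_int c * cform z z / (of_int c * \<tau> + of_int e))) * F \<tau> z"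
proof -
  let ?j = "\<lambda>c e \<tau>. of_int c * \<tau> + of_int e :: complex"
  have "\<forall>\<tau> z. Im \<tau> > 0 \<longrightarrow> F (moebius_act a b c e \<tau>) (inverse (?j c e \<tau>) *s z) =
           ?j c e \<tau> powi w * exp (\<mu> * (of_int c * cform z z / ?j c e \<tau>)) * F \<tau> z"
    using det
  proof (induction rule: sl2z_induct)
    case one
    show ?case by (simp add: moebius_act_def)
  next
    case (shift a b c e)
    show ?case
    proof (intro allI impI)
      fix \<tau> :: complex and z :: "complex ^ 'n" assume \<tau>: "Im \<tau> > 0"
      have "moebius_act (a + c) (b + e) c e \<tau> = moebius_act a b c e \<tau> + 1"
        using automorphy_factor_nonzero[OF shift(1) \<tau>] by (simp add: moebius_act_def field_simps)
      thus "F (moebius_act (a + c) (b + e) c e \<tau>) (inverse (?j c e \<tau>) *s z) =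
           ?j c e \<tau> powi w * exp (\<mu> * (of_int c * cform z z / ?j c e \<tau>)) * F \<tau> z"
        using shift(2) \<tau> T[OF Im_moebius_act[OF shift(1) \<tau>]] by simp
    qed
  next
    case (unshift a b c e)
    show ?case
    proof (intro allI impI)
      fix \<tau> :: complex and z :: "complex ^ 'n" assume \<tau>: "Im \<tau> > 0"
      have M: "moebius_act a b c e \<tau> = moebius_act (a - c) (b - e) c e \<tau> + 1"
        using automorphy_factor_nonzero[OF unshift(1) \<tau>] by (simp add: moebius_act_def field_simps)
      have det': "(a - c) * e - (b - e) * c = 1" using unshift(1) by (simp add: algebra_simps)
      have "F (moebius_act (a - c) (b - e) c e \<tau>) (inverse (?j c e \<tau>) *s z) =
          F (moebius_act a b c e \<tau>) (inverse (?j c e \<tau>) *s z)"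
        unfolding M by (rule T[OF Im_moebius_act[OF det' \<tau>], symmetric])
      thus "F (moebius_act (a - c) (b - e) c e \<tau>) (inverse (?j c e \<tau>) *s z) =
           ?j c e \<tau> powi w * exp (\<mu> * (of_int c * cform z z / ?j c e \<tau>)) * F \<tau> z"
        using unshift(2) \<tau> by simp
    qed
  next
    case (inversion a b c e)
    show ?case
    proof (intro allI impI)
      fix \<tau> :: complex and z :: "complex ^ 'n" assume \<tau>: "Im \<tau> > 0"
      define j j' \<sigma> where "j = ?j c e \<tau>" and "j' = ?j a b \<tau>" and "\<sigma> = moebius_act a b c e \<tau>"
      have j: "j \<noteq> 0" unfolding j_def by (rule automorphy_factor_nonzero[OF inversion(1) \<tau>])
      have "(- c) * b - (- e) * a = 1" using inversion(1) by (simp add: algebra_simps)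
      hence j': "j' \<noteq> 0" unfolding j'_def by (rule automorphy_factor_nonzero[OF _ \<tau>])
      have \<sigma>: "\<sigma> = j' / j" by (simp add: \<sigma>_def moebius_act_def j_def j'_def)
      have Im\<sigma>: "Im \<sigma> > 0" unfolding \<sigma>_def by (rule Im_moebius_act[OF inversion(1) \<tau>])
      have "moebius_act (- c) (- e) a b \<tau> = - 1 / \<sigma>"
        unfolding \<sigma> using j j' by (simp add: moebius_act_def j_def j'_def field_simps)
      moreover have "inverse j' *s z = inverse \<sigma> *s (inverse j *s z)"
        using j j' by (simp add: \<sigma> vector_smult_assoc field_simps)
      ultimately have "F (moebius_act (- c) (- e) a b \<tau>) (inverse j' *s z) =
          \<sigma> powi w * exp (\<mu> * (cform (inverse j *s z) (inverse j *s z) / \<sigma>)) * F \<sigma> (inverse j *s z)"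
        using S[OF Im\<sigma>, of "inverse j *s z"] by (simp only:)
      also have "F \<sigma> (inverse j *s z) = j powi w * exp (\<mu> * (of_int c * cform z z / j)) * F \<tau> z"
        using inversion(2) \<tau> by (simp add: \<sigma>_def j_def)
      also have "cform (inverse j *s z) (inverse j *s z) = cform z z / j\<^sup>2"
        by (simp add: cform_def sum_divide_distrib field_simps power2_eq_square)
      also have "\<sigma> powi w * exp (\<mu> * (cform z z / j\<^sup>2 / \<sigma>)) * (j powi w * exp (\<mu> * (of_int c * cform z z / j)) * F \<tau> z) =
          (\<sigma> * j) powi w * exp (\<mu> * (cform z z / j\<^sup>2 / \<sigma>) + \<mu> * (of_int c * cform z z / j)) * F \<tau> z"
        by (simp only: exp_add power_int_mult_distrib mult_ac)
      also have "\<sigma> * j = j'" using j by (simp add: \<sigma>)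
      also have "\<mu> * (cform z z / j\<^sup>2 / \<sigma>) + \<mu> * (of_int c * cform z z / j) = \<mu> * (of_int a * cform z z / j')"
      proof -
        have "of_int a * j - of_int c * j' = of_int (a * e - b * c)"
          by (simp add: j_def j'_def algebra_simps)
        hence aj: "1 + of_int c * j' = of_int a * j" unfolding inversion(1) by (simp add: algebra_simps)
        have "cform z z / j\<^sup>2 / \<sigma> + of_int c * cform z z / j = cform z z * (1 + of_int c * j') / (j * j')"
          unfolding \<sigma> using j j' by (simp add: field_simps power2_eq_square)
        also have "\<dots> = of_int a * cform z z / j'"
          unfolding aj using j by simp
        finally have "cform z z / j\<^sup>2 / \<sigma> + of_int c * cform z z / j = of_int a * cform z z / j'" .
        thus ?thesis by (simp only: distrib_left[symmetric])
      qed
      finally show "F (moebius_act (- c) (- e) a b \<tau>) (inverse (?j a b \<tau>) *s z) =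
           ?j a b \<tau> powi w * exp (\<mu> * (of_int a * cform z z / ?j a b \<tau>)) * F \<tau> z"
        unfolding j'_def .
    qed
  qed
  thus ?thesis using \<tau> by blast
qed


lemma csqrt_automorphy_factor_continuous:
  assumes det: "a * e - b * c = 1"
  shows "continuous_on {\<tau>. Im \<tau> > 0} (\<lambda>\<tau>. csqrt (of_int c * \<tau> + of_int e))"
proof (cases "c = 0")
  case False
  have "of_int c * \<tau> + of_int e \<notin> \<real>\<^sub>\<le>\<^sub>0" if "Im \<tau> > 0" for \<tau>
    using that False by (auto simp: complex_nonpos_Reals_iff)
  thus ?thesis
    by (intro continuous_on_compose2[OF continuous_on_csqrt] continuous_intros) auto
qed simp

lemma eta_power_24_moebius:
  assumes det: "a * e - b * c = 1" and \<tau>: "Im \<tau> > 0"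
  shows "dedekind_eta (moebius_act a b c e \<tau>) ^ 24 = (of_int c * \<tau> + of_int e) ^ 12 * dedekind_eta \<tau> ^ 24"
proof -
  have "(\<lambda>\<tau> (z :: complex ^ 1). dedekind_eta \<tau> ^ 24) (moebius_act a b c e \<tau>) (inverse (of_int c * \<tau> + of_int e) *s 0) =
      (of_int c * \<tau> + of_int e) powi 12 * exp (0 * (of_int c * cform (0 :: complex ^ 1) 0 / (of_int c * \<tau> + of_int e))) *
      (\<lambda>\<tau> (z :: complex ^ 1). dedekind_eta \<tau> ^ 24) \<tau> 0"
  proof (rule automorphy_induct[OF _ _ det \<tau>])
    fix \<tau> :: complex and z :: "complex ^ 1" assume \<tau>: "Im \<tau> > 0"
    have "exp (pi * \<i> / 12) ^ 24 = exp (of_nat 24 * (pi * \<i> / 12))"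
      by (simp only: exp_of_nat_mult)
    also have "of_nat 24 * (pi * \<i> / 12) = (2 * of_int 1 * pi) * \<i>" by simp
    also have "exp \<dots> = 1" by (rule exp_integer_2pi) simp
    finally have "exp (pi * \<i> / 12) ^ 24 = 1" .
    thus "dedekind_eta (\<tau> + 1) ^ 24 = dedekind_eta \<tau> ^ 24"
      by (simp add: eta_shift[OF \<tau>] power_mult_distrib)
    have "csqrt (- \<i> * \<tau>) ^ 24 = ((csqrt (- \<i> * \<tau>))\<^sup>2) ^ 12" by (simp only: power_mult[symmetric]) simp
    also have "\<dots> = (- \<i> * \<tau>) ^ 12" by (simp only: power2_csqrt)
    also have "\<dots> = ((- \<i>)\<^sup>2)\<^sup>2 ^ 3 * \<tau> ^ 12" by (simp only: power_mult_distrib power_mult[symmetric]) simp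
    also have "\<dots> = \<tau> powi 12" by simp
    finally show "dedekind_eta (- 1 / \<tau>) ^ 24 = \<tau> powi 12 * exp (0 * (cform z z / \<tau>)) * dedekind_eta \<tau> ^ 24"
      unfolding eta_inversion[OF \<tau>] power_mult_distrib by simp
  qed
  thus ?thesis by simp
qed

text \<open>
  The 24th power of \<open>\<eta>\<close> is modular of weight \<open>12\<close> without a multiplier. Hence
  \<open>\<eta>(A \<tau>) / ((c \<tau> + e)\<^sup>1\<^sup>/\<^sup>2 \<eta>(\<tau>))\<close> is a continuous function on the upper half-plane with values in the
  24th roots of unity, and therefore constant.
\<close>

theorem v_eta_exists:
  assumes det: "a * e - b * c = 1"
  shows eta_moebius: "\<And>\<tau>. Im \<tau> > 0 \<Longrightarrow> dedekind_eta (moebius_act a b c e \<tau>) =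
          v_eta a b c e * csqrt (of_int c * \<tau> + of_int e) * dedekind_eta \<tau>"
    and v_eta_nonzero: "v_eta a b c e \<noteq> 0"
proof -
  define H where "H = {\<tau>. Im \<tau> > 0}"
  define j where "j = (\<lambda>\<tau>. of_int c * \<tau> + of_int e :: complex)"
  define R where "R = (\<lambda>\<tau>. dedekind_eta (moebius_act a b c e \<tau>) / (csqrt (j \<tau>) * dedekind_eta \<tau>))"
  have j: "j \<tau> \<noteq> 0" if "\<tau> \<in> H" for \<tau>
    unfolding j_def by (rule automorphy_factor_nonzero[OF det]) (use that in \<open>simp add: H_def\<close>)
  have eta: "dedekind_eta \<tau> \<noteq> 0" if "\<tau> \<in> H" for \<tau> using that by (simp add: H_def eta_nonzero)
  have contA: "continuous_on H (moebius_act a b c e)"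
    unfolding moebius_act_def using j by (intro continuous_intros) (auto simp: j_def)
  have "continuous_on H (\<lambda>\<tau>. dedekind_eta (moebius_act a b c e \<tau>))"
    by (rule continuous_on_compose2[OF eta_continuous_on contA]) (auto simp: H_def Im_moebius_act[OF det])
  hence "continuous_on H R"
    unfolding R_def j_def
    by (intro continuous_intros csqrt_automorphy_factor_continuous[OF det, folded H_def] eta_continuous_on[folded H_def])
       (use j eta in \<open>auto simp: j_def\<close>)
  moreover have "R ` H \<subseteq> {z. z ^ 24 = 1}"
  proof clarify
    fix \<tau> assume \<tau>: "\<tau> \<in> H"
    have "csqrt (j \<tau>) ^ 24 = ((csqrt (j \<tau>))\<^sup>2) ^ 12" by (simp only: power_mult[symmetric]) simp
    hence "csqrt (j \<tau>) ^ 24 = j \<tau> ^ 12" by simp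
    thus "R \<tau> ^ 24 = 1"
      using eta_power_24_moebius[OF det, of \<tau>] \<tau> j[OF \<tau>] eta[OF \<tau>]
      by (simp add: R_def power_divide power_mult_distrib H_def j_def)
  qed
  hence "finite (R ` H)" by (rule finite_subset) (rule finite_nth_roots, simp)
  moreover have "connected H" unfolding H_def by (rule convex_connected[OF convex_halfspace_Im_gt])
  ultimately have "R constant_on H" by (intro continuous_finite_range_constant)
  then obtain v where v: "\<And>\<tau>. \<tau> \<in> H \<Longrightarrow> R \<tau> = v" unfolding constant_on_def by blast
  have ex: "dedekind_eta (moebius_act a b c e \<tau>) = v * csqrt (j \<tau>) * dedekind_eta \<tau>" if "\<tau> \<in> H" for \<tau>
    using v[OF that] j[OF that] eta[OF that] by (simp add: R_def field_simps)
  have "\<i> \<in> H" by (simp add: H_def)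
  have "v_eta a b c e = v"
    unfolding v_eta_def
  proof (rule the_equality)
    show "\<forall>\<tau>. Im \<tau> > 0 \<longrightarrow> dedekind_eta (moebius_act a b c e \<tau>) = v * csqrt (of_int c * \<tau> + of_int e) * dedekind_eta \<tau>"
      using ex by (simp add: H_def j_def)
    fix u assume "\<forall>\<tau>. Im \<tau> > 0 \<longrightarrow> dedekind_eta (moebius_act a b c e \<tau>) = u * csqrt (of_int c * \<tau> + of_int e) * dedekind_eta \<tau>"
    hence "u * csqrt (j \<i>) * dedekind_eta \<i> = v * csqrt (j \<i>) * dedekind_eta \<i>"
      using ex[OF \<open>\<i> \<in> H\<close>] by (simp add: j_def)
    thus "u = v" using j[OF \<open>\<i> \<in> H\<close>] eta[OF \<open>\<i> \<in> H\<close>] by simp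
  qed
  thus "dedekind_eta (moebius_act a b c e \<tau>) = v_eta a b c e * csqrt (of_int c * \<tau> + of_int e) * dedekind_eta \<tau>"
    if "Im \<tau> > 0" for \<tau> using ex[of \<tau>] that by (simp add: H_def j_def)
  have "dedekind_eta (moebius_act a b c e \<i>) \<noteq> 0"
    by (rule eta_nonzero[OF Im_moebius_act[OF det]]) simp
  thus "v_eta a b c e \<noteq> 0" using ex[OF \<open>\<i> \<in> H\<close>] \<open>v_eta a b c e = v\<close> by auto
qed

section \<open>The Jacobi theta functions and the quintuple product function\<close>

text \<open>
  The kinds of theta functions that are used: the four Jacobi theta functions and the function
  of the quintuple product identity. A kind stands for its level \<open>N\<close> and its coefficients.
\<close>

datatype thkind = Th1 | Th2 | Th3 | Th4 | Quint

fun kind_level :: "thkind \<Rightarrow> nat" where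
  "kind_level Quint = 12" | "kind_level _ = 4"

fun kind_coeff :: "thkind \<Rightarrow> int \<Rightarrow> complex" where
  "kind_coeff Th1 l = (if l mod 4 = 1 then 1 else if l mod 4 = 3 then - 1 else 0)"
| "kind_coeff Th2 l = (if odd l then 1 else 0)"
| "kind_coeff Th3 l = (if even l then 1 else 0)"
| "kind_coeff Th4 l = (if l mod 4 = 0 then 1 else if l mod 4 = 2 then - 1 else 0)"
| "kind_coeff Quint l = chi12 l"

text \<open>
  The translation \<open>\<tau> \<mapsto> \<tau> + 1\<close> and the inversion \<open>\<tau> \<mapsto> - 1 / \<tau>\<close> permute the kinds by \<open>Tkind\<close> and
  \<open>Skind\<close>, up to the constants \<open>Tmult\<close> and \<open>Smult\<close>.
\<close>

fun Tkind :: "thkind \<Rightarrow> thkind" where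
  "Tkind Th3 = Th4" | "Tkind Th4 = Th3" | "Tkind \<kappa> = \<kappa>"

fun Skind :: "thkind \<Rightarrow> thkind" where
  "Skind Th2 = Th4" | "Skind Th4 = Th2" | "Skind \<kappa> = \<kappa>"

fun Tmult :: "thkind \<Rightarrow> complex" where
  "Tmult Th3 = 1" | "Tmult Th4 = 1" | "Tmult Quint = exp (pi * \<i> / 12)" | "Tmult _ = exp (pi * \<i> / 4)"

fun Smult :: "thkind \<Rightarrow> complex" where
  "Smult Th1 = - \<i>" | "Smult _ = 1"

text \<open>The theta function of a given kind.\<close>

abbreviation theta_kind :: "thkind \<Rightarrow> complex \<Rightarrow> complex \<Rightarrow> complex" where
  "theta_kind \<kappa> \<equiv> theta (kind_level \<kappa>) (kind_coeff \<kappa>)"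

lemma kind_level_pos [simp]: "kind_level \<kappa> > 0" by (cases \<kappa>) auto
lemma kind_level_even [simp]: "even (kind_level \<kappa>)" by (cases \<kappa>) auto
lemma kind_level_Tkind [simp]: "kind_level (Tkind \<kappa>) = kind_level \<kappa>" by (cases \<kappa>) auto
lemma kind_level_Skind [simp]: "kind_level (Skind \<kappa>) = kind_level \<kappa>" by (cases \<kappa>) auto

lemma exp_growth_kind_coeff: "exp_growth (kind_coeff \<kappa>)"
  by (rule exp_growth_bounded[of _ 1], cases \<kappa>) (auto simp: chi12_def)

lemma kind_coeff_mod: "kind_coeff \<kappa> l = kind_coeff \<kappa> (l mod int (kind_level \<kappa>))"
proof (cases \<kappa>)
  case Quint thus ?thesis using chi12_mod by simp
qed (auto, presburger+)

lemma kind_coeff_periodic: "kind_coeff \<kappa> (l + int (kind_level \<kappa>)) = kind_coeff \<kappa> l"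
  using kind_coeff_mod[of \<kappa> "l + int (kind_level \<kappa>)"] kind_coeff_mod[of \<kappa> l] by simp

lemma kind_coeff_modulus_shift:
  "kind_coeff \<kappa> l * exp (pi * \<i> * (of_int l)\<^sup>2 / of_nat (kind_level \<kappa>)) = Tmult \<kappa> * kind_coeff (Tkind \<kappa>) l"
proof -
  have odd: "exp (pi * \<i> * (of_int l)\<^sup>2 / 4) = exp (pi * \<i> / 4)" if "odd l"
  proof -
    obtain k where l: "l = 2 * k + 1" using \<open>odd l\<close> by (rule oddE)
    have "even (k * (k + 1))" by simp
    then obtain m where m: "k * (k + 1) = 2 * m" by (rule evenE)
    have "l\<^sup>2 = 4 * (k * (k + 1)) + 1" by (simp add: l power2_eq_square algebra_simps)
    hence l2: "l\<^sup>2 = 8 * m + 1" unfolding m by simp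
    have "(of_int l :: complex)\<^sup>2 = 8 * of_int m + 1"
      using arg_cong[OF l2, of "of_int :: int \<Rightarrow> complex"] by simp
    hence "pi * \<i> * (of_int l)\<^sup>2 / 4 = 2 * of_int m * pi * \<i> + pi * \<i> / 4"
      by (simp add: field_simps)
    moreover have "exp (2 * of_int m * pi * \<i>) = (1 :: complex)" by (rule exp_integer_2pi) simp
    ultimately show ?thesis by (simp only: exp_add mult_1_left)
  qed
  have mod4: "exp (pi * \<i> * (of_int l)\<^sup>2 / 4) = (if l mod 4 = 0 then 1 else - 1)" if "even l"
  proof -
    obtain k where l: "l = 2 * k" using \<open>even l\<close> by (rule evenE)
    have e: "pi * \<i> * (of_int l)\<^sup>2 / 4 = \<i> * of_real (pi * real_of_int (k\<^sup>2))"
      by (simp add: l power2_eq_square)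
    have "exp (pi * \<i> * (of_int l)\<^sup>2 / 4) = (if even k then 1 else - 1)"
      unfolding e cis_conv_exp[symmetric] using sin_npi_int[of "k\<^sup>2"] cos_npi_int[of "k\<^sup>2"]
      by (simp add: complex_eq_iff)
    moreover have "even k \<longleftrightarrow> l mod 4 = 0" unfolding l by presburger
    ultimately show ?thesis by simp
  qed
  have m4: "l mod 4 = 1 \<Longrightarrow> odd l" "l mod 4 = 3 \<Longrightarrow> odd l" "l mod 4 = 0 \<Longrightarrow> even l" "l mod 4 = 2 \<Longrightarrow> even l"
    "even l \<Longrightarrow> l mod 4 \<noteq> 0 \<Longrightarrow> l mod 4 = 2"
    by presburger+
  show ?thesis
  proof (cases \<kappa>)
    case Quint thus ?thesis using chi12_modulus_shift[of l] by simp
  qed (use odd mod4 m4 in auto)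
qed

lemma exp_quarter_turn:
  "exp (pi * \<i> * of_int l / 2) = (if l mod 4 = 0 then 1 else if l mod 4 = 1 then \<i> else if l mod 4 = 2 then - 1 else - \<i>)"
proof -
  define k j where "k = l div 4" and "j = l mod 4"
  have l: "l = 4 * k + j" by (simp add: k_def j_def)
  have j: "j \<in> {0, 1, 2, 3}" unfolding j_def by (auto; presburger)
  have "pi * \<i> * of_int l / 2 = 2 * of_int k * pi * \<i> + \<i> * of_real (pi / 2 * real_of_int j)"
    by (simp add: l field_simps)
  moreover have "exp (2 * of_int k * pi * \<i>) = (1 :: complex)" by (rule exp_integer_2pi) simp
  ultimately have "exp (pi * \<i> * of_int l / 2) = cis (pi / 2 * real_of_int j)"
    unfolding cis_conv_exp by (simp only: exp_add mult_1_left)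
  moreover have "cis (pi / 2) = \<i>" "cis pi = - 1" by (simp_all add: complex_eq_iff)
  moreover have "cis (pi / 2 * 3) = - \<i>"
  proof -
    have "cis (pi / 2 * 3) = cis pi * cis (pi / 2)" unfolding cis_mult by (rule arg_cong) simp
    thus ?thesis by (simp add: complex_eq_iff)
  qed
  ultimately show ?thesis
    using j unfolding j_def[symmetric] by (elim insertE emptyE) simp_all
qed

lemma kind_coeff_fourier:
  "Smult \<kappa> * kind_coeff (Skind \<kappa>) m =
     (\<Sum>r<kind_level \<kappa>. kind_coeff \<kappa> (int r) * exp (- 2 * pi * \<i> * of_nat r * of_int m / of_nat (kind_level \<kappa>))) / of_real (sqrt (real (kind_level \<kappa>)))"
proof (cases "\<kappa> = Quint")
  case True thus ?thesis using chi12_fourier[of m] by simp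
next
  case False
  hence kind_level: "kind_level \<kappa> = 4" by (cases \<kappa>) auto
  define \<omega> where "\<omega> = exp (- 2 * pi * \<i> * of_int m / 4)"
  have E: "exp (- 2 * pi * \<i> * of_nat r * of_int m / of_nat 4) = \<omega> ^ r" for r
    unfolding \<omega>_def exp_of_nat_mult[symmetric] by (rule arg_cong[of _ _ exp]) simp
  define k j where "k = m div 4" and "j = m mod 4"
  have m: "m = 4 * k + j" by (simp add: k_def j_def)
  have j: "j \<in> {0, 1, 2, 3}" unfolding j_def by (auto; presburger)
  have neg: "(- m) mod 4 = (if j = 0 then 0 else 4 - j)" unfolding j_def by presburger
  have "\<omega> = exp (pi * \<i> * of_int (- m) / 2)"
    unfolding \<omega>_def by (rule arg_cong[of _ _ exp]) simp
  hence \<omega>: "\<omega> = (if j = 0 then 1 else if j = 1 then - \<i> else if j = 2 then - 1 else \<i>)"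
    using j unfolding exp_quarter_turn neg by (elim insertE emptyE) simp_all
  have par: "even m \<longleftrightarrow> even j" by (simp add: m)
  have "(\<Sum>r<kind_level \<kappa>. kind_coeff \<kappa> (int r) * exp (- 2 * pi * \<i> * of_nat r * of_int m / of_nat (kind_level \<kappa>))) / of_real (sqrt (real (kind_level \<kappa>))) =
     (kind_coeff \<kappa> 0 + kind_coeff \<kappa> 1 * \<omega> + kind_coeff \<kappa> 2 * \<omega>\<^sup>2 + kind_coeff \<kappa> 3 * \<omega> ^ 3) / 2"
    unfolding kind_level E by (simp add: eval_nat_numeral lessThan_Suc)
  also have "\<dots> = Smult \<kappa> * kind_coeff (Skind \<kappa>) m"
    using j False unfolding \<omega>
    by (cases \<kappa>; elim insertE emptyE) (simp_all add: par power3_eq_cube flip: j_def)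
  finally show ?thesis ..
qed

lemma theta_kind_inversion:
  assumes \<tau>: "Im \<tau> > 0"
  shows "theta_kind \<kappa> (- 1 / \<tau>) (z / \<tau>) =
     csqrt (- \<i> * \<tau>) * exp (pi * \<i> * z\<^sup>2 / \<tau>) * (Smult \<kappa> * theta_kind (Skind \<kappa>) \<tau> z)"
proof -
  have "theta_kind \<kappa> (- 1 / \<tau>) (z / \<tau>) =
     csqrt (- \<i> * \<tau>) * exp (pi * \<i> * z\<^sup>2 / \<tau>) * theta (kind_level \<kappa>) (\<lambda>m. Smult \<kappa> * kind_coeff (Skind \<kappa>) m) \<tau> z"
    by (rule theta_inversion[OF kind_level_pos \<tau> kind_coeff_mod kind_coeff_fourier])
  thus ?thesis by (simp only: theta_cmult kind_level_Skind)
qed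

lemma theta_kind_shift:
  "theta_kind \<kappa> (\<tau> + 1) z = Tmult \<kappa> * theta_kind (Tkind \<kappa>) \<tau> z"
  unfolding theta_modulus_shift kind_coeff_modulus_shift by (simp only: theta_cmult kind_level_Tkind)

section \<open>Products of theta functions in several variables\<close>

text \<open>The product of theta functions of kinds \<open>c i\<close>, one for each coordinate \<open>i\<close>.\<close>

definition theta_prod :: "('n::finite \<Rightarrow> thkind) \<Rightarrow> complex \<times> (complex ^ 'n) \<Rightarrow> complex" where
  "theta_prod c p = (\<Prod>i\<in>UNIV. theta_kind (c i) (fst p) (snd p $ i))"

lemma holomorphic_on_H_theta_coord:
  fixes i :: "'n::finite"
  shows "holomorphic_on_H (\<lambda>p. theta_kind \<kappa> (fst p) (snd p $ i))"
  unfolding holomorphic_on_H_def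
proof (intro allI impI)
  fix \<tau> :: complex and z :: "complex ^ 'n" assume \<tau>: "Im \<tau> > 0"
  from theta_has_derivative[OF kind_level_pos exp_growth_kind_coeff \<tau>, of \<kappa> \<kappa> "z $ i"]
  obtain D E where DE: "((\<lambda>(\<tau>, w). theta_kind \<kappa> \<tau> w) has_derivative (\<lambda>(s, t). D * s + E * t)) (at (\<tau>, z $ i))"
    by (elim exE) (rule that)
  have "bounded_linear (\<lambda>p :: complex \<times> (complex ^ 'n). (fst p, snd p $ i))"
    by (intro bounded_linear_Pair bounded_linear_fst bounded_linear_compose[OF bounded_linear_vec_nth bounded_linear_snd])
  hence "((\<lambda>p :: complex \<times> (complex ^ 'n). (fst p, snd p $ i)) has_derivative (\<lambda>p. (fst p, snd p $ i))) (at (\<tau>, z))"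
    by (rule bounded_linear_imp_has_derivative)
  from has_derivative_compose[OF this, of "\<lambda>(\<tau>, w). theta_kind \<kappa> \<tau> w" "\<lambda>(s, t). D * s + E * t"] DE
  have "((\<lambda>p. theta_kind \<kappa> (fst p) (snd p $ i)) has_derivative (\<lambda>p. D * fst p + E * (snd p $ i))) (at (\<tau>, z))"
    by simp
  thus "\<exists>D. ((\<lambda>p. theta_kind \<kappa> (fst p) (snd p $ i)) has_derivative D) (at (\<tau>, z)) \<and>
          (\<forall>s u w. D (s * u, s *s w) = s * D (u, w))"
    by (intro exI conjI) (assumption, simp add: algebra_simps)
qed

lemma holomorphic_on_H_prod:
  fixes f :: "'i \<Rightarrow> complex \<times> (complex ^ 'n::finite) \<Rightarrow> complex"
  assumes "\<And>i. i \<in> I \<Longrightarrow> holomorphic_on_H (f i)"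
  shows "holomorphic_on_H (\<lambda>p. \<Prod>i\<in>I. f i p)"
  unfolding holomorphic_on_H_def
proof (intro allI impI)
  fix \<tau> :: complex and z :: "complex ^ 'n" assume \<tau>: "Im \<tau> > 0"
  have ex: "\<forall>i\<in>I. \<exists>D. (f i has_derivative D) (at (\<tau>, z)) \<and> (\<forall>s u w. D (s * u, s *s w) = s * D (u, w))"
    using assms \<tau> unfolding holomorphic_on_H_def by blast
  from bchoice[OF ex] obtain D where "\<forall>i\<in>I. (f i has_derivative D i) (at (\<tau>, z)) \<and>
      (\<forall>s u w. D i (s * u, s *s w) = s * D i (u, w))" ..
  hence D: "\<And>i. i \<in> I \<Longrightarrow> (f i has_derivative D i) (at (\<tau>, z))"
    "\<And>i s u w. i \<in> I \<Longrightarrow> D i (s * u, s *s w) = s * D i (u, w)" by simp_all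
  have "((\<lambda>p. \<Prod>i\<in>I. f i p) has_derivative (\<lambda>h. \<Sum>i\<in>I. D i h * (\<Prod>j\<in>I - {i}. f j (\<tau>, z)))) (at (\<tau>, z))"
    by (rule has_derivative_prod) (rule D(1))
  thus "\<exists>D. ((\<lambda>p. \<Prod>i\<in>I. f i p) has_derivative D) (at (\<tau>, z)) \<and> (\<forall>s u w. D (s * u, s *s w) = s * D (u, w))"
    by (intro exI conjI) (assumption, simp add: D(2) sum_distrib_left mult.assoc)
qed

lemma holomorphic_on_H_sum:
  fixes f :: "'k \<Rightarrow> complex \<times> (complex ^ 'n::finite) \<Rightarrow> complex"
  assumes "\<And>k. k \<in> K \<Longrightarrow> holomorphic_on_H (f k)"
  shows "holomorphic_on_H (\<lambda>p. \<Sum>k\<in>K. s k * f k p)"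
  unfolding holomorphic_on_H_def
proof (intro allI impI)
  fix \<tau> :: complex and z :: "complex ^ 'n" assume \<tau>: "Im \<tau> > 0"
  have ex: "\<forall>k\<in>K. \<exists>D. (f k has_derivative D) (at (\<tau>, z)) \<and> (\<forall>s u w. D (s * u, s *s w) = s * D (u, w))"
    using assms \<tau> unfolding holomorphic_on_H_def by blast
  from bchoice[OF ex] obtain D where "\<forall>i\<in>K. (f i has_derivative D i) (at (\<tau>, z)) \<and>
      (\<forall>s u w. D i (s * u, s *s w) = s * D i (u, w))" ..
  hence D: "\<And>i. i \<in> K \<Longrightarrow> (f i has_derivative D i) (at (\<tau>, z))"
    "\<And>i s u w. i \<in> K \<Longrightarrow> D i (s * u, s *s w) = s * D i (u, w)" by simp_all
  have "((\<lambda>p. \<Sum>k\<in>K. s k * f k p) has_derivative (\<lambda>h. \<Sum>k\<in>K. s k * D k h)) (at (\<tau>, z))"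
    by (intro has_derivative_sum has_derivative_mult_right D(1))
  thus "\<exists>D. ((\<lambda>p. \<Sum>k\<in>K. s k * f k p) has_derivative D) (at (\<tau>, z)) \<and> (\<forall>s u w. D (s * u, s *s w) = s * D (u, w))"
    by (intro exI conjI) (assumption, simp add: D(2) sum_distrib_left mult.left_commute)
qed

lemma theta_prod_inversion:
  fixes c :: "'n::finite \<Rightarrow> thkind"
  assumes \<tau>: "Im \<tau> > 0"
  shows "theta_prod c (- 1 / \<tau>, inverse \<tau> *s z) =
     csqrt (- \<i> * \<tau>) ^ CARD('n) * exp (pi * \<i> * (cform z z / \<tau>)) *
     ((\<Prod>i\<in>UNIV. Smult (c i)) * theta_prod (Skind \<circ> c) (\<tau>, z))"
proof -
  have "theta_prod c (- 1 / \<tau>, inverse \<tau> *s z) = (\<Prod>i\<in>UNIV. csqrt (- \<i> * \<tau>) * exp (pi * \<i> * (z $ i)\<^sup>2 / \<tau>) *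
     (Smult (c i) * theta_kind (Skind (c i)) \<tau> (z $ i)))"
  proof -
    have "(inverse \<tau> *s z) $ i = z $ i / \<tau>" for i by (simp add: field_simps)
    thus ?thesis unfolding theta_prod_def
      by (intro prod.cong refl) (simp only: fst_conv snd_conv theta_kind_inversion[OF \<tau>])
  qed
  also have "\<dots> = csqrt (- \<i> * \<tau>) ^ CARD('n) * (\<Prod>i\<in>UNIV. exp (pi * \<i> * (z $ i)\<^sup>2 / \<tau>)) *
     ((\<Prod>i\<in>UNIV. Smult (c i)) * theta_prod (Skind \<circ> c) (\<tau>, z))"
    by (simp add: theta_prod_def prod.distrib)
  also have "(\<Prod>i\<in>UNIV. exp (pi * \<i> * (z $ i)\<^sup>2 / \<tau>)) = exp (\<Sum>i\<in>UNIV. pi * \<i> * (z $ i)\<^sup>2 / \<tau>)"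
    by (simp add: exp_sum)
  also have "(\<Sum>i\<in>UNIV. pi * \<i> * (z $ i)\<^sup>2 / \<tau>) = pi * \<i> * (cform z z / \<tau>)"
    by (simp add: cform_def sum_distrib_left sum_divide_distrib power2_eq_square)
  finally show ?thesis .
qed

lemma theta_prod_shift:
  "theta_prod c (\<tau> + 1, z) = (\<Prod>i\<in>UNIV. Tmult (c i)) * theta_prod (Tkind \<circ> c) (\<tau>, z)"
  by (simp add: theta_prod_def theta_kind_shift prod.distrib del: Tmult.simps)

lemma theta_kind_lattice_shift:
  fixes m k :: int
  shows "theta_kind \<kappa> \<tau> (w + \<tau> * of_real (sqrt (kind_level \<kappa>) * m) + of_real (sqrt (kind_level \<kappa>) * k)) =
     exp (- pi * \<i> * (of_real ((sqrt (kind_level \<kappa>) * m)\<^sup>2) * \<tau> + 2 * (of_real (sqrt (kind_level \<kappa>) * m) * w))) *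
     theta_kind \<kappa> \<tau> w"
  by (rule theta_lattice_shift[where a = "kind_coeff \<kappa>", OF kind_level_pos kind_coeff_periodic])

lemma theta_prod_lattice_shift:
  fixes c :: "'n::finite \<Rightarrow> thkind" and x y :: "real ^ 'n"
  assumes x: "\<And>i. x $ i = sqrt (kind_level (c i)) * real_of_int (m i)" and y: "\<And>i. y $ i = sqrt (kind_level (c i)) * real_of_int (k i)"
  shows "theta_prod c (\<tau>, z + \<tau> *s cvec x + cvec y) =
     exp (- pi * \<i> * (of_real (x \<bullet> x) * \<tau> + 2 * cform (cvec x) z)) * theta_prod c (\<tau>, z)"
proof -
  have "theta_prod c (\<tau>, z + \<tau> *s cvec x + cvec y) =
     (\<Prod>i\<in>UNIV. exp (- pi * \<i> * (of_real ((x $ i)\<^sup>2) * \<tau> + 2 * (of_real (x $ i) * z $ i))) *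
         theta_kind (c i) \<tau> (z $ i))"
    unfolding theta_prod_def
    by (intro prod.cong refl)
       (simp only: fst_conv snd_conv vector_add_component vector_smult_component cvec_def vec_lambda_beta x y
          theta_kind_lattice_shift)
  also have "\<dots> = exp (\<Sum>i\<in>UNIV. - pi * \<i> * (of_real ((x $ i)\<^sup>2) * \<tau> + 2 * (of_real (x $ i) * z $ i))) * theta_prod c (\<tau>, z)"
    by (simp add: prod.distrib theta_prod_def exp_sum)
  also have "(\<Sum>i\<in>UNIV. - pi * \<i> * (of_real ((x $ i)\<^sup>2) * \<tau> + 2 * (of_real (x $ i) * z $ i))) =
     - pi * \<i> * (of_real (x \<bullet> x) * \<tau> + 2 * cform (cvec x) z)"
  proof -
    have "of_real (x \<bullet> x) * \<tau> + 2 * cform (cvec x) z =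
        (\<Sum>i\<in>UNIV. of_real ((x $ i)\<^sup>2) * \<tau> + 2 * (of_real (x $ i) * z $ i))"
      by (simp add: inner_vec_def cform_def cvec_def sum_distrib_left sum_distrib_right sum.distrib power2_eq_square)
    thus ?thesis by (simp only: sum_distrib_left[symmetric])
  qed
  finally show ?thesis .
qed

text \<open>
  The exponent \<open>(n, l)\<close> of the Fourier expansion that belongs to the summation indices \<open>g i\<close>.
\<close>

definition theta_index :: "('n \<Rightarrow> nat) \<Rightarrow> ('n \<Rightarrow> int) \<Rightarrow> real \<times> (real ^ 'n::finite)" where
  "theta_index N g = ((\<Sum>i\<in>UNIV. (real_of_int (g i))\<^sup>2 / (2 * real (N i))), (\<chi> i. real_of_int (g i) / sqrt (N i)))"

lemma theta_prod_has_sum: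
  fixes c :: "'n::finite \<Rightarrow> thkind"
  assumes \<tau>: "Im \<tau> > 0"
  shows "((\<lambda>g. (\<Prod>i\<in>UNIV. kind_coeff (c i) (g i)) *
            exp (2 * pi * \<i> * (of_real (fst (theta_index (kind_level \<circ> c) g)) * \<tau> + cform (cvec (snd (theta_index (kind_level \<circ> c) g))) z)))
          has_sum theta_prod c (\<tau>, z)) UNIV"
proof -
  let ?t = "\<lambda>i. theta_term (kind_level (c i)) (kind_coeff (c i)) \<tau> (z $ i)"
  have abs: "(\<lambda>l. norm (?t i l)) summable_on UNIV" for i
    by (rule theta_term_abs_summable[OF kind_level_pos exp_growth_kind_coeff \<tau>])
  have Pi: "(PiE UNIV (\<lambda>_. UNIV) :: ('n \<Rightarrow> int) set) = UNIV" by (auto simp: PiE_UNIV_domain)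
  have "Infinite_Set_Sum.abs_summable_on (\<lambda>g. \<Prod>i\<in>UNIV. ?t i (g i)) (PiE UNIV (\<lambda>_. UNIV))"
    by (rule abs_summable_on_prod_PiE) (use abs in \<open>simp_all add: abs_summable_equivalent[symmetric]\<close>)
  hence sm: "(\<lambda>g. norm (\<Prod>i\<in>UNIV. ?t i (g i))) summable_on UNIV"
    unfolding abs_summable_equivalent[symmetric] Pi .
  have "((\<lambda>g. \<Prod>i\<in>UNIV. ?t i (g i)) has_sum infsum (\<lambda>g. \<Prod>i\<in>UNIV. ?t i (g i)) UNIV) UNIV"
    by (rule has_sum_infsum[OF abs_summable_summable[OF sm]])
  moreover have "infsum (\<lambda>g. \<Prod>i\<in>UNIV. ?t i (g i)) UNIV = theta_prod c (\<tau>, z)"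
    using infsum_prod_PiE_abs[of UNIV ?t "\<lambda>_. UNIV"] abs unfolding Pi by (simp add: theta_prod_def theta_def)
  moreover have "(\<Prod>i\<in>UNIV. ?t i (g i)) = (\<Prod>i\<in>UNIV. kind_coeff (c i) (g i)) *
      exp (2 * pi * \<i> * (of_real (fst (theta_index (kind_level \<circ> c) g)) * \<tau> + cform (cvec (snd (theta_index (kind_level \<circ> c) g))) z))" for g
  proof -
    have "(\<Prod>i\<in>UNIV. ?t i (g i)) = (\<Prod>i\<in>UNIV. kind_coeff (c i) (g i)) *
      exp (\<Sum>i\<in>UNIV. pi * \<i> * (of_int (g i))\<^sup>2 * \<tau> / of_nat (kind_level (c i)) + 2 * pi * \<i> * of_int (g i) * z $ i / of_real (sqrt (kind_level (c i))))"
      by (simp add: theta_term_def prod.distrib exp_sum)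
    also have "(\<Sum>i\<in>UNIV. pi * \<i> * (of_int (g i))\<^sup>2 * \<tau> / of_nat (kind_level (c i)) + 2 * pi * \<i> * of_int (g i) * z $ i / of_real (sqrt (kind_level (c i)))) =
       2 * pi * \<i> * (of_real (fst (theta_index (kind_level \<circ> c) g)) * \<tau> + cform (cvec (snd (theta_index (kind_level \<circ> c) g))) z)"
      unfolding theta_index_def cform_def cvec_def fst_conv snd_conv vec_lambda_beta of_real_sum
        sum_distrib_left sum_distrib_right distrib_left sum.distrib
      by (intro arg_cong2[of _ _ _ _ "(+)"] sum.cong refl) simp_all
    finally show ?thesis .
  qed
  ultimately show ?thesis by (simp only:)
qed

section \<open>Rectangular lattices and their Jacobi forms of singular weight\<close>

text \<open>The orthogonal sum of the lattices \<open>\<surd>(N i) \<int>\<close>.\<close>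

definition rect_lattice :: "('n \<Rightarrow> nat) \<Rightarrow> (real ^ 'n::finite) set" where
  "rect_lattice N = {x. \<forall>i. \<exists>m :: int. x $ i = sqrt (N i) * real_of_int m}"

lemma rect_lattice_rank:
  fixes N :: "'n::finite \<Rightarrow> nat"
  assumes N: "\<And>i. N i > 0"
  shows "is_lattice_of_rank (rect_lattice N) CARD('n)"
proof -
  define v where "v = (\<lambda>i. axis i (sqrt (N i)) :: real ^ 'n)"
  define B where "B = range v"
  have comp: "v i $ j = (if i = j then sqrt (N i) else 0)" for i j
    by (simp add: v_def axis_def)
  have inj: "inj v"
  proof (rule injI)
    fix i j assume "v i = v j"
    hence "v i $ i = v j $ i" by simp
    thus "i = j" using N[of i] by (simp add: comp split: if_splits)
  qed
  have fin: "finite B" by (simp add: B_def)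
  have card: "card B = CARD('n)" unfolding B_def by (rule card_image[OF inj])
  have "independent B"
  proof (rule pairwise_orthogonal_independent)
    show "pairwise orthogonal B"
      unfolding pairwise_def B_def orthogonal_def by (auto simp: v_def inner_axis_axis)
    show "0 \<notin> B"
    proof
      assume "0 \<in> B"
      then obtain i where "v i = 0" unfolding B_def by (metis rangeE)
      hence "v i $ i = 0" by simp
      thus False using N[of i] by (simp add: comp)
    qed
  qed
  moreover have "rect_lattice N = {(\<Sum>b\<in>B. real_of_int (m b) *\<^sub>R b) | m. True}"
  proof -
    have sum: "(\<Sum>b\<in>B. real_of_int (m b) *\<^sub>R b) $ j = sqrt (N j) * real_of_int (m (v j))" for m :: "real ^ 'n \<Rightarrow> int" and j
    proof -
      have "(\<Sum>b\<in>B. real_of_int (m b) *\<^sub>R b) $ j = (\<Sum>i\<in>UNIV. real_of_int (m (v i)) * (v i $ j))"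
        unfolding B_def by (subst sum.reindex[OF inj]) simp
      also have "\<dots> = sqrt (N j) * real_of_int (m (v j))"
        by (simp add: comp if_distrib cong: if_cong)
      finally show ?thesis .
    qed
    show ?thesis
    proof (intro equalityI subsetI)
      fix x assume "x \<in> rect_lattice N"
      then obtain m where m: "\<And>i. x $ i = sqrt (N i) * real_of_int (m i)"
        unfolding rect_lattice_def by (auto simp: choice_iff)
      have "x = (\<Sum>b\<in>B. real_of_int ((m \<circ> the_inv v) b) *\<^sub>R b)"
        unfolding vec_eq_iff sum by (simp add: m the_inv_f_f[OF inj])
      thus "x \<in> {(\<Sum>b\<in>B. real_of_int (m b) *\<^sub>R b) | m. True}" by blast
    next
      fix x assume "x \<in> {(\<Sum>b\<in>B. real_of_int (m b) *\<^sub>R b) | m. True}"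
      then obtain m where "x = (\<Sum>b\<in>B. real_of_int (m b) *\<^sub>R b)" by blast
      hence "x $ j = sqrt (N j) * real_of_int (m (v j))" for j by (simp only: sum)
      thus "x \<in> rect_lattice N" unfolding rect_lattice_def by blast
    qed
  qed
  ultimately show ?thesis unfolding is_lattice_of_rank_def using fin card by blast
qed

lemma rect_lattice_even:
  fixes N :: "'n::finite \<Rightarrow> nat"
  assumes N: "\<And>i. even (N i)"
  shows "even_lattice (rect_lattice N)"
  unfolding even_lattice_def
proof
  fix x assume "x \<in> rect_lattice N"
  then obtain m where m: "\<And>i. x $ i = sqrt (N i) * real_of_int (m i)"
    unfolding rect_lattice_def by (auto simp: choice_iff)
  have "x \<bullet> x = (\<Sum>i\<in>UNIV. real (N i) * (real_of_int (m i))\<^sup>2)"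
    by (simp add: inner_vec_def m power2_eq_square mult_ac)
  also have "\<dots> = (\<Sum>i\<in>UNIV. 2 * (real (N i div 2) * (real_of_int (m i))\<^sup>2))"
  proof (intro sum.cong refl)
    fix i
    have "real (N i) = 2 * real (N i div 2)" using N[of i] by (simp add: real_of_nat_div)
    thus "real (N i) * (real_of_int (m i))\<^sup>2 = 2 * (real (N i div 2) * (real_of_int (m i))\<^sup>2)" by simp
  qed
  also have "\<dots> = 2 * real_of_int (\<Sum>i\<in>UNIV. int (N i div 2) * (m i)\<^sup>2)"
    by (simp add: sum_distrib_left)
  finally show "\<exists>m :: int. x \<bullet> x = 2 * real_of_int m" by blast
qed

lemma theta_index_inj:
  assumes N: "\<And>i. N i > 0"
  shows "inj (theta_index N)"
proof (rule injI)
  fix g h assume "theta_index N g = theta_index N h"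
  hence e: "snd (theta_index N g) $ i = snd (theta_index N h) $ i" for i by simp
  have "g i = h i" for i using e[of i] N[of i] by (simp add: theta_index_def)
  thus "g = h" by (rule ext)
qed

text \<open>All exponents have \<open>2 n = (l, l)\<close>, as always for Jacobi forms of singular weight.\<close>

lemma theta_index_norm:
  assumes N: "\<And>i. N i > 0"
  shows "snd (theta_index N g) \<bullet> snd (theta_index N g) = 2 * fst (theta_index N g)"
proof -
  have "real_of_int (g i) / sqrt (N i) * (real_of_int (g i) / sqrt (N i)) = 2 * ((real_of_int (g i))\<^sup>2 / (2 * real (N i)))" for i
    by (simp add: power2_eq_square)
  thus ?thesis unfolding theta_index_def fst_conv snd_conv inner_vec_def sum_distrib_left
    by (intro sum.cong refl) (simp only: vec_lambda_beta inner_real_def)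
qed

lemma theta_index_dual:
  assumes N: "\<And>i. N i > 0"
  shows "snd (theta_index N g) \<in> dual_lattice (rect_lattice N)"
  unfolding dual_lattice_def
proof (intro CollectI ballI)
  fix x assume "x \<in> rect_lattice N"
  then obtain m where m: "\<And>i. x $ i = sqrt (N i) * real_of_int (m i)"
    unfolding rect_lattice_def by (auto simp: choice_iff)
  have "snd (theta_index N g) \<bullet> x = (\<Sum>i\<in>UNIV. real_of_int (g i * m i))"
    unfolding theta_index_def inner_vec_def
  proof (intro sum.cong refl)
    fix i
    have "sqrt (N i) \<noteq> 0" using N[of i] by simp
    thus "snd (\<Sum>i\<in>UNIV. (real_of_int (g i))\<^sup>2 / (2 * real (N i)), \<chi> i. real_of_int (g i) / sqrt (N i)) $ i \<bullet> x $ i = real_of_int (g i * m i)"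
      by (simp add: m)
  qed
  also have "\<dots> = real_of_int (\<Sum>i\<in>UNIV. g i * m i)" by simp
  finally show "snd (theta_index N g) \<bullet> x \<in> \<int>" by (simp only: Ints_of_int)
qed

text \<open>
  A linear combination of theta products is a Jacobi form if \<open>T\<close> and \<open>S\<close> permute its terms (by
  \<open>\<alpha>\<close> and \<open>\<beta>\<close>) and multiply the coefficients by the constants that belong to \<open>v\<^sub>\<eta>\<^sup>d\<close>. For \<open>S\<close>,
  where \<open>\<eta>(- 1 / \<tau>) = (- \<i> \<tau>)\<^sup>1\<^sup>/\<^sup>2 \<eta>(\<tau>)\<close>, this constant is \<open>\<i>\<^sup>w\<close> with \<open>2 w = n - d\<close>: it compensates the
  factor \<open>(- \<i>)\<^sup>w\<close> that remains after division by \<open>\<eta>\<^sup>d\<close>.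
\<close>

theorem theta_combination_in_jacobi_forms:
  fixes K :: "'k set" and s :: "'k \<Rightarrow> complex" and c :: "'k \<Rightarrow> 'n::finite \<Rightarrow> thkind" and N :: "'n \<Rightarrow> nat"
    and d w :: int
  assumes N: "\<And>i. N i > 0" and kind_level: "\<And>k. k \<in> K \<Longrightarrow> kind_level \<circ> c k = N"
    and T: "bij_betw \<alpha> K K" "\<And>k. k \<in> K \<Longrightarrow> Tkind \<circ> c k = c (\<alpha> k)"
      "\<And>k. k \<in> K \<Longrightarrow> s k * (\<Prod>i\<in>UNIV. Tmult (c k i)) = exp (pi * \<i> * of_int d / 12) * s (\<alpha> k)"
    and S: "bij_betw \<beta> K K" "\<And>k. k \<in> K \<Longrightarrow> Skind \<circ> c k = c (\<beta> k)"
      "\<And>k. k \<in> K \<Longrightarrow> s k * (\<Prod>i\<in>UNIV. Smult (c k i)) = \<i> powi w * s (\<beta> k)"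
    and d: "int CARD('n) - d = 2 * w"
  shows "(\<lambda>p. \<Sum>k\<in>K. s k * theta_prod (c k) p) \<in> jacobi_forms (real CARD('n) / 2) (rect_lattice N) d"
proof -
  define \<phi> where "\<phi> = (\<lambda>p. \<Sum>k\<in>K. s k * theta_prod (c k) p)"
  have hol: "holomorphic_on_H \<phi>"
    unfolding \<phi>_def theta_prod_def by (intro holomorphic_on_H_sum holomorphic_on_H_prod holomorphic_on_H_theta_coord)
  have shift: "\<phi> (\<tau> + 1, z) = exp (pi * \<i> * of_int d / 12) * \<phi> (\<tau>, z)" for \<tau> z
  proof -
    have "\<phi> (\<tau> + 1, z) = (\<Sum>k\<in>K. exp (pi * \<i> * of_int d / 12) * (s (\<alpha> k) * theta_prod (c (\<alpha> k)) (\<tau>, z)))"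
      unfolding \<phi>_def theta_prod_shift
    proof (intro sum.cong refl)
      fix k assume k: "k \<in> K"
      show "s k * ((\<Prod>i\<in>UNIV. Tmult (c k i)) * theta_prod (Tkind \<circ> c k) (\<tau>, z)) =
          exp (pi * \<i> * of_int d / 12) * (s (\<alpha> k) * theta_prod (c (\<alpha> k)) (\<tau>, z))"
        unfolding T(2)[OF k] mult.assoc[symmetric] T(3)[OF k] ..
    qed
    also have "\<dots> = exp (pi * \<i> * of_int d / 12) * \<phi> (\<tau>, z)"
      unfolding \<phi>_def sum_distrib_left[symmetric]
      by (subst sum.reindex_bij_betw[OF T(1), of "\<lambda>k. s k * theta_prod (c k) (\<tau>, z)"]) simp
    finally show ?thesis .
  qed
  have inversion: "\<phi> (- 1 / \<tau>, inverse \<tau> *s z) =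
      \<i> powi w * csqrt (- \<i> * \<tau>) ^ CARD('n) * exp (pi * \<i> * (cform z z / \<tau>)) * \<phi> (\<tau>, z)"
    if \<tau>: "Im \<tau> > 0" for \<tau> z
  proof -
    define E where "E = csqrt (- \<i> * \<tau>) ^ CARD('n) * exp (pi * \<i> * (cform z z / \<tau>))"
    have "\<phi> (- 1 / \<tau>, inverse \<tau> *s z) = (\<Sum>k\<in>K. E * \<i> powi w * (s (\<beta> k) * theta_prod (c (\<beta> k)) (\<tau>, z)))"
      unfolding \<phi>_def theta_prod_inversion[OF \<tau>] E_def[symmetric]
    proof (intro sum.cong refl)
      fix k assume k: "k \<in> K"
      have "s k * (E * ((\<Prod>i\<in>UNIV. Smult (c k i)) * theta_prod (Skind \<circ> c k) (\<tau>, z))) =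
         E * ((s k * (\<Prod>i\<in>UNIV. Smult (c k i))) * theta_prod (Skind \<circ> c k) (\<tau>, z))"
        by (simp only: mult_ac)
      also have "\<dots> = E * \<i> powi w * (s (\<beta> k) * theta_prod (c (\<beta> k)) (\<tau>, z))"
        unfolding S(2)[OF k] S(3)[OF k] by (simp only: mult_ac)
      finally show "s k * (E * ((\<Prod>i\<in>UNIV. Smult (c k i)) * theta_prod (Skind \<circ> c k) (\<tau>, z))) =
         E * \<i> powi w * (s (\<beta> k) * theta_prod (c (\<beta> k)) (\<tau>, z))" .
    qed
    also have "\<dots> = E * \<i> powi w * \<phi> (\<tau>, z)"
      unfolding \<phi>_def sum_distrib_left[symmetric]
      by (subst sum.reindex_bij_betw[OF S(1), of "\<lambda>k. s k * theta_prod (c k) (\<tau>, z)"]) simp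
    finally show ?thesis by (simp only: E_def mult_ac)
  qed

  have modular: "\<phi> (moebius_act a b c e \<tau>, inverse (of_int c * \<tau> + of_int e) *s z) =
       v_eta a b c e powi d * (of_int c * \<tau> + of_int e) powr of_real (real CARD('n) / 2) *
       exp (pi * \<i> * (of_int c * cform z z / (of_int c * \<tau> + of_int e))) * \<phi> (\<tau>, z)"
    if det: "a * e - b * c = 1" and \<tau>: "Im \<tau> > 0" for a b c e \<tau> z
  proof -
    \<comment> \<open>\<open>F\<close> has integral weight \<open>w\<close> and trivial character.\<close>
    define F where "F = (\<lambda>\<tau> z. \<phi> (\<tau>, z) / dedekind_eta \<tau> powi d)"
    define j where "j = of_int c * \<tau> + (of_int e :: complex)"
    have j: "j \<noteq> 0" unfolding j_def by (rule automorphy_factor_nonzero[OF det \<tau>])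
    have F: "F (moebius_act a b c e \<tau>) (inverse j *s z) =
        j powi w * exp (pi * \<i> * (of_int c * cform z z / j)) * F \<tau> z"
      unfolding j_def
    proof (rule automorphy_induct[OF _ _ det \<tau>])
      fix \<tau> :: complex and z :: "complex ^ 'n" assume \<tau>: "Im \<tau> > 0"
      have "exp (pi * \<i> / 12) powi d = exp (pi * \<i> * of_int d / 12)"
        by (simp add: exp_power_int mult_ac)
      thus "F (\<tau> + 1) z = F \<tau> z"
        using eta_nonzero[OF \<tau>] by (simp add: F_def shift eta_shift[OF \<tau>] power_int_mult_distrib)
      define r where "r = csqrt (- \<i> * \<tau>)"
      have r: "r \<noteq> 0" "r\<^sup>2 = - \<i> * \<tau>" using \<tau> by (auto simp: r_def)
      have "r ^ CARD('n) / r powi d = r powi (int CARD('n) - d)"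
        using r by (simp add: power_int_diff)
      also have "\<dots> = (r\<^sup>2) powi w" unfolding d by (simp add: power_int_mult)
      also have "\<dots> = (- \<i>) powi w * \<tau> powi w" unfolding r(2) by (rule power_int_mult_distrib)
      finally have "\<i> powi w * (r ^ CARD('n) / r powi d) = (\<i> powi w * (- \<i>) powi w) * \<tau> powi w" by simp
      also have "\<i> powi w * (- \<i>) powi w = (1 :: complex)"
        by (simp flip: power_int_mult_distrib)
      finally have key: "\<i> powi w * (r ^ CARD('n) / r powi d) = \<tau> powi w" by simp
      have "F (- 1 / \<tau>) (inverse \<tau> *s z) = \<i> powi w * (r ^ CARD('n) / r powi d) * exp (pi * \<i> * (cform z z / \<tau>)) * F \<tau> z"
        unfolding F_def inversion[OF \<tau>] eta_inversion[OF \<tau>] r_def[symmetric] power_int_mult_distrib by simp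
      thus "F (- 1 / \<tau>) (inverse \<tau> *s z) = \<tau> powi w * exp (pi * \<i> * (cform z z / \<tau>)) * F \<tau> z"
        unfolding key .
    qed
    have csq: "csqrt j powi d * j powi w = j powr of_real (real CARD('n) / 2)"
    proof -
      have "j powi w = ((csqrt j)\<^sup>2) powi w" by simp
      also have "\<dots> = csqrt j powi (2 * w)" by (simp add: power_int_mult)
      also have "csqrt j powi d * csqrt j powi (2 * w) = csqrt j powi int CARD('n)"
      proof -
        have "int CARD('n) = d + 2 * w" using d by simp
        thus ?thesis using j by (simp only: power_int_add csqrt_eq_0 simp_thms)
      qed
      also have "\<dots> = csqrt j ^ CARD('n)" by simp
      also have "csqrt j ^ CARD('n) = exp (Ln j / 2) ^ CARD('n)" by (simp only: csqrt_exp_Ln[OF j])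
      also have "exp (Ln j / 2) ^ CARD('n) = exp (of_nat CARD('n) * (Ln j / 2))" by (rule exp_of_nat_mult[symmetric])
      also have "\<dots> = j powr of_real (real CARD('n) / 2)" using j by (simp add: powr_def)
      finally show ?thesis .
    qed
    have "\<phi> (moebius_act a b c e \<tau>, inverse j *s z) =
       F (moebius_act a b c e \<tau>) (inverse j *s z) * dedekind_eta (moebius_act a b c e \<tau>) powi d"
      using eta_nonzero[OF Im_moebius_act[OF det \<tau>]] by (simp add: F_def)
    also have "\<dots> = v_eta a b c e powi d * (csqrt j powi d * j powi w) * exp (pi * \<i> * (of_int c * cform z z / j)) *
        (F \<tau> z * dedekind_eta \<tau> powi d)"
      unfolding F eta_moebius[OF det \<tau>] j_def[symmetric] power_int_mult_distrib by (simp only: mult_ac)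
    also have "F \<tau> z * dedekind_eta \<tau> powi d = \<phi> (\<tau>, z)"
      using eta_nonzero[OF \<tau>] by (simp add: F_def)
    finally show ?thesis unfolding csq unfolding j_def .
  qed

  have lattice: "\<phi> (\<tau>, z + \<tau> *s cvec x + cvec y) =
       exp (- pi * \<i> * (of_real (x \<bullet> x) * \<tau> + 2 * cform (cvec x) z)) * \<phi> (\<tau>, z)"
    if x: "x \<in> rect_lattice N" and y: "y \<in> rect_lattice N" for \<tau> z x y
  proof -
    obtain m where m: "\<And>i. x $ i = sqrt (N i) * real_of_int (m i)"
      using x unfolding rect_lattice_def by (auto simp: choice_iff)
    obtain l where l: "\<And>i. y $ i = sqrt (N i) * real_of_int (l i)"
      using y unfolding rect_lattice_def by (auto simp: choice_iff)
    have "theta_prod (c k) (\<tau>, z + \<tau> *s cvec x + cvec y) =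
       exp (- pi * \<i> * (of_real (x \<bullet> x) * \<tau> + 2 * cform (cvec x) z)) * theta_prod (c k) (\<tau>, z)" if "k \<in> K" for k
    proof -
      have "N i = kind_level (c k i)" for i using fun_cong[OF kind_level[OF that], of i] by simp
      thus ?thesis using m l by (intro theta_prod_lattice_shift[of _ _ m _ l]) auto
    qed
    thus ?thesis by (simp add: \<phi>_def sum_distrib_left mult.left_commute)
  qed

  have fourier: "\<exists>f. \<forall>\<tau> z. Im \<tau> > 0 \<longrightarrow>
      ((\<lambda>(n, l). f (n, l) * exp (2 * pi * \<i> * (of_real n * \<tau> + cform (cvec l) z))) has_sum \<phi> (\<tau>, z))
        (fourier_index (rect_lattice N) d)"
  proof -
    define X where "X = (\<lambda>g. \<Sum>k\<in>K. s k * (\<Prod>i\<in>UNIV. kind_coeff (c k i) (g i)))"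
    \<comment> \<open>Exponents that do not come from a summation index get the coefficient \<open>0\<close>.\<close>
    define f where "f = (\<lambda>p. if p \<in> range (theta_index N) then X (the_inv (theta_index N) p) else 0)"
    have inj: "inj (theta_index N)" by (rule theta_index_inj[OF N])
    have f: "f (theta_index N g) = X g" for g by (simp add: f_def the_inv_f_f[OF inj])
    \<comment> \<open>The behaviour under \<open>\<tau> \<mapsto> \<tau> + 1\<close>, read on coefficients, fixes the exponents modulo \<open>1\<close>.\<close>
    have cong: "fst (theta_index N g) - of_int d / 24 \<in> \<int>" if X: "X g \<noteq> 0" for g
    proof -
      define n where "n = fst (theta_index N g)"
      have exp_n: "exp (2 * pi * \<i> * of_real n) = (\<Prod>i\<in>UNIV. exp (pi * \<i> * (of_int (g i))\<^sup>2 / of_nat (N i)))"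
      proof -
        have "2 * pi * \<i> * of_real n = (\<Sum>i\<in>UNIV. pi * \<i> * (of_int (g i))\<^sup>2 / of_nat (N i))"
          unfolding n_def theta_index_def fst_conv of_real_sum sum_distrib_left
          by (intro sum.cong refl) simp
        thus ?thesis by (simp add: exp_sum)
      qed
      have "X g * exp (2 * pi * \<i> * of_real n) = (\<Sum>k\<in>K. exp (pi * \<i> * of_int d / 12) * (s (\<alpha> k) * (\<Prod>i\<in>UNIV. kind_coeff (c (\<alpha> k) i) (g i))))"
        unfolding X_def sum_distrib_right
      proof (intro sum.cong refl)
        fix k assume k: "k \<in> K"
        have kind_level': "kind_level (c k i) = N i" for i using fun_cong[OF kind_level[OF k], of i] by simp
        have kind: "Tkind (c k i) = c (\<alpha> k) i" for i using fun_cong[OF T(2)[OF k], of i] by simp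
        have "s k * (\<Prod>i\<in>UNIV. kind_coeff (c k i) (g i)) * exp (2 * pi * \<i> * of_real n) =
           s k * (\<Prod>i\<in>UNIV. kind_coeff (c k i) (g i) * exp (pi * \<i> * (of_int (g i))\<^sup>2 / of_nat (kind_level (c k i))))"
          unfolding exp_n kind_level' prod.distrib by (simp only: mult.assoc)
        also have "\<dots> = (s k * (\<Prod>i\<in>UNIV. Tmult (c k i))) * (\<Prod>i\<in>UNIV. kind_coeff (c (\<alpha> k) i) (g i))"
          unfolding kind_coeff_modulus_shift prod.distrib kind by (simp only: mult.assoc)
        finally show "s k * (\<Prod>i\<in>UNIV. kind_coeff (c k i) (g i)) * exp (2 * pi * \<i> * of_real n) =
           exp (pi * \<i> * of_int d / 12) * (s (\<alpha> k) * (\<Prod>i\<in>UNIV. kind_coeff (c (\<alpha> k) i) (g i)))"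
          unfolding T(3)[OF k] by (simp only: mult.assoc)
      qed
      also have "\<dots> = exp (pi * \<i> * of_int d / 12) * X g"
        unfolding X_def sum_distrib_left[symmetric]
        by (subst sum.reindex_bij_betw[OF T(1), of "\<lambda>k. s k * (\<Prod>i\<in>UNIV. kind_coeff (c k i) (g i))"]) simp
      finally have "exp (2 * pi * \<i> * of_real n) = exp (pi * \<i> * of_int d / 12)" using X by simp
      hence "exp (2 * pi * \<i> * of_real n - pi * \<i> * of_int d / 12) = 1" by (simp add: exp_diff)
      moreover have "2 * pi * \<i> * of_real n - pi * \<i> * of_int d / 12 = \<i> * of_real (2 * pi * (n - of_int d / 24))"
        by (simp add: field_simps)
      ultimately have "exp (\<i> * of_real (2 * pi * (n - of_int d / 24))) = 1" by simp
      then obtain r :: int where "2 * pi * (n - of_int d / 24) = of_int (2 * r) * pi"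
        unfolding exp_eq_1 by auto
      hence "n - of_int d / 24 = of_int r" by simp
      thus ?thesis unfolding n_def by simp
    qed
    have "((\<lambda>(n, l). f (n, l) * exp (2 * pi * \<i> * (of_real n * \<tau> + cform (cvec l) z))) has_sum \<phi> (\<tau>, z))
        (fourier_index (rect_lattice N) d)" if \<tau>: "Im \<tau> > 0" for \<tau> z
    proof -
      define h where "h = (\<lambda>p. f p * exp (2 * pi * \<i> * (of_real (fst p) * \<tau> + cform (cvec (snd p)) z)))"
      have "((\<lambda>g. \<Sum>k\<in>K. s k * ((\<Prod>i\<in>UNIV. kind_coeff (c k i) (g i)) *
          exp (2 * pi * \<i> * (of_real (fst (theta_index N g)) * \<tau> + cform (cvec (snd (theta_index N g))) z)))) has_sum \<phi> (\<tau>, z)) UNIV"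
        unfolding \<phi>_def
      proof (intro has_sum_sum has_sum_cmult_right)
        fix k assume k: "k \<in> K"
        show "((\<lambda>g. (\<Prod>i\<in>UNIV. kind_coeff (c k i) (g i)) *
          exp (2 * pi * \<i> * (of_real (fst (theta_index N g)) * \<tau> + cform (cvec (snd (theta_index N g))) z))) has_sum
           theta_prod (c k) (\<tau>, z)) UNIV"
          using theta_prod_has_sum[OF \<tau>, of "c k" z] unfolding kind_level[OF k] .
      qed
      hence "((\<lambda>g. h (theta_index N g)) has_sum \<phi> (\<tau>, z)) UNIV"
        by (simp add: h_def f X_def sum_distrib_right mult.assoc)
      hence "(h has_sum \<phi> (\<tau>, z)) (range (theta_index N))"
        using has_sum_reindex[OF inj, of h] by (simp add: o_def)
      moreover have "(h has_sum \<phi> (\<tau>, z)) (range (theta_index N)) \<longleftrightarrow>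
          (h has_sum \<phi> (\<tau>, z)) (fourier_index (rect_lattice N) d)"
      proof (rule has_sum_cong_neutral)
        fix p assume "p \<in> fourier_index (rect_lattice N) d - range (theta_index N)"
        thus "h p = 0" by (simp add: h_def f_def)
      next
        fix p assume p: "p \<in> range (theta_index N) - fourier_index (rect_lattice N) d"
        then obtain g where g: "p = theta_index N g" by blast
        have "X g = 0"
        proof (rule ccontr)
          assume X: "X g \<noteq> 0"
          have "fst (theta_index N g) \<ge> 0" by (simp add: theta_index_def sum_nonneg)
          hence "theta_index N g \<in> fourier_index (rect_lattice N) d"
            unfolding fourier_index_def case_prod_unfold
            using cong[OF X] theta_index_dual[of N g, OF N] theta_index_norm[of N g, OF N] by simp
          thus False using p unfolding g by simp
        qed
        thus "h p = 0" by (simp add: h_def g f)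
      qed auto
      ultimately show ?thesis by (simp add: h_def case_prod_unfold)
    qed
    thus ?thesis by blast
  qed

  show ?thesis
    unfolding jacobi_forms_def \<phi>_def[symmetric]
    using hol modular lattice fourier by blast
qed

section \<open>Multipliers and special values\<close>

lemma exp_pi_12_cong:
  fixes d m t :: int
  assumes "d = m + 24 * t"
  shows "exp (pi * \<i> * of_int d / 12) = exp (pi * \<i> * of_int m / 12)"
proof -
  have "pi * \<i> * of_int d / 12 = pi * \<i> * of_int m / 12 + 2 * of_int t * pi * \<i>"
    unfolding assms by (simp add: field_simps)
  moreover have "exp (2 * of_int t * pi * \<i>) = (1 :: complex)" by (rule exp_integer_2pi) simp
  ultimately show ?thesis by (simp only: exp_add mult_1_right)
qed

lemma i_powi_cong:
  fixes w m t :: int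
  assumes "w = m + 12 * t"
  shows "\<i> powi w = \<i> powi m"
proof -
  have "\<i> powi w = \<i> powi m * (\<i> powi 12) powi t"
    unfolding assms by (simp add: power_int_add power_int_mult del: power_int_numeral)
  also have "\<i> powi 12 = \<i> ^ 12" by simp
  also have "\<i> ^ 12 = (\<i>\<^sup>2) ^ 6" by (simp flip: power_mult)
  also have "\<dots> = 1" by simp
  finally show ?thesis by simp
qed

lemma i_powi_neg: "\<i> powi (- int m) = (- \<i>) ^ m"
  by (simp add: power_int_minus flip: power_inverse)

lemma two_kinds_multipliers:
  fixes A I :: "'n::finite set"
  assumes A: "A \<subseteq> I"
  defines "b \<equiv> (\<lambda>i. if i \<in> A then Th1 else Quint)"
  shows "(\<Prod>i\<in>I. Tmult (b i)) = exp (pi * \<i> * of_int (int (card I) + 2 * int (card A)) / 12)"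
    and "(\<Prod>i\<in>I. Smult (b i)) = \<i> powi (- int (card A))"
proof -
  have split: "(\<Prod>i\<in>I. f (b i)) = f Th1 ^ card A * f Quint ^ (card I - card A)" for f :: "thkind \<Rightarrow> complex"
  proof -
    have "(\<Prod>i\<in>I. f (b i)) = (\<Prod>i\<in>I - A. f (b i)) * (\<Prod>i\<in>A. f (b i))"
      using A by (intro prod.subset_diff) auto
    also have "(\<Prod>i\<in>I - A. f (b i)) = f Quint ^ (card I - card A)"
      using A by (simp add: b_def card_Diff_subset)
    also have "(\<Prod>i\<in>A. f (b i)) = f Th1 ^ card A" by (simp add: b_def)
    finally show ?thesis by simp
  qed
  have "card A \<le> card I" using A by (simp add: card_mono)
  hence card: "of_nat (card I - card A) = (of_nat (card I) - of_nat (card A) :: complex)" by (rule of_nat_diff)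
  have "(\<Prod>i\<in>I. Tmult (b i)) = exp (of_nat (card A) * (pi * \<i> / 4) + of_nat (card I - card A) * (pi * \<i> / 12))"
    unfolding split Tmult.simps exp_of_nat_mult[symmetric] exp_add[symmetric] ..
  also have "of_nat (card A) * (pi * \<i> / 4) + of_nat (card I - card A) * (pi * \<i> / 12) =
      pi * \<i> * of_int (int (card I) + 2 * int (card A)) / 12"
    unfolding card by (simp add: field_simps)
  finally show "(\<Prod>i\<in>I. Tmult (b i)) = exp (pi * \<i> * of_int (int (card I) + 2 * int (card A)) / 12)" .
  show "(\<Prod>i\<in>I. Smult (b i)) = \<i> powi (- int (card A))"
    unfolding split i_powi_neg by simp
qed

lemma theta_half: "theta 4 a \<tau> (1 / 2) = theta 4 (\<lambda>l. exp (pi * \<i> * of_int l / 2) * a l) \<tau> 0"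
proof -
  have "pi * \<i> * (of_int l)\<^sup>2 * \<tau> / of_nat 4 + 2 * pi * \<i> * of_int l * (1 / 2) / of_real (sqrt (real 4)) =
      pi * \<i> * of_int l / 2 + (pi * \<i> * (of_int l)\<^sup>2 * \<tau> / of_nat 4 + 2 * pi * \<i> * of_int l * 0 / of_real (sqrt (real 4)))" for l
    by simp
  thus ?thesis unfolding theta_def theta_term_def by (simp only: exp_add mult_ac)
qed

lemma theta_period_1: "theta 4 a \<tau> 1 = theta 4 (\<lambda>l. (if even l then 1 else - 1) * a l) \<tau> 0"
proof -
  have "pi * \<i> * (of_int l)\<^sup>2 * \<tau> / of_nat 4 + 2 * pi * \<i> * of_int l * 1 / of_real (sqrt (real 4)) =
      pi * \<i> * of_int (2 * l) / 2 + (pi * \<i> * (of_int l)\<^sup>2 * \<tau> / of_nat 4 + 2 * pi * \<i> * of_int l * 0 / of_real (sqrt (real 4)))" for l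
    by simp
  moreover have "exp (pi * \<i> * of_int (2 * l) / 2) = (if even l then 1 else - 1)" for l
  proof -
    have "(2 * l) mod 4 = (if even l then 0 else 2)" by presburger
    thus ?thesis unfolding exp_quarter_turn by simp
  qed
  ultimately show ?thesis unfolding theta_def theta_term_def by (simp only: exp_add mult_ac)
qed

lemma theta_odd_coeffs_eq_0:
  assumes "\<And>l. a (- l) = - a l"
  shows "theta N a \<tau> 0 = 0"
proof -
  have "theta N a \<tau> 0 = theta N (\<lambda>l. a (- l)) \<tau> 0" by (simp add: theta_reindex_neg)
  also have "\<dots> = theta N (\<lambda>l. (- 1) * a l) \<tau> 0" by (simp add: assms)
  also have "\<dots> = - theta N a \<tau> 0" by (subst theta_cmult) simp
  finally show ?thesis by (simp add: equal_neg_zero)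
qed

lemma theta_pos_at_i:
  fixes a :: "int \<Rightarrow> real"
  assumes N: "N > 0" and nonneg: "\<And>l. a l \<ge> 0" and growth: "exp_growth (\<lambda>l. of_real (a l))" and pos: "a m > 0"
  shows "\<exists>S > 0. theta N (\<lambda>l. of_real (a l)) \<i> 0 = of_real S"
proof -
  define t where "t = (\<lambda>l. a l * exp (- (pi * (real_of_int l)\<^sup>2 / N)))"
  have t: "theta_term N (\<lambda>l. of_real (a l)) \<i> 0 l = of_real (t l)" for l
  proof -
    have "pi * \<i> * (of_int l)\<^sup>2 * \<i> / of_nat N + 2 * pi * \<i> * of_int l * 0 / of_real (sqrt N) =
        of_real (- (pi * (real_of_int l)\<^sup>2 / N))"
    proof -
      have "pi * \<i> * (of_int l)\<^sup>2 * \<i> = (\<i> * \<i>) * (of_real pi * (of_int l)\<^sup>2)" by (simp only: mult_ac)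
      also have "\<dots> = - (of_real pi * (of_int l)\<^sup>2)" by simp
      finally have e: "pi * \<i> * (of_int l)\<^sup>2 * \<i> = - (of_real pi * (of_int l)\<^sup>2)" .
      show ?thesis unfolding e by simp
    qed
    thus ?thesis unfolding theta_term_def t_def by (simp only: exp_of_real of_real_mult)
  qed
  have "(theta_term N (\<lambda>l. of_real (a l)) \<i> 0 has_sum theta N (\<lambda>l. of_real (a l)) \<i> 0) UNIV"
    by (rule theta_has_sum[OF N growth]) simp
  hence hs: "((\<lambda>l. complex_of_real (t l)) has_sum theta N (\<lambda>l. of_real (a l)) \<i> 0) UNIV"
    by (rule has_sum_cong[THEN iffD1, rotated]) (rule t)
  have sum: "t summable_on UNIV"
    using has_sum_bounded_linear[OF bounded_linear_Re hs] by (auto simp: o_def intro: has_sum_imp_summable)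
  have "infsum t {m} \<le> infsum t UNIV"
    by (rule infsum_mono_neutral) (use sum nonneg in \<open>auto simp: t_def\<close>)
  moreover have "t m > 0" using pos by (simp add: t_def)
  ultimately have "infsum t UNIV > 0" by simp
  thus ?thesis using has_sum_complex_of_real_eq[OF hs] by blast
qed

lemma mod_4_parity_cases:
  fixes l :: int
  shows "l mod 4 = 0 \<and> even l \<or> l mod 4 = 1 \<and> odd l \<or> l mod 4 = 2 \<and> even l \<or> l mod 4 = 3 \<and> odd l"
  by presburger

text \<open>
  Only the inequalities between the values at \<open>\<tau> = \<i>\<close>, \<open>w = 0\<close> are needed. They hold since the
  coefficients of \<open>Th2\<close> and of \<open>Th3 \<plusminus> Th4\<close> are nonnegative.
\<close>

lemma theta_nullvalues:
  obtains A B C :: real where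
    "theta 4 (kind_coeff Th2) \<i> 0 = of_real A" "theta 4 (kind_coeff Th3) \<i> 0 = of_real B" "theta 4 (kind_coeff Th4) \<i> 0 = of_real C"
    "A > 0" "B > C" "B > - C"
proof -
  have growth: "exp_growth (\<lambda>l. of_real (a l))" if "\<And>l. a l \<in> {0, 1}" for a :: "int \<Rightarrow> real"
  proof (rule exp_growth_bounded[of _ 1])
    fix l show "norm (complex_of_real (a l)) \<le> 1" using that[of l] by auto
  qed
  let ?a = "\<lambda>l :: int. if odd l then 1 else (0 :: real)"
  let ?b = "\<lambda>l :: int. if l mod 4 = 2 then 1 else (0 :: real)"
  let ?c = "\<lambda>l :: int. if l mod 4 = 0 then 1 else (0 :: real)"
  have "\<exists>S > 0. theta 4 (\<lambda>l. of_real (?a l)) \<i> 0 = of_real S"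
    by (rule theta_pos_at_i[where m = 1]) (auto intro!: growth split: if_splits)
  then obtain A where A: "A > 0" "theta 4 (\<lambda>l. of_real (?a l)) \<i> 0 = of_real A" by blast
  have "\<exists>S > 0. theta 4 (\<lambda>l. of_real (?b l)) \<i> 0 = of_real S"
    by (rule theta_pos_at_i[where m = 2]) (auto intro!: growth split: if_splits)
  then obtain S where S: "S > 0" "theta 4 (\<lambda>l. of_real (?b l)) \<i> 0 = of_real S" by blast
  have "\<exists>S > 0. theta 4 (\<lambda>l. of_real (?c l)) \<i> 0 = of_real S"
    by (rule theta_pos_at_i[where m = 0]) (auto intro!: growth split: if_splits)
  then obtain R where R: "R > 0" "theta 4 (\<lambda>l. of_real (?c l)) \<i> 0 = of_real R" by blast
  have hb: "((theta_term 4 (\<lambda>l. of_real (?b l)) \<i> 0) has_sum of_real S) UNIV"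
    unfolding S(2)[symmetric] by (rule theta_has_sum) (use growth[of ?b] in auto)
  have hc: "((theta_term 4 (\<lambda>l. of_real (?c l)) \<i> 0) has_sum of_real R) UNIV"
    unfolding R(2)[symmetric] by (rule theta_has_sum) (use growth[of ?c] in auto)
  have e3: "kind_coeff Th3 l = of_real (?c l) + of_real (?b l)" for l
    unfolding kind_coeff.simps using mod_4_parity_cases[of l] by (elim disjE conjE) simp_all
  have e4: "kind_coeff Th4 l = of_real (?c l) - of_real (?b l)" for l
    unfolding kind_coeff.simps using mod_4_parity_cases[of l] by (elim disjE conjE) simp_all
  have "(theta_term 4 (kind_coeff Th3) \<i> 0 has_sum of_real (R + S)) UNIV"
    using has_sum_add[OF hc hb] unfolding theta_term_def e3 by (simp only: distrib_right of_real_add)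
  hence 3: "theta 4 (kind_coeff Th3) \<i> 0 = of_real (R + S)" by (simp add: theta_def infsumI del: of_real_add)
  have "(theta_term 4 (kind_coeff Th4) \<i> 0 has_sum of_real (R - S)) UNIV"
    using has_sum_add[OF hc has_sum_cmult_right[OF hb, of "- 1"]]
    unfolding theta_term_def e4 by (simp add: left_diff_distrib)
  hence 4: "theta 4 (kind_coeff Th4) \<i> 0 = of_real (R - S)" by (simp add: theta_def infsumI del: of_real_diff)
  have "kind_coeff Th2 = (\<lambda>l. of_real (?a l))" by (rule ext) simp
  hence 2: "theta 4 (kind_coeff Th2) \<i> 0 = of_real A" using A(2) by simp
  show ?thesis by (rule that[OF 2 3 4 A(1)]) (use S(1) R(1) in auto)
qed

lemma theta_values_half:
  "theta 4 (kind_coeff Th1) \<tau> (1 / 2) = \<i> * theta 4 (kind_coeff Th2) \<tau> 0"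
  "theta 4 (kind_coeff Th2) \<tau> (1 / 2) = 0"
  "theta 4 (kind_coeff Th3) \<tau> (1 / 2) = theta 4 (kind_coeff Th4) \<tau> 0"
  "theta 4 (kind_coeff Th4) \<tau> (1 / 2) = theta 4 (kind_coeff Th3) \<tau> 0"
proof -
  have "exp (pi * \<i> * of_int l / 2) * kind_coeff Th1 l = \<i> * kind_coeff Th2 l" for l
    unfolding exp_quarter_turn kind_coeff.simps using mod_4_parity_cases[of l] by (elim disjE conjE) simp_all
  thus "theta 4 (kind_coeff Th1) \<tau> (1 / 2) = \<i> * theta 4 (kind_coeff Th2) \<tau> 0"
    unfolding theta_half by (simp only: theta_cmult)
  show "theta 4 (kind_coeff Th2) \<tau> (1 / 2) = 0"
    unfolding theta_half
  proof (rule theta_odd_coeffs_eq_0)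
    fix l :: int
    have "(- l) mod 4 = (if l mod 4 = 0 then 0 else 4 - l mod 4)" by presburger
    thus "exp (pi * \<i> * of_int (- l) / 2) * kind_coeff Th2 (- l) = - (exp (pi * \<i> * of_int l / 2) * kind_coeff Th2 l)"
      unfolding exp_quarter_turn kind_coeff.simps using mod_4_parity_cases[of l] by (elim disjE conjE) simp_all
  qed
  have "exp (pi * \<i> * of_int l / 2) * kind_coeff Th3 l = kind_coeff Th4 l" for l
    unfolding exp_quarter_turn kind_coeff.simps using mod_4_parity_cases[of l] by (elim disjE conjE) simp_all
  thus "theta 4 (kind_coeff Th3) \<tau> (1 / 2) = theta 4 (kind_coeff Th4) \<tau> 0"
    unfolding theta_half by (simp only:)
  have "exp (pi * \<i> * of_int l / 2) * kind_coeff Th4 l = kind_coeff Th3 l" for l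
    unfolding exp_quarter_turn kind_coeff.simps using mod_4_parity_cases[of l] by (elim disjE conjE) simp_all
  thus "theta 4 (kind_coeff Th4) \<tau> (1 / 2) = theta 4 (kind_coeff Th3) \<tau> 0"
    unfolding theta_half by (simp only:)
qed

lemma theta_values_1:
  "theta 4 (kind_coeff Th2) \<tau> 1 = - theta 4 (kind_coeff Th2) \<tau> 0"
  "theta 4 (kind_coeff Th3) \<tau> 1 = theta 4 (kind_coeff Th3) \<tau> 0"
  "theta 4 (kind_coeff Th4) \<tau> 1 = theta 4 (kind_coeff Th4) \<tau> 0"
proof -
  have "(if even l then 1 else - 1) * kind_coeff Th2 l = (- 1) * kind_coeff Th2 l" for l by simp
  thus "theta 4 (kind_coeff Th2) \<tau> 1 = - theta 4 (kind_coeff Th2) \<tau> 0"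
    unfolding theta_period_1 by (simp only: theta_cmult) (simp only: mult_minus1)
  have "(if even l then 1 else - 1) * kind_coeff Th3 l = kind_coeff Th3 l" for l by simp
  thus "theta 4 (kind_coeff Th3) \<tau> 1 = theta 4 (kind_coeff Th3) \<tau> 0"
    unfolding theta_period_1 by (simp only:)
  have "l mod 4 = 0 \<Longrightarrow> even l" "l mod 4 = 2 \<Longrightarrow> even l" for l :: int by presburger+
  hence "(if even l then 1 else - 1) * kind_coeff Th4 l = kind_coeff Th4 l" for l by simp
  thus "theta 4 (kind_coeff Th4) \<tau> 1 = theta 4 (kind_coeff Th4) \<tau> 0"
    unfolding theta_period_1 by (simp only:)
qed

lemma theta_Th1_nonzero: "theta 4 (kind_coeff Th1) \<i> (1 / 2) \<noteq> 0"
  by (rule theta_nullvalues) (simp add: theta_values_half)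

lemma theta_Quint_nonzero: "theta 12 (kind_coeff Quint) \<i> 0 \<noteq> 0"
proof -
  have "kind_coeff Quint = chi12" by (rule ext) simp
  thus ?thesis using theta_chi12_eq_eta[of \<i>] eta_nonzero[of \<i>] by simp
qed

section \<open>Existence for every admissible character\<close>

text \<open>The coordinates in \<open>A\<close> carry \<open>Th1\<close>, the others \<open>Quint\<close>.\<close>

proposition jacobi_form_of_products:
  fixes A :: "'n::finite set" and d t :: int
  assumes d: "d = int CARD('n) + 2 * int (card A) + 24 * t"
  shows "\<exists>L :: (real ^ 'n) set. is_lattice_of_rank L CARD('n) \<and> even_lattice L \<and>
           (\<exists>\<phi>\<in>jacobi_forms (real CARD('n) / 2) L d. \<exists>\<tau> z. Im \<tau> > 0 \<and> \<phi> (\<tau>, z) \<noteq> 0)"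
proof -
  define b where "b = (\<lambda>i :: 'n. if i \<in> A then Th1 else Quint)"
  define w where "w = - int (card A) + 12 * (- t)"
  have mult: "(\<Prod>i\<in>UNIV. Tmult (b i)) = exp (pi * \<i> * of_int (int CARD('n) + 2 * int (card A)) / 12)"
      "(\<Prod>i\<in>UNIV. Smult (b i)) = \<i> powi (- int (card A))"
    unfolding b_def by (rule two_kinds_multipliers, simp)+
  have "(\<lambda>p. \<Sum>k\<in>{()}. 1 * theta_prod b p) \<in> jacobi_forms (real CARD('n) / 2) (rect_lattice (kind_level \<circ> b)) d"
  proof (rule theta_combination_in_jacobi_forms[where \<alpha> = id and \<beta> = id and s = "\<lambda>_. 1" and c = "\<lambda>_. b" and w = w])
    show "Tkind \<circ> b = b" "Skind \<circ> b = b" by (auto simp: b_def)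
    show "1 * (\<Prod>i\<in>UNIV. Tmult (b i)) = exp (pi * \<i> * of_int d / 12) * 1"
      unfolding mult exp_pi_12_cong[OF d] by simp
    show "1 * (\<Prod>i\<in>UNIV. Smult (b i)) = \<i> powi w * 1"
      unfolding mult i_powi_cong[OF w_def] by simp
    show "int CARD('n) - d = 2 * w" unfolding d w_def by simp
  qed auto
  hence J: "theta_prod b \<in> jacobi_forms (real CARD('n) / 2) (rect_lattice (kind_level \<circ> b)) d" by simp
  define z :: "complex ^ 'n" where "z = (\<chi> i. if i \<in> A then 1 / 2 else 0)"
  have "theta_kind (b i) \<i> (z $ i) \<noteq> 0" for i
    using theta_Th1_nonzero theta_Quint_nonzero by (simp add: b_def z_def del: kind_coeff.simps)
  hence "theta_prod b (\<i>, z) \<noteq> 0" by (simp add: theta_prod_def)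
  moreover have "is_lattice_of_rank (rect_lattice (kind_level \<circ> b)) CARD('n)" by (rule rect_lattice_rank) simp
  moreover have "even_lattice (rect_lattice (kind_level \<circ> b))" by (rule rect_lattice_even) simp
  moreover have "Im \<i> > 0" by simp
  ultimately show ?thesis using J by blast
qed

text \<open>
  The terms of the determinant of \<open>Th2\<close>, \<open>Th3\<close>, \<open>Th4\<close> in three variables, and their signs.
\<close>

definition det_triples :: "(thkind \<times> thkind \<times> thkind) set" where
  "det_triples = {(Th2, Th3, Th4), (Th3, Th4, Th2), (Th4, Th2, Th3), (Th2, Th4, Th3), (Th4, Th3, Th2), (Th3, Th2, Th4)}"

definition det_sign :: "thkind \<times> thkind \<times> thkind \<Rightarrow> complex" where
  "det_sign k = (if k \<in> {(Th2, Th3, Th4), (Th3, Th4, Th2), (Th4, Th2, Th3)} then 1 else - 1)"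

lemma bij_betw_involutionI:
  assumes "\<And>x. x \<in> K \<Longrightarrow> f x \<in> K" "\<And>x. x \<in> K \<Longrightarrow> f (f x) = x"
  shows "bij_betw f K K"
  by (rule bij_betwI[of _ _ _ f]) (use assms in auto)

text \<open>
  The coordinates \<open>p\<close>, \<open>q\<close>, \<open>r\<close> carry the determinant. Both \<open>T\<close> and \<open>S\<close> exchange two of its
  columns; the resulting sign accounts for the summand \<open>12\<close> in \<open>d\<close>.
\<close>

proposition jacobi_form_of_determinant:
  fixes A :: "'n::finite set" and p q r :: 'n and d t :: int
  assumes distinct: "p \<noteq> q" "p \<noteq> r" "q \<noteq> r" and A: "A \<subseteq> UNIV - {p, q, r}"
    and d: "d = int CARD('n) + 12 + 2 * int (card A) + 24 * t"
  shows "\<exists>L :: (real ^ 'n) set. is_lattice_of_rank L CARD('n) \<and> even_lattice L \<and>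
           (\<exists>\<phi>\<in>jacobi_forms (real CARD('n) / 2) L d. \<exists>\<tau> z. Im \<tau> > 0 \<and> \<phi> (\<tau>, z) \<noteq> 0)"
proof -
  define I where "I = UNIV - {p, q, r}"
  have AI: "A \<subseteq> I" using A by (simp add: I_def)
  define b where "b = (\<lambda>i :: 'n. if i \<in> A then Th1 else Quint)"
  define c where "c = (\<lambda>(k1, k2, k3) i. if i = p then k1 else if i = q then k2 else if i = r then k3 else b i)"
  define N where "N = kind_level \<circ> c (Th2, Th3, Th4)"
  define map3 where "map3 = (\<lambda>f :: thkind \<Rightarrow> thkind. \<lambda>(k1, k2, k3). (f k1, f k2, f k3))"
  define w where "w = (- int (card A) - 6) + 12 * (- t)"
  have mult: "(\<Prod>i\<in>I. Tmult (b i)) = exp (pi * \<i> * of_int (int (card I) + 2 * int (card A)) / 12)"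
      "(\<Prod>i\<in>I. Smult (b i)) = \<i> powi (- int (card A))"
    unfolding b_def by (rule two_kinds_multipliers[OF AI])+
  have "card {p, q, r} = 3" using distinct by simp
  hence cardI: "int (card I) = int CARD('n) - 3"
    using card_Diff_subset[of "{p, q, r}" UNIV] card_mono[of UNIV "{p, q, r}"] by (simp add: I_def of_nat_diff)
  have split: "(\<Prod>i\<in>UNIV. f i (c (k1, k2, k3) i)) = f p k1 * f q k2 * f r k3 * (\<Prod>i\<in>I. f i (b i))"
    for f :: "'n \<Rightarrow> thkind \<Rightarrow> complex" and k1 k2 k3
  proof -
    have "(\<Prod>i\<in>UNIV. f i (c (k1, k2, k3) i)) =
        (\<Prod>i\<in>I. f i (c (k1, k2, k3) i)) * (\<Prod>i\<in>{p, q, r}. f i (c (k1, k2, k3) i))"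
      unfolding I_def by (rule prod.subset_diff) auto
    also have "(\<Prod>i\<in>I. f i (c (k1, k2, k3) i)) = (\<Prod>i\<in>I. f i (b i))"
      by (intro prod.cong refl) (auto simp: c_def I_def)
    also have "(\<Prod>i\<in>{p, q, r}. f i (c (k1, k2, k3) i)) = f p k1 * f q k2 * f r k3"
      using distinct by (simp add: c_def)
    finally show ?thesis by (simp only: mult_ac)
  qed
  have Tb: "Tkind (b i) = b i" and Sb: "Skind (b i) = b i" for i by (auto simp: b_def)
  have Tdet: "map3 Tkind k \<in> det_triples" "map3 Tkind (map3 Tkind k) = k" "det_sign (map3 Tkind k) = - det_sign k"
    and Sdet: "map3 Skind k \<in> det_triples" "map3 Skind (map3 Skind k) = k" "det_sign (map3 Skind k) = - det_sign k"
    if "k \<in> det_triples" for k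
    using that unfolding det_triples_def
    by (elim insertE emptyE; simp add: map3_def det_sign_def)+
  have J: "(\<lambda>u. \<Sum>k\<in>det_triples. det_sign k * theta_prod (c k) u) \<in> jacobi_forms (real CARD('n) / 2) (rect_lattice N) d"
  proof (rule theta_combination_in_jacobi_forms[where \<alpha> = "map3 Tkind" and \<beta> = "map3 Skind" and w = w])
    show "N i > 0" for i by (simp add: N_def)
    show "kind_level \<circ> c k = N" if "k \<in> det_triples" for k
      using that by (auto simp: det_triples_def N_def c_def)
    show "bij_betw (map3 Tkind) det_triples det_triples"
      by (rule bij_betw_involutionI[OF Tdet(1,2)])
    show "bij_betw (map3 Skind) det_triples det_triples"
      by (rule bij_betw_involutionI[OF Sdet(1,2)])
    show "Tkind \<circ> c k = c (map3 Tkind k)" "Skind \<circ> c k = c (map3 Skind k)" for k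
      by (cases k; auto simp: c_def map3_def Tb Sb)+
    show "int CARD('n) - d = 2 * w" unfolding d w_def by simp
    fix k assume k: "k \<in> det_triples"
    obtain k1 k2 k3 where k_eq: "k = (k1, k2, k3)" by (cases k)
    have Tk: "Tmult k1 * Tmult k2 * Tmult k3 = exp (pi * \<i> / 4)" and Sk: "Smult k1 * Smult k2 * Smult k3 = 1"
      using k unfolding det_triples_def k_eq by (elim insertE emptyE; simp)+
    show "det_sign k * (\<Prod>i\<in>UNIV. Tmult (c k i)) = exp (pi * \<i> * of_int d / 12) * det_sign (map3 Tkind k)"
    proof -
      have "(\<Prod>i\<in>UNIV. Tmult (c k i)) = exp (pi * \<i> / 4) * exp (pi * \<i> * of_int (int (card I) + 2 * int (card A)) / 12)"
        unfolding k_eq split[of "\<lambda>_. Tmult"] Tk mult ..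
      also have "\<dots> = exp (pi * \<i> * of_int (int CARD('n) + 2 * int (card A)) / 12)"
        unfolding exp_add[symmetric] cardI by (rule arg_cong[of _ _ exp]) (simp add: field_simps)
      finally have 1: "(\<Prod>i\<in>UNIV. Tmult (c k i)) = exp (pi * \<i> * of_int (int CARD('n) + 2 * int (card A)) / 12)" .
      have "pi * \<i> * of_int (int CARD('n) + 12 + 2 * int (card A)) / 12 =
          pi * \<i> * of_int (int CARD('n) + 2 * int (card A)) / 12 + pi * \<i>" by (simp add: field_simps)
      hence "exp (pi * \<i> * of_int d / 12) = - exp (pi * \<i> * of_int (int CARD('n) + 2 * int (card A)) / 12)"
        unfolding exp_pi_12_cong[OF d] by (simp only: exp_add exp_pi_i) simp
      thus ?thesis unfolding 1 Tdet(3)[OF k] by simp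
    qed
    show "det_sign k * (\<Prod>i\<in>UNIV. Smult (c k i)) = \<i> powi w * det_sign (map3 Skind k)"
    proof -
      have 1: "(\<Prod>i\<in>UNIV. Smult (c k i)) = \<i> powi (- int (card A))"
        unfolding k_eq split[of "\<lambda>_. Smult"] Sk mult by simp
      have "\<i> powi w = \<i> powi (- int (card A)) * \<i> powi (- 6)"
        unfolding i_powi_cong[OF w_def] using power_int_add[of \<i> "- int (card A)" "- 6"] by simp
      also have "\<i> powi (- 6) = - 1"
      proof -
        have "\<i> powi (- int 6) = (- \<i>) ^ 6" by (rule i_powi_neg)
        also have "\<dots> = ((- \<i>)\<^sup>2) ^ 3" by (simp flip: power_mult)
        also have "\<dots> = - 1" by simp
        finally show ?thesis by simp
      qed
      finally show ?thesis unfolding 1 Sdet(3)[OF k] by simp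
    qed
  qed
  \<comment> \<open>At the values \<open>0, 1/2, 1\<close> of the three variables the rows of the determinant are
    \<open>(a, b', c')\<close>, \<open>(0, c', b')\<close>, \<open>(- a, b', c')\<close>, with the values \<open>a\<close>, \<open>b'\<close>, \<open>c'\<close> of \<open>Th2\<close>, \<open>Th3\<close>, \<open>Th4\<close> at \<open>\<tau> = \<i>\<close>, \<open>w = 0\<close>.\<close>
  define z :: "complex ^ 'n" where "z = (\<chi> i. if i = q \<or> i \<in> A then 1 / 2 else if i = r then 1 else 0)"
  have z: "z $ p = 0" "z $ q = 1 / 2" "z $ r = 1"
    using distinct A by (auto simp: z_def)
  define R where "R = (\<Prod>i\<in>I. theta_kind (b i) \<i> (z $ i))"
  have "theta_kind (b i) \<i> (z $ i) \<noteq> 0" if "i \<in> I" for i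
    using that theta_Th1_nonzero theta_Quint_nonzero by (simp add: b_def z_def I_def del: kind_coeff.simps)
  hence R: "R \<noteq> 0" by (simp add: R_def I_def)
  obtain a b' c' :: real where abc:
      "theta 4 (kind_coeff Th2) \<i> 0 = of_real a" "theta 4 (kind_coeff Th3) \<i> 0 = of_real b'" "theta 4 (kind_coeff Th4) \<i> 0 = of_real c'"
      "a > 0" "b' > c'" "b' > - c'" by (rule theta_nullvalues)
  have prod: "theta_prod (c (k1, k2, k3)) (\<i>, z) =
      theta_kind k1 \<i> 0 * theta_kind k2 \<i> (1 / 2) * theta_kind k3 \<i> 1 * R" for k1 k2 k3
    unfolding theta_prod_def fst_conv snd_conv R_def
    using split[of "\<lambda>i k. theta_kind k \<i> (z $ i)" k1 k2 k3] by (simp only: z)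
  have "(\<Sum>k\<in>det_triples. det_sign k * theta_prod (c k) (\<i>, z)) = of_real (2 * a * (c'\<^sup>2 - b'\<^sup>2)) * R"
    by (simp add: det_triples_def det_sign_def prod theta_values_half theta_values_1 abc power2_eq_square algebra_simps
        del: kind_coeff.simps)
  moreover have "2 * a * (c'\<^sup>2 - b'\<^sup>2) \<noteq> 0"
  proof -
    have "(b' - c') * (b' + c') > 0" using abc by (intro mult_pos_pos) auto
    hence "c'\<^sup>2 - b'\<^sup>2 < 0" by (simp add: power2_eq_square algebra_simps)
    thus ?thesis using abc(4) by simp
  qed
  ultimately have "(\<Sum>k\<in>det_triples. det_sign k * theta_prod (c k) (\<i>, z)) \<noteq> 0"
    using R by (metis mult_eq_0_iff of_real_eq_0_iff)
  moreover have "is_lattice_of_rank (rect_lattice N) CARD('n)" by (rule rect_lattice_rank) (simp add: N_def)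
  moreover have "even_lattice (rect_lattice N)" by (rule rect_lattice_even) (simp add: N_def)
  ultimately show ?thesis
    using J by (intro exI[of _ "rect_lattice N"] conjI
      bexI[of _ "\<lambda>u. \<Sum>k\<in>det_triples. det_sign k * theta_prod (c k) u"] exI[of _ \<i>] exI[of _ z]) simp_all
qed

theorem proposition3p7:
  fixes n :: nat and d :: int
  assumes dim: "CARD('n::finite) = n"
    and n: "(even n \<and> n \<ge> 8) \<or> (odd n \<and> n \<ge> 9)"
    and d: "d mod 2 = int n mod 2"
  shows "\<exists>L :: (real ^ 'n) set. is_lattice_of_rank L n \<and> even_lattice L \<and>
           (\<exists>\<phi>\<in>jacobi_forms (real n / 2) L d. \<exists>\<tau> z. Im \<tau> > 0 \<and> \<phi> (\<tau>, z) \<noteq> 0)"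
proof -
  have n8: "n \<ge> 8" using n by auto
  \<comment> \<open>Modulo \<open>24\<close>, the products reach \<open>d = n + 2 k\<close> for \<open>k \<le> 8\<close>, and the determinants for \<open>9 \<le> k \<le> 11\<close>.\<close>
  define e where "e = (d - int n) div 2"
  have e: "d = int n + 2 * e" using d unfolding e_def by presburger
  define k where "k = nat (e mod 12)"
  define t where "t = e div 12"
  have k: "e = int k + 12 * t" "k < 12" by (auto simp: k_def t_def)
  show ?thesis
  proof (cases "k \<le> 8")
    case True
    then obtain A :: "'n set" where A: "card A = k"
      using obtain_subset_with_card_n[of k "UNIV :: 'n set"] dim n8 by auto
    have "d = int CARD('n) + 2 * int (card A) + 24 * t" by (simp add: e k(1) A dim)
    from jacobi_form_of_products[OF this] show ?thesis unfolding dim .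
  next
    case False
    obtain P :: "'n set" where P: "card P = 3"
      using obtain_subset_with_card_n[of 3 "UNIV :: 'n set"] dim n8 by auto
    then obtain p q r where pqr: "P = {p, q, r}" "p \<noteq> q" "q \<noteq> r" "p \<noteq> r"
      by (auto simp: card_3_iff)
    have "card (UNIV - P) = n - 3" using P dim by (simp add: card_Diff_subset)
    hence "k - 6 \<le> card (UNIV - P)" using n8 k(2) by simp
    then obtain A where A: "A \<subseteq> UNIV - P" "card A = k - 6"
      using obtain_subset_with_card_n by metis
    have "int (k - 6) = int k - 6" using False by simp
    hence "d = int CARD('n) + 12 + 2 * int (card A) + 24 * t" by (simp add: e k(1) A(2) dim)
    from jacobi_form_of_determinant[OF pqr(2) pqr(4) pqr(3) _ this] A(1) show ?thesis
      unfolding dim pqr(1) by blast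
  qed
qed

end
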